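(* Let $j\ge0$ and let $V\in L^1_{j+1}$ be real-valued. Then for $0\le l\le j$ the functions $\frac{d^l}{dk^l}\big(T(k)-1\big)$ and $\frac{d^l}{dk^l}R_\pm(k)$ (as functions of $k\in\mathbb{R}$) belong to $\mathcal{A}$. (This holds in particular in the resonant case, i.e.\ when $Hf=0$ has a bounded solution.)
   Context: $H=-\frac{d^2}{dx^2}+V$, $L^1_\sigma$ is the space of functions with $\int(1+|x|)^\sigma|V|<\infty$. $\mathcal{A}$ is the Wiener algebra of functions $f(k)=\int_{\mathbb{R}}\mathrm{e}^{\mathrm{i}kp}\hat f(p)dp$, $\hat f\in L^1(\mathbb{R})$, with norm $\|\hat f\|_{L^1}$. $f_\pm(x,k)$ are the Jost solutions of $Hf=k^2f$ with $f_\pm(x,k)\sim\mathrm{e}^{\pm\mathrm{i}kx}$ as $x\to\pm\infty$. With $W(f,g)=fg'-f'g$, set $W(k)=W(f_-(\cdot,k),f_+(\cdot,k))$ and $W_\pm(k)=W(f_\mp(\cdot,k),f_\pm(\cdot,-k))$. The transmission and reflection coefficients are $T(k)=\frac{2\mathrm{i}k}{W(k)}$, $R_\pm(k)=\mp\frac{W_\pm(k)}{W(k)}$ for real $k\neq0$, extended continuously to $k=0$. *)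

theory Defs
  imports "HOL-Analysis.Analysis"
begin

definition L1_weighted :: "nat \<Rightarrow> (real \<Rightarrow> real) \<Rightarrow> bool" where
  "L1_weighted \<sigma> V \<longleftrightarrow> V \<in> borel_measurable lborel \<and>
     integrable lborel (\<lambda>x. (1 + \<bar>x\<bar>) ^ \<sigma> * \<bar>V x\<bar>)"

text \<open>y solves -y'' + V y = k^2 y in the Caratheodory sense: y is differentiable with
  derivative y', and y' is absolutely continuous with y'' = (V - k^2) y a.e.\<close>
definition ode_sol :: "(real \<Rightarrow> real) \<Rightarrow> real \<Rightarrow> (real \<Rightarrow> complex) \<Rightarrow> bool" where
  "ode_sol V k y \<longleftrightarrow> (\<exists>y'. (\<forall>x. (y has_vector_derivative y' x) (at x)) \<and>
     (\<forall>x. y' x = y' 0 + interval_lebesgue_integral lborel (ereal 0) (ereal x)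
                         (\<lambda>t. complex_of_real (V t - k\<^sup>2) * y t)))"

definition jost_plus_cond :: "(real \<Rightarrow> real) \<Rightarrow> real \<Rightarrow> (real \<Rightarrow> complex) \<Rightarrow> bool" where
  "jost_plus_cond V k y \<longleftrightarrow> ode_sol V k y \<and>
     ((\<lambda>x. y x - exp (\<i> * of_real k * of_real x)) \<longlongrightarrow> 0) at_top \<and>
     ((\<lambda>x. vector_derivative y (at x) - \<i> * of_real k * exp (\<i> * of_real k * of_real x))
        \<longlongrightarrow> 0) at_top"

definition jost_minus_cond :: "(real \<Rightarrow> real) \<Rightarrow> real \<Rightarrow> (real \<Rightarrow> complex) \<Rightarrow> bool" where
  "jost_minus_cond V k y \<longleftrightarrow> ode_sol V k y \<and>
     ((\<lambda>x. y x - exp (- \<i> * of_real k * of_real x)) \<longlongrightarrow> 0) at_bot \<and>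
     ((\<lambda>x. vector_derivative y (at x) + \<i> * of_real k * exp (- \<i> * of_real k * of_real x))
        \<longlongrightarrow> 0) at_bot"

definition jost_plus :: "(real \<Rightarrow> real) \<Rightarrow> real \<Rightarrow> real \<Rightarrow> complex" where
  "jost_plus V x k = (THE y. jost_plus_cond V k y) x"

definition jost_minus :: "(real \<Rightarrow> real) \<Rightarrow> real \<Rightarrow> real \<Rightarrow> complex" where
  "jost_minus V x k = (THE y. jost_minus_cond V k y) x"

text \<open>Wronskian W(f,g) = f g' - f' g (evaluated at x = 0; constant for solutions).\<close>
definition wronskian :: "(real \<Rightarrow> complex) \<Rightarrow> (real \<Rightarrow> complex) \<Rightarrow> complex" where
  "wronskian f g = f 0 * vector_derivative g (at 0) - vector_derivative f (at 0) * g 0"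

definition W0 :: "(real \<Rightarrow> real) \<Rightarrow> real \<Rightarrow> complex" where
  "W0 V k = wronskian (\<lambda>x. jost_minus V x k) (\<lambda>x. jost_plus V x k)"

definition W_plus :: "(real \<Rightarrow> real) \<Rightarrow> real \<Rightarrow> complex" where
  "W_plus V k = wronskian (\<lambda>x. jost_minus V x k) (\<lambda>x. jost_plus V x (- k))"

definition W_minus :: "(real \<Rightarrow> real) \<Rightarrow> real \<Rightarrow> complex" where
  "W_minus V k = wronskian (\<lambda>x. jost_plus V x k) (\<lambda>x. jost_minus V x (- k))"

definition transmission :: "(real \<Rightarrow> real) \<Rightarrow> real \<Rightarrow> complex" where
  "transmission V k = (if k = 0 then Lim (at 0) (\<lambda>q. 2 * \<i> * of_real q / W0 V q)
                       else 2 * \<i> * of_real k / W0 V k)"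

definition refl_plus :: "(real \<Rightarrow> real) \<Rightarrow> real \<Rightarrow> complex" where
  "refl_plus V k = (if k = 0 then Lim (at 0) (\<lambda>q. - W_plus V q / W0 V q)
                    else - W_plus V k / W0 V k)"

definition refl_minus :: "(real \<Rightarrow> real) \<Rightarrow> real \<Rightarrow> complex" where
  "refl_minus V k = (if k = 0 then Lim (at 0) (\<lambda>q. W_minus V q / W0 V q)
                     else W_minus V k / W0 V k)"

fun nth_deriv :: "nat \<Rightarrow> (real \<Rightarrow> complex) \<Rightarrow> real \<Rightarrow> complex" where
  "nth_deriv 0 f = f"
| "nth_deriv (Suc n) f = (\<lambda>k. vector_derivative (nth_deriv n f) (at k))"

definition differentiable_upto :: "nat \<Rightarrow> (real \<Rightarrow> complex) \<Rightarrow> bool" where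
  "differentiable_upto l f \<longleftrightarrow> (\<forall>m<l. \<forall>k. nth_deriv m f differentiable (at k))"

definition wiener_algebra :: "(real \<Rightarrow> complex) set" where
  "wiener_algebra = {f. \<exists>h :: real \<Rightarrow> complex. integrable lborel h \<and>
      (\<forall>k. f k = (LINT p|lborel. exp (\<i> * of_real k * of_real p) * h p))}"

end

theory Submission
  imports Defs "HOL-Complex_Analysis.Complex_Analysis" "HOL-Probability.Sinc_Integral"
begin

text \<open>
  The Jost solution has the form \<open>f\<^sub>+(x,k) = e\<^sup>i\<^sup>k\<^sup>x h(k,x)\<close> with
  \<open>h(k,x) = 1 + \<integral>\<^sub>0\<^sup>\<infinity> K(x,t) e\<^sup>2\<^sup>i\<^sup>k\<^sup>t dt\<close>, where the kernel satisfies
  \<open>\<bar>K(x,t)\<bar> \<le> C \<integral>\<^sub>x\<^sub>+\<^sub>t\<^sup>\<infinity> \<bar>V\<bar>\<close>. So for \<open>V \<in> L\<^sup>1\<^sub>j\<^sub>+\<^sub>1\<close> the values \<open>F(k) = h(k,0)\<close> and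
  \<open>G(k) = h'(k,0)\<close>, and likewise \<open>F'\<close>, \<open>G'\<close> for the reflected potential, have \<open>j\<close> derivatives in the Wiener
  algebra (modulo constants), and \<open>W = 2ikF'F + F'G + G'F\<close>. Since \<open>\<bar>W(k)\<bar>\<^sup>2 = 4k\<^sup>2 + \<bar>W\<^sub>+(k)\<bar>\<^sup>2\<close>, the
  Wronskian can vanish only at \<open>k = 0\<close>.

  If \<open>W(0) \<noteq> 0\<close>, multiply numerators and denominator by \<open>1/(1 - ik)\<close> and apply Wiener's lemma. If
  \<open>W(0) = 0\<close>, a factor \<open>k\<close> has to be cancelled without losing a moment of \<open>V\<close>: integrating the derivative
  of \<open>f(0,x) f'(k,x) - f'(0,x) f(k,x) - ik f(0,x) f(k,x)\<close> over \<open>[0,\<infinity>)\<close> gives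
  \<open>G(k) F(0) - F(k) G(0) = ik \<Psi>(k)\<close>, where \<open>\<Psi>\<close> again has \<open>j\<close> derivatives in the Wiener algebra. With this
  and its mirror image both Wronskians become \<open>k\<close> times such a function, and Wiener's lemma applies to \<open>W/k\<close>.

  Wiener's lemma is proved by Newman's argument: \<open>ft g = w + ft q\<close> with \<open>w\<close> smooth and
  \<open>q\<close> small in \<open>L\<^sup>1\<close>, and \<open>1/(1 + ft g) = \<Sum>\<^sub>n (- ft q)\<^sup>n (1 + w)\<^sup>-\<^sup>n\<^sup>-\<^sup>1\<close>, in which the norms of the powers
  of \<open>1/(1 + w)\<close> are estimated by two derivatives.
\<close>

section \<open>Fourier transforms of integrable functions\<close>

text \<open>The delicate point is the count of moments. One integration over a tail of
  \<open>V\<close> costs one moment, so j + 1 moments of \<open>V\<close> leave exactly j for the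
  kernel. The value F(k) has none to spare, and dividing F(k) - F(0) by k directly would cost one
  more. The combination G(k) F(0) - F(k) G(0) is, up to a multiple of k, the Wronskian of the Jost
  solutions at momenta 0 and k; the equation itself supplies the factor k there, and what remains
  costs only one tail integration. Newman's series converges because the Wiener norms of powers of
  1/(1 + w) grow like powers of the supremum, times a polynomial in the exponent;
  submultiplicativity of the Wiener norm would give no such control. As \<open>V\<close> is merely
  integrable, the derivative of a solution need not be differentiable everywhere; hence
  \<open>ac_deriv\<close>, a calculus of absolutely continuous functions given by integrals. The
  left Jost solution is never constructed separately: it is the right one for the reflected
  potential, a second instance of the same locale.\<close>

lemma borel_measurable_cis [measurable]: "cis \<in> borel_measurable borel"
  by (intro borel_measurable_continuous_onI continuous_intros)

lemma integrable_bounded_by: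
  fixes f :: "'a \<Rightarrow> 'b::{banach, second_countable_topology}" and g :: "'a \<Rightarrow> real"
  assumes "integrable M g" "f \<in> borel_measurable M" "\<And>x. norm (f x) \<le> g x"
  shows "integrable M f"
  by (rule Bochner_Integration.integrable_bound[OF assms(1,2)])
    (use assms(3) in \<open>auto intro!: AE_I2 intro: order_trans[OF _ abs_ge_self]\<close>)

lemma integrable_cis_mult:
  fixes h :: "'a \<Rightarrow> complex"
  assumes "integrable M h" "s \<in> borel_measurable M"
  shows "integrable M (\<lambda>x. cis (s x) * h x)"
  by (rule Bochner_Integration.integrable_bound[OF assms(1)]) (use assms in \<open>auto simp: norm_mult\<close>)

text \<open>The integral of \<open>wiener_algebra\<close> written with \<open>cis\<close>, whose
  modulus simplifies to 1.\<close>

definition ft :: "(real \<Rightarrow> complex) \<Rightarrow> real \<Rightarrow> complex" where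
  "ft h k = (LINT p|lborel. cis (k * p) * h p)"

lemma wiener_algebra_iff: "f \<in> wiener_algebra \<longleftrightarrow> (\<exists>h. integrable lborel h \<and> f = ft h)"
  by (auto simp: wiener_algebra_def ft_def fun_eq_iff cis_conv_exp mult_ac)

lemma norm_ft_le: "norm (ft h k) \<le> (LINT p|lborel. norm (h p))"
proof -
  have "norm (ft h k) \<le> (LINT p|lborel. norm (cis (k * p) * h p))"
    unfolding ft_def by (rule integral_norm_bound)
  then show ?thesis by (simp add: norm_mult)
qed

lemma ft_add: "integrable lborel g \<Longrightarrow> integrable lborel h \<Longrightarrow> ft (\<lambda>p. g p + h p) k = ft g k + ft h k"
  unfolding ft_def by (simp add: distrib_left integrable_cis_mult)

lemma ft_diff: "integrable lborel g \<Longrightarrow> integrable lborel h \<Longrightarrow> ft (\<lambda>p. g p - h p) k = ft g k - ft h k"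
  unfolding ft_def by (simp add: right_diff_distrib integrable_cis_mult)

lemma ft_cmult: "ft (\<lambda>p. c * h p) k = c * ft h k"
  unfolding ft_def by (simp add: mult.left_commute[of _ c])

lemma continuous_ft:
  assumes "integrable lborel h"
  shows "continuous_on A (ft h)"
proof -
  have "isCont (ft h) k" for k
    unfolding continuous_at_sequentially comp_def
  proof (intro allI impI)
    fix x assume x: "x \<longlonglongrightarrow> k"
    show "(\<lambda>n. ft h (x n)) \<longlonglongrightarrow> ft h k"
      unfolding ft_def
    proof (rule integral_dominated_convergence[where w="\<lambda>p. norm (h p)"])
      show "AE p in lborel. (\<lambda>n. cis (x n * p) * h p) \<longlonglongrightarrow> cis (k * p) * h p"
        using x by (intro AE_I2 tendsto_intros isCont_tendsto_compose[where g=cis]) (auto intro!: continuous_intros)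
    qed (use assms in \<open>auto simp: norm_mult\<close>)
  qed
  then show ?thesis by (simp add: continuous_at_imp_continuous_on)
qed

text \<open>For a fixed first coordinate the substitution is affine in the second, so Fubini reduces
  the claim to a one-dimensional change of variables with Jacobian \<open>\<bar>c\<bar>\<close>; of
  the shift \<open>s\<close> only measurability enters. It carries a density in (x, t) to one in (x,
  p) with p = s(x) + c t.\<close>

lemma shear_integral:
  fixes G :: "'a \<times> real \<Rightarrow> 'b::{banach, second_countable_topology}" and s :: "'a \<Rightarrow> real" and c :: real
  assumes M: "sigma_finite_measure M" and [measurable]: "s \<in> borel_measurable M" and c: "c \<noteq> 0"
    and G: "integrable (M \<Otimes>\<^sub>M lborel) G"
  shows "integrable (M \<Otimes>\<^sub>M lborel) (\<lambda>z. G (fst z, (snd z - s (fst z)) / c))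
      \<and> (\<integral>z. G (fst z, (snd z - s (fst z)) / c) \<partial>(M \<Otimes>\<^sub>M lborel)) = \<bar>c\<bar> *\<^sub>R (\<integral>z. G z \<partial>(M \<Otimes>\<^sub>M lborel))"
proof -
  interpret M: sigma_finite_measure M by fact
  interpret P: pair_sigma_finite M lborel ..
  have [measurable]: "G \<in> borel_measurable (M \<Otimes>\<^sub>M lborel)" using G by auto
  let ?G = "\<lambda>z. G (fst z, (snd z - s (fst z)) / c)"
  have "(\<integral>\<^sup>+z. norm (?G z) \<partial>(M \<Otimes>\<^sub>M lborel)) = (\<integral>\<^sup>+x. (\<integral>\<^sup>+p. norm (?G (x, p)) \<partial>lborel) \<partial>M)"
    by (rule lborel.nn_integral_fst[symmetric]) simp
  also have "\<dots> = (\<integral>\<^sup>+x. \<bar>c\<bar> * (\<integral>\<^sup>+p. norm (G (x, p)) \<partial>lborel) \<partial>M)"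
  proof (rule nn_integral_cong)
    fix x assume [measurable]: "x \<in> space M"
    show "(\<integral>\<^sup>+p. norm (?G (x, p)) \<partial>lborel) = \<bar>c\<bar> * (\<integral>\<^sup>+p. norm (G (x, p)) \<partial>lborel)"
      by (subst nn_integral_real_affine[where c=c and t="s x"]) (use c in auto)
  qed
  also have "\<dots> = \<bar>c\<bar> * (\<integral>\<^sup>+z. norm (G z) \<partial>(M \<Otimes>\<^sub>M lborel))"
    by (simp add: nn_integral_cmult lborel.nn_integral_fst[of "\<lambda>z. ennreal (norm (G z))" M])
  also have "\<dots> < \<infinity>"
    using G by (auto simp: integrable_iff_bounded ennreal_mult_less_top)
  finally have i: "integrable (M \<Otimes>\<^sub>M lborel) ?G"
    by (auto simp: integrable_iff_bounded)
  have "integral\<^sup>L (M \<Otimes>\<^sub>M lborel) ?G = (\<integral>x. (\<integral>p. ?G (x, p) \<partial>lborel) \<partial>M)"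
    using P.integral_fst'[OF i] by simp
  also have "\<dots> = (\<integral>x. \<bar>c\<bar> *\<^sub>R (\<integral>p. G (x, p) \<partial>lborel) \<partial>M)"
  proof (rule Bochner_Integration.integral_cong[OF refl])
    fix x
    show "(\<integral>p. ?G (x, p) \<partial>lborel) = \<bar>c\<bar> *\<^sub>R (\<integral>p. G (x, p) \<partial>lborel)"
      by (subst lborel_integral_real_affine[where c=c and t="s x"]) (use c in auto)
  qed
  also have "\<dots> = \<bar>c\<bar> *\<^sub>R (\<integral>z. G z \<partial>(M \<Otimes>\<^sub>M lborel))"
    using P.integral_fst'[OF G] by simp
  finally show ?thesis using i by simp
qed

text \<open>The density \<open>h\<close> arises by translating in the inner variable and integrating out the outer one.\<close>
lemma ft_superposition:
  fixes \<rho> :: "'a \<times> real \<Rightarrow> complex" and s :: "'a \<Rightarrow> real" and c :: real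
  assumes M: "sigma_finite_measure M" and [measurable]: "s \<in> borel_measurable M"
    and c: "c \<noteq> 0" and [measurable]: "\<rho> \<in> borel_measurable (M \<Otimes>\<^sub>M lborel)"
    and int: "integrable (M \<Otimes>\<^sub>M lborel) (\<lambda>z. (1 + \<bar>s (fst z) + c * snd z\<bar>) ^ j * norm (\<rho> z))"
  obtains h where "h \<in> borel_measurable lborel" "integrable lborel (\<lambda>p. (1 + \<bar>p\<bar>) ^ j * norm (h p))"
    "\<And>k. ft h k = (\<integral>z. cis (k * (s (fst z) + c * snd z)) * \<rho> z \<partial>(M \<Otimes>\<^sub>M lborel))"
    "(LINT p|lborel. (1 + \<bar>p\<bar>) ^ j * norm (h p))
       \<le> (\<integral>z. (1 + \<bar>s (fst z) + c * snd z\<bar>) ^ j * norm (\<rho> z) \<partial>(M \<Otimes>\<^sub>M lborel))"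
proof -
  interpret M: sigma_finite_measure M by fact
  interpret P: pair_sigma_finite M lborel ..
  define w where "w p = (1 + \<bar>p\<bar>) ^ j" for p :: real
  have w1: "w p \<ge> 1" for p by (simp add: w_def)
  have [simp]: "\<bar>w p\<bar> = w p" for p using w1[of p] by simp
  have [measurable]: "w \<in> borel_measurable borel" unfolding w_def by measurable
  note shear = shear_integral[OF M \<open>s \<in> borel_measurable M\<close> c]
  \<comment> \<open>The density in the coordinates (x, p) with p = s(x) + c t; dividing by
    \<open>\<bar>c\<bar>\<close> cancels the Jacobian of the shear.\<close>
  define r where "r z = \<rho> (fst z, (snd z - s (fst z)) / c) / of_real \<bar>c\<bar>" for z
  have [measurable]: "r \<in> borel_measurable (M \<Otimes>\<^sub>M lborel)" unfolding r_def by measurable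
  have sub: "w (snd z) * norm (r z) = (\<lambda>z. w (s (fst z) + c * snd z) * norm (\<rho> z) / \<bar>c\<bar>) (fst z, (snd z - s (fst z)) / c)" for z
    using c by (simp add: r_def norm_divide)
  have "integrable (M \<Otimes>\<^sub>M lborel) (\<lambda>z. w (s (fst z) + c * snd z) * norm (\<rho> z) / \<bar>c\<bar>)"
    using int unfolding w_def by (intro integrable_divide) auto
  from shear[OF this]
  have wr: "integrable (M \<Otimes>\<^sub>M lborel) (\<lambda>z. w (snd z) * norm (r z))"
    and wri: "(\<integral>z. w (snd z) * norm (r z) \<partial>(M \<Otimes>\<^sub>M lborel)) = (\<integral>z. w (s (fst z) + c * snd z) * norm (\<rho> z) \<partial>(M \<Otimes>\<^sub>M lborel))"
    unfolding sub using c by auto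
  have r: "integrable (M \<Otimes>\<^sub>M lborel) r"
    by (rule Bochner_Integration.integrable_bound[OF wr]) (use w1 in \<open>auto simp: mult_le_cancel_right1 abs_of_nonneg order_trans[OF zero_le_one w1]\<close>)
  have \<rho>: "integrable (M \<Otimes>\<^sub>M lborel) \<rho>"
    by (rule Bochner_Integration.integrable_bound[OF int]) (use w1 in \<open>auto simp: mult_le_cancel_right1 w_def[symmetric] abs_of_nonneg order_trans[OF zero_le_one w1]\<close>)
  define h where "h p = (\<integral>x. r (x, p) \<partial>M)" for p
  have hm[measurable]: "h \<in> borel_measurable lborel"
    unfolding h_def by measurable
  have wr': "integrable (M \<Otimes>\<^sub>M lborel) (\<lambda>(x, p). w p * norm (r (x, p)))"
    using wr by (simp add: case_prod_beta')
  have wrs: "integrable lborel (\<lambda>p. \<integral>x. w p * norm (r (x, p)) \<partial>M)"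
    using P.integrable_snd[OF wr'] .
  have bd: "w p * norm (h p) \<le> (\<integral>x. w p * norm (r (x, p)) \<partial>M)" for p
    unfolding h_def using w1[of p] by (simp add: mult_left_mono integral_norm_bound)
  have wh: "integrable lborel (\<lambda>p. w p * norm (h p))"
    by (rule Bochner_Integration.integrable_bound[OF wrs]) (use bd in \<open>auto simp: abs_mult\<close>)
  show ?thesis
  proof
    show "h \<in> borel_measurable lborel" by fact
    show "integrable lborel (\<lambda>p. (1 + \<bar>p\<bar>) ^ j * norm (h p))" using wh by (simp add: w_def)
    have "(LINT p|lborel. w p * norm (h p)) \<le> (LINT p|lborel. \<integral>x. w p * norm (r (x, p)) \<partial>M)"
      by (rule integral_mono[OF wh wrs bd])
    also have "\<dots> = (\<integral>z. w (snd z) * norm (r z) \<partial>(M \<Otimes>\<^sub>M lborel))"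
      using P.integral_snd[OF wr'] by (simp add: case_prod_beta')
    finally show "(LINT p|lborel. (1 + \<bar>p\<bar>) ^ j * norm (h p))
       \<le> (\<integral>z. (1 + \<bar>s (fst z) + c * snd z\<bar>) ^ j * norm (\<rho> z) \<partial>(M \<Otimes>\<^sub>M lborel))"
      unfolding wri by (simp add: w_def)
    fix k
    have ic: "integrable (M \<Otimes>\<^sub>M lborel) (\<lambda>z. cis (k * snd z) * r z)"
      using r by (rule integrable_cis_mult) measurable
    have ic': "integrable (M \<Otimes>\<^sub>M lborel) (\<lambda>(x,p). cis (k * p) * r (x,p))"
      using ic by (simp add: case_prod_beta')
    have "ft h k = (LINT p|lborel. \<integral>x. cis (k * p) * r (x, p) \<partial>M)"
      by (simp add: ft_def h_def)
    also have "\<dots> = (\<integral>z. cis (k * snd z) * r z \<partial>(M \<Otimes>\<^sub>M lborel))"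
      using P.integral_snd[OF ic'] by (simp add: case_prod_beta')
    also have "\<dots> = (\<integral>z. (\<lambda>z. cis (k * (s (fst z) + c * snd z)) * \<rho> z / of_real \<bar>c\<bar>) (fst z, (snd z - s (fst z)) / c) \<partial>(M \<Otimes>\<^sub>M lborel))"
      using c by (intro Bochner_Integration.integral_cong) (auto simp: r_def)
    also have "\<dots> = \<bar>c\<bar> *\<^sub>R (\<integral>z. cis (k * (s (fst z) + c * snd z)) * \<rho> z / of_real \<bar>c\<bar> \<partial>(M \<Otimes>\<^sub>M lborel))"
      using \<rho> by (intro conjunct2[OF shear] integrable_divide integrable_cis_mult) measurable
    also have "\<dots> = (\<integral>z. cis (k * (s (fst z) + c * snd z)) * \<rho> z \<partial>(M \<Otimes>\<^sub>M lborel))"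
      using c by (simp add: scaleR_conv_of_real)
    finally show "ft h k = (\<integral>z. cis (k * (s (fst z) + c * snd z)) * \<rho> z \<partial>(M \<Otimes>\<^sub>M lborel))" .
  qed
qed

lemma (in pair_sigma_finite) integrable_product_mult:
  fixes u :: "_ \<Rightarrow> 'c::{real_normed_field, banach, second_countable_topology}"
  assumes u: "integrable M1 u" and v: "integrable M2 v"
  shows "integrable (M1 \<Otimes>\<^sub>M M2) (\<lambda>z. u (fst z) * v (snd z))"
    "(\<integral>z. u (fst z) * v (snd z) \<partial>(M1 \<Otimes>\<^sub>M M2)) = (\<integral>x. u x \<partial>M1) * (\<integral>x. v x \<partial>M2)"
proof -
  have [measurable]: "u \<in> borel_measurable M1" "v \<in> borel_measurable M2" using u v by auto
  have "(\<integral>\<^sup>+z. norm (u (fst z) * v (snd z)) \<partial>(M1 \<Otimes>\<^sub>M M2)) =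
      (\<integral>\<^sup>+x. (\<integral>\<^sup>+y. ennreal (norm (u x)) * ennreal (norm (v y)) \<partial>M2) \<partial>M1)"
    by (subst M2.nn_integral_fst[symmetric]) (auto simp: norm_mult ennreal_mult)
  also have "\<dots> = (\<integral>\<^sup>+x. norm (u x) \<partial>M1) * (\<integral>\<^sup>+x. norm (v x) \<partial>M2)"
    by (simp add: nn_integral_cmult nn_integral_multc)
  also have "\<dots> < \<infinity>" using u v by (auto simp: integrable_iff_bounded ennreal_mult_less_top)
  finally show i: "integrable (M1 \<Otimes>\<^sub>M M2) (\<lambda>z. u (fst z) * v (snd z))"
    by (simp add: integrable_iff_bounded)
  show "(\<integral>z. u (fst z) * v (snd z) \<partial>(M1 \<Otimes>\<^sub>M M2)) = (\<integral>x. u x \<partial>M1) * (\<integral>x. v x \<partial>M2)"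
    using integral_fst'[OF i] by simp
qed

lemmas integrable_pair_mult = lborel_pair.integrable_product_mult

text \<open>Convolution is the superposition of the tensor product of \<open>g\<close> and
  \<open>h\<close> along p = x + t, so \<open>ft_superposition\<close> with weight exponent 0 yields
  the product formula and Young's inequality for the L^1 norm at once.\<close>

lemma ft_convolution:
  assumes g: "integrable lborel g" and h: "integrable lborel h"
  obtains u where "integrable lborel u" "\<And>k. ft u k = ft g k * ft h k"
    "(LINT p|lborel. norm (u p)) \<le> (LINT p|lborel. norm (g p)) * (LINT p|lborel. norm (h p))"
proof -
  have [measurable]: "g \<in> borel_measurable lborel" "h \<in> borel_measurable lborel" using g h by auto
  let ?\<rho> = "\<lambda>z. g (fst z) * h (snd z)"
  have *: "integrable (lborel \<Otimes>\<^sub>M lborel) (\<lambda>z. (1 + \<bar>fst z + 1 * snd z\<bar>) ^ 0 * norm (?\<rho> z))"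
    using integrable_pair_mult(1)[OF g h] by simp
  obtain u where u: "u \<in> borel_measurable lborel" "integrable lborel (\<lambda>p. (1 + \<bar>p\<bar>) ^ 0 * norm (u p))"
    "\<And>k. ft u k = (\<integral>z. cis (k * (fst z + 1 * snd z)) * ?\<rho> z \<partial>(lborel \<Otimes>\<^sub>M lborel))"
    "(LINT p|lborel. (1 + \<bar>p\<bar>) ^ 0 * norm (u p))
       \<le> (\<integral>z. (1 + \<bar>fst z + 1 * snd z\<bar>) ^ 0 * norm (?\<rho> z) \<partial>(lborel \<Otimes>\<^sub>M lborel))"
    by (rule ft_superposition[OF lborel.sigma_finite_measure_axioms _ _ _ *]) auto
  show ?thesis
  proof
    show "integrable lborel u" using u(1,2) by (simp add: integrable_norm_iff)
    show "ft u k = ft g k * ft h k" for k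
    proof -
      have "ft u k = (\<integral>z. (cis (k * fst z) * g (fst z)) * (cis (k * snd z) * h (snd z)) \<partial>(lborel \<Otimes>\<^sub>M lborel))"
        unfolding u(3) by (intro Bochner_Integration.integral_cong) (auto simp: distrib_left cis_mult[symmetric])
      also have "\<dots> = ft g k * ft h k"
        unfolding ft_def
        by (rule integrable_pair_mult(2)[OF integrable_cis_mult[OF g, of "\<lambda>p. k * p"] integrable_cis_mult[OF h, of "\<lambda>p. k * p"]]) auto
      finally show ?thesis .
    qed
    show "(LINT p|lborel. norm (u p)) \<le> (LINT p|lborel. norm (g p)) * (LINT p|lborel. norm (h p))"
      using u(4) integrable_pair_mult(2)[OF integrable_norm[OF g] integrable_norm[OF h]] by (simp add: norm_mult)
  qed
qed

section \<open>Absolutely continuous functions\<close>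

text \<open>Local absolute continuity, encoded by the fundamental theorem on compact intervals. The
  function \<open>u\<close> matters only up to null sets, which suits y'' = (V - k^2) y with an
  integrable \<open>V\<close>.\<close>

definition ac_deriv :: "(real \<Rightarrow> complex) \<Rightarrow> (real \<Rightarrow> complex) \<Rightarrow> bool" where
  "ac_deriv F u \<longleftrightarrow> (\<forall>a b. integrable lborel (\<lambda>x. indicator {a..b} x *\<^sub>R u x)) \<and>
     (\<forall>a b. a \<le> b \<longrightarrow> F b - F a = (LINT x|lborel. indicator {a..b} x *\<^sub>R u x))"

lemma ac_derivD:
  assumes "ac_deriv F u"
  shows "integrable lborel (\<lambda>x. indicator {a..b} x *\<^sub>R u x)"
    "a \<le> b \<Longrightarrow> F b - F a = (LINT x|lborel. indicator {a..b} x *\<^sub>R u x)"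
  using assms by (auto simp: ac_deriv_def)

lemma ac_deriv_vector_derivative:
  assumes "\<And>x. (F has_vector_derivative u x) (at x)" "continuous_on UNIV u"
  shows "ac_deriv F u"
  unfolding ac_deriv_def
proof (intro conjI allI impI)
  fix a b :: real
  have c: "continuous_on {a..b} u" using assms(2) continuous_on_subset by blast
  show "integrable lborel (\<lambda>x. indicator {a..b} x *\<^sub>R u x)"
    using borel_integrable_atLeastAtMost'[OF c] by (simp add: set_integrable_def)
  assume "a \<le> b"
  then show "F b - F a = (LINT x|lborel. indicator {a..b} x *\<^sub>R u x)"
    using c by (intro integral_FTC_atLeastAtMost[symmetric] has_vector_derivative_at_within[OF assms(1)])
qed

lemma ac_deriv_cong: "ac_deriv F u \<Longrightarrow> (\<And>x. u x = v x) \<Longrightarrow> ac_deriv F v"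
  by (simp add: ac_deriv_def)

lemma ac_deriv_add: "ac_deriv F u \<Longrightarrow> ac_deriv G v \<Longrightarrow> ac_deriv (\<lambda>x. F x + G x) (\<lambda>x. u x + v x)"
proof -
  assume F: "ac_deriv F u" and G: "ac_deriv G v"
  note i = ac_derivD(1)[OF F] ac_derivD(1)[OF G]
  have "F b + G b - (F a + G a) = (LINT x|lborel. indicator {a..b} x *\<^sub>R (u x + v x))" if "a \<le> b" for a b
  proof -
    have "F b + G b - (F a + G a) = (F b - F a) + (G b - G a)" by simp
    then show ?thesis unfolding ac_derivD(2)[OF F that] ac_derivD(2)[OF G that] scaleR_add_right
      by (simp only: Bochner_Integration.integral_add[OF i])
  qed
  then show ?thesis using i by (simp add: ac_deriv_def scaleR_add_right)
qed

lemma ac_deriv_cmult: "ac_deriv F u \<Longrightarrow> ac_deriv (\<lambda>x. c * F x) (\<lambda>x. c * u x)"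
proof -
  assume F: "ac_deriv F u"
  have eq: "indicator A x *\<^sub>R (c * u x) = c * (indicator A x *\<^sub>R u x)" for A x
    by (rule mult_scaleR_right[symmetric])
  show ?thesis
    unfolding ac_deriv_def eq
    using F by (auto simp only: ac_deriv_def integral_mult_right_zero right_diff_distrib[symmetric] integrable_mult_right)
qed

lemma ac_deriv_diff: "ac_deriv F u \<Longrightarrow> ac_deriv G v \<Longrightarrow> ac_deriv (\<lambda>x. F x - G x) (\<lambda>x. u x - v x)"
  using ac_deriv_add[of F u "\<lambda>x. - 1 * G x" "\<lambda>x. - 1 * v x"] ac_deriv_cmult[of G v "- 1"] by simp

lemma ac_deriv_zero_imp_const:
  assumes "ac_deriv F (\<lambda>_. 0)"
  shows "F x = F y"
  using ac_derivD(2)[OF assms, of x y] ac_derivD(2)[OF assms, of y x] by (cases "x \<le> y") auto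

lemma ac_deriv_continuous:
  assumes "ac_deriv F u"
  shows "continuous_on UNIV F"
proof -
  have "isCont F x" for x
  proof -
    let ?a = "x - 1" and ?b = "x + 1"
    have i: "set_integrable lborel {?a..?b} u" using ac_derivD(1)[OF assms] by (simp add: set_integrable_def)
    have F: "F y = F ?a + integral {?a..y} u" if "y \<in> {?a..?b}" for y
    proof -
      have "set_integrable lborel {?a..y} u" by (rule set_integrable_subset[OF i]) (use that in auto)
      then have "(LINT x|lborel. indicator {?a..y} x *\<^sub>R u x) = integral {?a..y} u"
        using set_borel_integral_eq_integral(2) by (auto simp: set_lebesgue_integral_def)
      then show ?thesis using ac_derivD(2)[OF assms, of ?a y] that by (simp add: algebra_simps)
    qed
    have "continuous_on {?a..?b} (\<lambda>y. F ?a + integral {?a..y} u)"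
      by (intro continuous_intros indefinite_integral_continuous_1 set_borel_integral_eq_integral(1)[OF i])
    then have "continuous_on {?a..?b} F" by (rule continuous_on_eq) (rule F[symmetric])
    then have "continuous_on {?a<..<?b} F" by (rule continuous_on_subset) auto
    then show ?thesis by (simp add: continuous_on_eq_continuous_at)
  qed
  then show ?thesis by (simp add: continuous_at_imp_continuous_on)
qed

lemma integrable_indicator_mult_continuous:
  fixes u G :: "real \<Rightarrow> complex"
  assumes u: "integrable lborel (\<lambda>x. indicator {a..b} x *\<^sub>R u x)" and G: "continuous_on UNIV G"
  shows "integrable lborel (\<lambda>x. indicator {a..b} x *\<^sub>R (u x * G x))"
proof -
  have "compact (G ` {a..b})"
    by (intro compact_continuous_image continuous_on_subset[OF G]) auto
  then obtain B where B: "\<And>x. x \<in> {a..b} \<Longrightarrow> norm (G x) \<le> B"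
    by (metis compact_imp_bounded bounded_iff image_eqI)
  have [measurable]: "G \<in> borel_measurable borel" by (rule borel_measurable_continuous_onI[OF G])
  show ?thesis
  proof (rule integrable_bounded_by)
    show "integrable lborel (\<lambda>x. B * norm (indicator {a..b} x *\<^sub>R u x))"
      by (intro integrable_mult_right integrable_norm u)
    show "(\<lambda>x. indicator {a..b} x *\<^sub>R (u x * G x)) \<in> borel_measurable lborel"
      using borel_measurable_times[OF borel_measurable_integrable[OF u], of G] by simp
    show "norm (indicator {a..b} x *\<^sub>R (u x * G x)) \<le> B * norm (indicator {a..b} x *\<^sub>R u x)" for x
      using mult_left_mono[OF B[of x], of "norm (u x)"] by (cases "x \<in> {a..b}") (auto simp: norm_mult mult.commute)
  qed
qed

text \<open>On [a, b] the factor \<open>G\<close> is expanded from the left endpoint and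
  \<open>F\<close> from the right one. Both corrections are integrals of u(x) v(s) over the triangle
  s <= x, and they cancel by Fubini. No pointwise derivative is used.\<close>

lemma ac_deriv_mult:
  assumes F: "ac_deriv F u" and G: "ac_deriv G v"
  shows "ac_deriv (\<lambda>x. F x * G x) (\<lambda>x. u x * G x + F x * v x)"
proof -
  have i: "integrable lborel (\<lambda>x. indicator {a..b} x *\<^sub>R (u x * G x))"
    "integrable lborel (\<lambda>x. indicator {a..b} x *\<^sub>R (v x * F x))" for a b
    by (intro integrable_indicator_mult_continuous ac_derivD(1)[OF F] ac_derivD(1)[OF G] ac_deriv_continuous[OF F] ac_deriv_continuous[OF G])+
  have "F b * G b - F a * G a = (LINT x|lborel. indicator {a..b} x *\<^sub>R (u x * G x + F x * v x))" if ab: "a \<le> b" for a b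
  proof -
    define U where "U x = indicator {a..b} x *\<^sub>R u x" for x
    define V where "V x = indicator {a..b} x *\<^sub>R v x" for x
    have iU: "integrable lborel U" and iV: "integrable lborel V"
      unfolding U_def[abs_def] V_def[abs_def] using F G by (auto intro: ac_derivD)
    have [measurable]: "U \<in> borel_measurable borel" "V \<in> borel_measurable borel" using iU iV by auto
    let ?T = "\<lambda>x s. if s \<le> x then U x * V s else 0"
    have iT: "integrable (lborel \<Otimes>\<^sub>M lborel) (\<lambda>(x, s). ?T x s)"
      by (rule Bochner_Integration.integrable_bound[OF integrable_pair_mult(1)[OF iU iV]]) (auto split: split_indicator)
    have eG: "U x * G x = U x * G a + (LINT s|lborel. ?T x s)" for x
    proof (cases "x \<in> {a..b}")
      case True
      then have T: "?T x s = U x * (indicator {a..x} s *\<^sub>R v s)" for s by (auto simp: V_def indicator_def)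
      have "(LINT s|lborel. ?T x s) = U x * (G x - G a)"
        unfolding T integral_mult_right_zero using True by (simp add: ac_derivD(2)[OF G])
      then show ?thesis by (simp add: algebra_simps)
    qed (simp add: U_def cong: if_cong)
    have eF: "F s * V s = F b * V s - (LINT x|lborel. ?T x s)" for s
    proof (cases "s \<in> {a..b}")
      case True
      then have T: "?T x s = (indicator {s..b} x *\<^sub>R u x) * V s" for x by (auto simp: U_def indicator_def)
      have "(LINT x|lborel. ?T x s) = (F b - F s) * V s"
        unfolding T integral_mult_left_zero using True by (simp add: ac_derivD(2)[OF F])
      then show ?thesis by (simp add: algebra_simps)
    qed (simp add: V_def cong: if_cong)
    have iT1: "integrable lborel (\<lambda>x. LINT s|lborel. ?T x s)" and iT2: "integrable lborel (\<lambda>s. LINT x|lborel. ?T x s)"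
      using lborel_pair.integrable_fst[OF iT] lborel_pair.integrable_snd[OF iT] by simp_all
    have "(LINT x|lborel. indicator {a..b} x *\<^sub>R (u x * G x + F x * v x)) = (LINT x|lborel. U x * G x + F x * V x)"
      by (intro Bochner_Integration.integral_cong) (auto simp: U_def V_def scaleR_add_right)
    also have "\<dots> = (LINT x|lborel. (U x * G a + (LINT s|lborel. ?T x s)) + (F b * V x - (LINT y|lborel. ?T y x)))"
      unfolding eG eF ..
    also have "\<dots> = (LINT x|lborel. U x) * G a + F b * (LINT x|lborel. V x)"
      using iU iV iT1 iT2 lborel_pair.Fubini_integral[OF iT] by simp
    also have "\<dots> = F b * G b - F a * G a"
      using ac_derivD(2)[OF F ab] ac_derivD(2)[OF G ab] by (simp add: U_def V_def algebra_simps)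
    finally show ?thesis ..
  qed
  then show ?thesis using i by (auto simp: ac_deriv_def scaleR_add_right mult.commute)
qed

lemma ac_deriv_limit_at_top:
  assumes F: "ac_deriv F u" and i: "integrable lborel (\<lambda>x. indicator {a..} x *\<^sub>R u x)" and l: "(F \<longlongrightarrow> L) at_top"
  shows "L - F a = (LINT x|lborel. indicator {a..} x *\<^sub>R u x)"
proof -
  have "((\<lambda>y. LINT x|lborel. indicator {..y} x *\<^sub>R (indicator {a..} x *\<^sub>R u x)) \<longlongrightarrow>
      (LINT x|lborel. indicator {a..} x *\<^sub>R u x)) at_top"
    by (rule tendsto_integral_at_top[OF _ i]) simp
  moreover have "eventually (\<lambda>y. (LINT x|lborel. indicator {..y} x *\<^sub>R (indicator {a..} x *\<^sub>R u x)) = F y - F a) at_top"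
    using eventually_ge_at_top[of a]
  proof eventually_elim
    case (elim y)
    have "(LINT x|lborel. indicator {..y} x *\<^sub>R (indicator {a..} x *\<^sub>R u x)) = (LINT x|lborel. indicator {a..y} x *\<^sub>R u x)"
      by (intro Bochner_Integration.integral_cong) (auto split: split_indicator)
    then show ?case using ac_derivD(2)[OF F elim] by simp
  qed
  ultimately have "((\<lambda>y. F y - F a) \<longlongrightarrow> (LINT x|lborel. indicator {a..} x *\<^sub>R u x)) at_top"
    by (rule Lim_transform_eventually)
  moreover have "((\<lambda>y. F y - F a) \<longlongrightarrow> L - F a) at_top" by (intro tendsto_intros l)
  ultimately show ?thesis using tendsto_unique trivial_limit_at_top_linorder by blast
qed

text \<open>The link to \<open>ode_sol\<close>, which uses the oriented integral from 0 to x, for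
  negative x as well.\<close>

lemma ac_deriv_interval_integral_iff:
  assumes i: "\<And>a b. integrable lborel (\<lambda>x. indicator {a..b} x *\<^sub>R u x)"
  shows "ac_deriv F u \<longleftrightarrow> (\<forall>x. F x = F 0 + interval_lebesgue_integral lborel (ereal 0) (ereal x) u)"
proof -
  have ii: "interval_lebesgue_integral lborel (ereal a) (ereal b) u = (LINT x|lborel. indicator {a..b} x *\<^sub>R u x)" if "a \<le> b" for a b
    using that by (simp add: interval_integral_Icc set_lebesgue_integral_def)
  show ?thesis
  proof
    assume F: "ac_deriv F u"
    show "\<forall>x. F x = F 0 + interval_lebesgue_integral lborel (ereal 0) (ereal x) u"
    proof
      fix x :: real
      show "F x = F 0 + interval_lebesgue_integral lborel (ereal 0) (ereal x) u"
      proof (cases "0 \<le> x")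
        case True
        then show ?thesis using ac_derivD(2)[OF F True] ii[OF True] by (simp add: algebra_simps)
      next
        case False
        then have "x \<le> 0" by simp
        then show ?thesis using ac_derivD(2)[OF F \<open>x \<le> 0\<close>] ii[OF \<open>x \<le> 0\<close>]
          by (subst interval_integral_endpoints_reverse) (simp add: algebra_simps)
      qed
    qed
  next
    assume F: "\<forall>x. F x = F 0 + interval_lebesgue_integral lborel (ereal 0) (ereal x) u"
    have li: "interval_lebesgue_integrable lborel (ereal a) (ereal b) u" for a b
    proof -
      have "set_integrable lborel {min a b..max a b} u" using i by (simp add: set_integrable_def)
      then have "set_integrable lborel (einterval (ereal (min a b)) (ereal (max a b))) u"
        by (rule set_integrable_subset) (auto simp: einterval_iff min_def max_def split: if_splits)
      then show ?thesis by (auto simp: interval_lebesgue_integrable_def min_def max_def split: if_splits)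
    qed
    have "F b - F a = (LINT x|lborel. indicator {a..b} x *\<^sub>R u x)" if "a \<le> b" for a b
    proof -
      have "interval_lebesgue_integral lborel (ereal 0) (ereal a) u + interval_lebesgue_integral lborel (ereal a) (ereal b) u
          = interval_lebesgue_integral lborel (ereal 0) (ereal b) u"
        by (rule interval_integral_sum) (auto simp: min_def max_def intro: li)
      then show ?thesis using F[rule_format, of a] F[rule_format, of b] ii[OF that] by (simp add: algebra_simps)
    qed
    then show "ac_deriv F u" using i by (auto simp: ac_deriv_def)
  qed
qed

lemma has_vector_derivative_reflect:
  assumes "(f has_vector_derivative f') (at (- x :: real))"
  shows "((\<lambda>x. f (- x)) has_vector_derivative - f') (at x)"
  using vector_diff_chain_at[OF has_vector_derivative_minus[OF has_vector_derivative_id] assms] by (simp add: o_def)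

section \<open>Inversion through the resolvent of the second derivative\<close>

lemma integral_uminus_lborel:
  fixes f :: "real \<Rightarrow> 'a::{banach, second_countable_topology}"
  shows "(LINT x|lborel. f (- x)) = (LINT x|lborel. f (x::real))"
  using lborel_integral_real_affine[of "-1" f 0] by simp

lemma integrable_uminus_lborel:
  fixes f :: "real \<Rightarrow> 'a::{banach, second_countable_topology}"
  shows "integrable lborel f \<Longrightarrow> integrable lborel (\<lambda>x. f (- x))"
  using lborel_integrable_real_affine[of f "-1" 0] by simp

section \<open>Explicit transform pairs: exponential, Laplace and Cauchy densities\<close>

lemma exp_decay_integral:
  "integrable lborel (\<lambda>p. indicator {0..} p * exp (- p) :: real)"
  "(LINT p|lborel. indicator {0..} p * exp (- p) :: real) = 1"
proof -
  have "(\<integral>\<^sup>+p. ennreal (exp (- p)) * indicator {0..} p \<partial>lborel) = ennreal (0 - (- exp (- 0)))"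
  proof (rule nn_integral_FTC_atLeast[where F="\<lambda>p. - exp (- p)"])
    show "((\<lambda>p. - exp (- p)) \<longlongrightarrow> (0::real)) at_top" by real_asymp
  qed (auto intro!: derivative_eq_intros)
  then have *: "(\<integral>\<^sup>+p. ennreal (indicator {0..} p * exp (- p)) \<partial>lborel) = ennreal 1"
    by (simp add: ennreal_mult' mult.commute ennreal_indicator)
  show "integrable lborel (\<lambda>p. indicator {0..} p * exp (- p) :: real)"
    by (rule integrableI_nonneg) (use * in auto)
  show "(LINT p|lborel. indicator {0..} p * exp (- p) :: real) = 1"
    by (subst integral_eq_nn_integral) (use * in auto)
qed

text \<open>Its transform is 1/(1 - ik). It serves as one half of the Laplace density and later as
  the multiplier that compensates the linear growth of the Wronskian.\<close>

definition exp_decay :: "real \<Rightarrow> complex" where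
  "exp_decay p = of_real (indicator {0..} p * exp (- p))"

lemma integrable_exp_decay: "integrable lborel exp_decay"
  unfolding exp_decay_def by (intro integrable_of_real exp_decay_integral)

lemma ft_exp_decay: "ft exp_decay k = 1 / (1 - \<i> * of_real k)"
proof -
  define c where "c = \<i> * of_real k - 1"
  have c: "c \<noteq> 0" by (auto simp: c_def complex_eq_iff)
  have eq: "cis (k * p) * exp_decay p = indicator {0..} p *\<^sub>R exp (c * of_real p)" for p
    by (auto simp: exp_decay_def c_def cis_conv_exp exp_of_real[symmetric] exp_add[symmetric] algebra_simps split: split_indicator)
  have "0 - exp (c * of_real 0) / c = (LINT p|lborel. indicator {0..} p *\<^sub>R exp (c * of_real p))"
  proof (rule ac_deriv_limit_at_top[OF ac_deriv_vector_derivative])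
    show "((\<lambda>x. exp (c * of_real x) / c) has_vector_derivative exp (c * of_real x)) (at x)" for x
    proof (rule has_vector_derivative_real_field)
      show "((\<lambda>z. exp (c * z) / c) has_field_derivative exp (c * of_real x)) (at (of_real x))"
        using c by (auto intro!: derivative_eq_intros)
    qed
    show "integrable lborel (\<lambda>x. indicator {0..} x *\<^sub>R exp (c * of_real x))"
      unfolding eq[symmetric] by (intro integrable_cis_mult integrable_exp_decay) auto
    have "((\<lambda>x. exp (- x) / cmod c) \<longlongrightarrow> 0) at_top"
      using c by real_asymp
    moreover have "norm (exp (c * of_real x) / c) = exp (- x) / cmod c" for x
      by (simp add: norm_divide c_def)
    ultimately show "((\<lambda>x. exp (c * of_real x) / c) \<longlongrightarrow> 0) at_top"
      by (simp add: tendsto_norm_zero_iff[symmetric, of "\<lambda>x. exp (c * of_real x) / c"])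
  qed (auto intro!: continuous_intros)
  then show ?thesis
    using c unfolding ft_def eq by (simp add: c_def field_simps flip: eq)
qed

lemma ft_reflect: "ft (\<lambda>p. h (- p)) k = ft h (- k)"
  unfolding ft_def using integral_uminus_lborel[of "\<lambda>p. cis (- k * p) * h p"] by simp

text \<open>The Green's function of 1 - d^2/dx^2 on the line and at the same time a probability
  density; the second property makes it a mollifier in \<open>ft_mollify\<close>.\<close>

definition laplace :: "real \<Rightarrow> real" where "laplace p = exp (- \<bar>p\<bar>) / 2"

text \<open>At 0 both one-sided exponentials are 1 and the right-hand side is twice too large; hence
  the almost-everywhere arguments below.\<close>

lemma laplace_eq: "p \<noteq> 0 \<Longrightarrow> of_real (laplace p) = exp_decay p / 2 + exp_decay (- p) / 2"
  by (auto simp: laplace_def exp_decay_def split: split_indicator)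

lemma laplace_measurable [measurable]: "laplace \<in> borel_measurable borel"
  unfolding laplace_def by measurable

lemma laplace_pos: "laplace p > 0" by (simp add: laplace_def)

lemma AE_lborel_neq_0: "AE x in lborel. x \<noteq> (0::real)"
  by (rule AE_lborel_singleton)

lemma integrable_laplace: "integrable lborel laplace"
proof -
  have "integrable lborel (\<lambda>p. of_real (laplace p) :: complex)"
    using integrable_exp_decay integrable_uminus_lborel[OF integrable_exp_decay]
    by (subst integrable_cong_AE[where g="\<lambda>p. exp_decay p / 2 + exp_decay (- p) / 2"])
       (use AE_lborel_neq_0 in \<open>auto simp: laplace_eq elim!: eventually_mono\<close>)
  from integrable_norm[OF this] show ?thesis using laplace_pos by (simp add: less_imp_le)
qed

lemma ft_laplace: "ft (\<lambda>p. of_real (laplace p)) k = 1 / (1 + of_real (k\<^sup>2))"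
proof -
  have i: "integrable lborel exp_decay" "integrable lborel (\<lambda>p. exp_decay (- p))"
    using integrable_exp_decay integrable_uminus_lborel[OF integrable_exp_decay] .
  have "ft (\<lambda>p. of_real (laplace p)) k = ft (\<lambda>p. 1/2 * exp_decay p + 1/2 * exp_decay (- p)) k"
    unfolding ft_def
    by (rule integral_cong_AE) (use AE_lborel_neq_0 i in \<open>auto simp: laplace_eq elim!: eventually_mono\<close>)
  also have "\<dots> = 1/2 * ft exp_decay k + 1/2 * ft exp_decay (- k)"
    using i by (subst ft_add) (simp_all only: ft_cmult ft_reflect integrable_mult_right)
  also have "\<dots> = 1 / (1 + of_real (k\<^sup>2))"
  proof -
    have "1 - \<i> * of_real k \<noteq> 0" "1 + \<i> * of_real k \<noteq> 0" by (auto simp: complex_eq_iff)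
    moreover have "1 + of_real (k\<^sup>2) = (1 - \<i> * of_real k) * (1 + \<i> * of_real k)"
      by (simp add: algebra_simps power2_eq_square)
    moreover have "1/2 * (1/a) + 1/2 * (1/b) = 1 / (a * b)" if "a \<noteq> 0" "b \<noteq> 0" "a + b = 2" for a b :: complex
    proof -
      have "1/2 * (1/a) + 1/2 * (1/b) = (a + b) / (2 * (a * b))" using that(1,2) by (simp add: field_simps)
      then show ?thesis using that(3) by simp
    qed
    from this[of "1 - \<i> * of_real k" "1 + \<i> * of_real k"] calculation
    show ?thesis by (simp only: ft_exp_decay) simp
  qed
  finally show ?thesis .
qed

lemma laplace_integral: "(LINT p|lborel. laplace p) = 1"
proof -
  have "complex_of_real (LINT p|lborel. laplace p) = ft (\<lambda>p. of_real (laplace p)) 0"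
    by (simp add: ft_def integral_complex_of_real)
  then show ?thesis by (simp add: ft_laplace)
qed

lemma cauchy_density_integral:
  "integrable lborel (\<lambda>p. 1 / (1 + p\<^sup>2) :: real)" "(LINT p|lborel. 1 / (1 + p\<^sup>2) :: real) = pi"
  using integrable_inverse_1_plus_square LBINT_inverse_1_plus_square
  by (simp_all add: set_integrable_def interval_lebesgue_integral_def set_lebesgue_integral_def einterval_eq_UNIV inverse_eq_divide)

text \<open>Subtracting exp(-k) makes the numerator vanish at the pole i, so the quotient extends
  holomorphically to Im z > -1 and no residue has to be computed. Cauchy's theorem then compares the
  segment with the upper half circle, where the numerator is at most 2 because k >= 0, the
  denominator is at least R^2 - 1, and the length is pi R.\<close>

lemma integral_cauchy_kernel_sub:
  assumes k: "k \<ge> 0" and R: "R > 1"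
  shows "norm (LINT p|lborel. indicator {- R..R} p *\<^sub>R ((cis (k * p) - of_real (exp (- k))) / (1 + of_real (p\<^sup>2))))
    \<le> 2 / (R\<^sup>2 - 1) * R * pi"
proof -
  define F where "F z = (exp (\<i> * of_real k * z) - of_real (exp (- k))) / (z + \<i>)" for z
  define S where "S = {z. Im z > - 1}"
  have S: "open S" "convex S"
    unfolding S_def by (auto simp: open_halfspace_Im_gt convex_halfspace_Im_gt)
  have F: "F holomorphic_on S" unfolding F_def
    by (intro holomorphic_intros) (auto simp: S_def complex_eq_iff)
  have Fi: "F \<i> = 0" 
  proof -
    have "\<i> * of_real k * \<i> = - complex_of_real k" by (simp add: algebra_simps)
    then show ?thesis by (simp add: F_def exp_of_real[symmetric])
  qed
  define G where "G z = (if z = \<i> then deriv F \<i> else (F z - F \<i>) / (z - \<i>))" for z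
  have G: "G holomorphic_on S" unfolding G_def by (rule pole_lemma_open[OF F S(1)])
  have Geq: "G z = (exp (\<i> * of_real k * z) - of_real (exp (- k))) / (1 + z\<^sup>2)" if "z \<noteq> \<i>" for z
  proof -
    have "(z + \<i>) * (z - \<i>) = 1 + z\<^sup>2" by (simp add: algebra_simps power2_eq_square)
    then show ?thesis using that by (simp add: G_def Fi) (simp add: F_def)
  qed
  let ?l = "linepath (- of_real R) (of_real R) :: real \<Rightarrow> complex"
  let ?c = "part_circlepath 0 R 0 pi"
  have pl: "path_image ?l \<subseteq> S"
    unfolding S_def by (auto simp: path_image_linepath closed_segment_def)
  have Im_c: "Im z \<ge> 0 \<and> norm z = R" if "z \<in> path_image ?c" for z
  proof -
    have "0 \<le> Im z"
      using that R by (auto simp: path_image_part_circlepath Im_exp sin_ge_zero)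
    then show ?thesis using that R in_path_image_part_circlepath[of z 0 R 0 pi] by auto
  qed
  have pc: "path_image ?c \<subseteq> S" unfolding S_def using Im_c by force
  have "(G has_contour_integral 0) (?l +++ ?c)"
  proof (rule Cauchy_theorem_convex_simple[OF G S(2)])
    show "valid_path (?l +++ ?c)" by (intro valid_path_join) auto
    show "path_image (?l +++ ?c) \<subseteq> S" using pl pc by (auto simp: path_image_join)
  qed auto
  moreover have il: "G contour_integrable_on ?l"
    by (rule contour_integrable_holomorphic_simple[OF G S(1) _ pl]) simp
  moreover have ic: "G contour_integrable_on ?c"
    by (rule contour_integrable_holomorphic_simple[OF G S(1) _ pc]) simp
  ultimately have eq: "contour_integral ?l G = - contour_integral ?c G"
    using contour_integral_unique[of G 0 "?l +++ ?c"] by (simp add: eq_neg_iff_add_eq_0)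
  have "norm (contour_integral ?c G) \<le> 2 / (R\<^sup>2 - 1) * R * \<bar>pi - 0\<bar>"
  proof (rule contour_integral_bound_part_circlepath[OF ic])
    fix z assume "z \<in> path_image ?c"
    note z = Im_c[OF this]
    have R1: "R\<^sup>2 > 1" using R by (simp add: one_less_power)
    have "z \<noteq> \<i>" using z R by auto
    have n1: "norm (exp (\<i> * of_real k * z) - of_real (exp (- k))) \<le> 1 + 1"
      using z k by (intro norm_triangle_le_diff add_mono) (auto simp: mult_nonneg_nonneg)
    have "norm (1 + z\<^sup>2) \<ge> norm (z\<^sup>2) - norm (1::complex)"
      using norm_diff_ineq[of "z\<^sup>2" 1] by (simp add: add.commute)
    then have n2: "norm (1 + z\<^sup>2) \<ge> R\<^sup>2 - 1" using z by (simp add: norm_power)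
    show "norm (G z) \<le> 2 / (R\<^sup>2 - 1)"
      unfolding Geq[OF \<open>z \<noteq> \<i>\<close>] norm_divide using n1 n2 R1 by (intro frac_le) auto
  qed (use R in \<open>auto simp: one_le_power less_imp_le\<close>)
  then have bd: "norm (contour_integral ?l G) \<le> 2 / (R\<^sup>2 - 1) * R * pi" using eq by simp
  let ?g = "\<lambda>p::real. (cis (k * p) - of_real (exp (- k))) / (1 + of_real (p\<^sup>2)) :: complex"
  have "contour_integral ?l G = integral {- R..R} (\<lambda>x. G (of_real x))"
    using contour_integral_linepath_Reals_eq[of "- of_real R" "of_real R" G] R by simp
  also have "\<dots> = integral {- R..R} ?g"
  proof (rule Henstock_Kurzweil_Integration.integral_cong)
    fix x
    have "complex_of_real x \<noteq> \<i>" by (auto simp: complex_eq_iff)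
    from Geq[OF this] show "G (of_real x) = ?g x" by (simp add: cis_conv_exp mult_ac)
  qed
  also have "\<dots> = (LINT p|lborel. indicator {- R..R} p *\<^sub>R ?g p)"
  proof -
    have "1 + (of_real x)\<^sup>2 \<noteq> (0::complex)" for x :: real
    proof -
      have "1 + x\<^sup>2 > 0" by (simp add: add_pos_nonneg)
      then have "complex_of_real (1 + x\<^sup>2) \<noteq> 0" by (simp only: of_real_eq_0_iff)
      then show ?thesis by simp
    qed
    then have "set_integrable lborel {-R..R} ?g"
      by (intro borel_integrable_atLeastAtMost') (auto intro!: continuous_intros)
    from set_borel_integral_eq_integral(2)[OF this] show ?thesis by (simp add: set_lebesgue_integral_def)
  qed
  finally show ?thesis using bd by simp
qed

text \<open>For k >= 0 the contour bound tends to 0, so the transform at k is exp(-k) times its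
  value pi at 0. Negative k follows since the density is even.\<close>

lemma ft_cauchy_kernel: "ft (\<lambda>p. of_real (1 / (1 + p\<^sup>2))) k = of_real (pi * exp (- \<bar>k\<bar>))"
proof -
  let ?c = "\<lambda>p::real. complex_of_real (1 / (1 + p\<^sup>2))"
  have ic: "integrable lborel ?c"
    by (intro integrable_of_real cauchy_density_integral)
  have c0: "ft ?c 0 = of_real pi"
    using cauchy_density_integral(2)
    by (simp only: ft_def integral_complex_of_real mult_zero_left cis_zero mult_1)
  have pos: "ft ?c k = of_real (exp (- k)) * ft ?c 0" if "k \<ge> 0" for k
  proof -
    let ?g = "\<lambda>p::real. (cis (k * p) - of_real (exp (- k))) / (1 + of_real (p\<^sup>2)) :: complex"
    have g: "?g p = cis (k * p) * ?c p - of_real (exp (- k)) * ?c p" for p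
      by (simp add: diff_divide_distrib)
    have ig: "integrable lborel ?g"
      unfolding g by (intro Bochner_Integration.integrable_diff integrable_cis_mult ic integrable_mult_right) auto
    have "((\<lambda>R. LINT p|lborel. indicator {- R..R} p *\<^sub>R ?g p) \<longlongrightarrow> (LINT p|lborel. ?g p)) at_top"
    proof (rule integral_dominated_convergence_at_top[where w="\<lambda>p. norm (?g p)"])
      show "AE x in lborel. ((\<lambda>R. indicator {- R..R} x *\<^sub>R ?g x) \<longlongrightarrow> ?g x) at_top"
      proof (rule AE_I2, rule tendsto_eventually)
        fix x :: real
        show "eventually (\<lambda>R. indicator {- R..R} x *\<^sub>R ?g x = ?g x) at_top"
          using eventually_ge_at_top[of "\<bar>x\<bar>"] by eventually_elim (auto simp: abs_le_iff minus_le_iff)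
      qed
      show "\<forall>\<^sub>F R in at_top. AE x in lborel. norm (indicator {- R..R} x *\<^sub>R ?g x) \<le> norm (?g x)"
        by (intro always_eventually allI AE_I2) (auto split: split_indicator)
    qed (use ig in auto)
    then have "((\<lambda>R. norm (LINT p|lborel. indicator {- R..R} p *\<^sub>R ?g p)) \<longlongrightarrow> norm (LINT p|lborel. ?g p)) at_top"
      by (rule tendsto_norm)
    moreover have "((\<lambda>R. norm (LINT p|lborel. indicator {- R..R} p *\<^sub>R ?g p)) \<longlongrightarrow> 0) at_top"
    proof (rule tendsto_sandwich[OF always_eventually _ tendsto_const])
      show "\<forall>\<^sub>F R in at_top. norm (LINT p|lborel. indicator {- R..R} p *\<^sub>R ?g p) \<le> 2 / (R\<^sup>2 - 1) * R * pi"
        using eventually_gt_at_top[of 1] by eventually_elim (rule integral_cauchy_kernel_sub[OF that])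
      show "((\<lambda>R::real. 2 / (R\<^sup>2 - 1) * R * pi) \<longlongrightarrow> 0) at_top" by real_asymp
    qed auto
    ultimately have "(LINT p|lborel. ?g p) = 0"
      using tendsto_unique trivial_limit_at_top_linorder by fastforce
    moreover have "(LINT p|lborel. ?g p) = ft ?c k - (LINT p|lborel. of_real (exp (- k)) * ?c p)"
      unfolding g ft_def
      by (intro Bochner_Integration.integral_diff integrable_cis_mult ic integrable_mult_right) auto
    moreover have "(LINT p|lborel. of_real (exp (- k)) * ?c p) = of_real (exp (- k)) * ft ?c 0"
      by (simp only: ft_def mult_zero_left cis_zero mult_1 integral_mult_right_zero)
    ultimately show ?thesis by simp
  qed
  show ?thesis
  proof (cases "k \<ge> 0")
    case True
    then show ?thesis using pos[of k] c0 by simp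
  next
    case False
    then show ?thesis using pos[of "- k"] c0 ft_reflect[of ?c k] by simp
  qed
qed

text \<open>On either side of s = k the kernel is a pure exponential. To the right, exp(k - s) (u -
  u'') has the antiderivative -exp(k - s) (u + u'), whose limit at infinity is 0 because u and u'
  are bounded. The two halves contribute u(k) + u'(k) and u(k) - u'(k), and their mean is
  u(k).\<close>

lemma laplace_convolution:
  fixes u :: "real \<Rightarrow> complex"
  assumes u: "\<And>x. (u has_vector_derivative u1 x) (at x)" and u1: "\<And>x. (u1 has_vector_derivative u2 x) (at x)"
    and c: "continuous_on UNIV u2" and b: "\<And>x. norm (u x) \<le> B" "\<And>x. norm (u1 x) \<le> B"
    and int: "integrable lborel (\<lambda>x. u x - u2 x)"
  shows "(LINT s|lborel. of_real (laplace (k - s)) * (u s - u2 s)) = u k"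
proof -
  have half: "(LINT s|lborel. indicator {k..} s *\<^sub>R (of_real (exp (k - s)) * (u s - u2 s))) = u k + u1 k
      \<and> integrable lborel (\<lambda>s. indicator {k..} s *\<^sub>R (of_real (exp (k - s)) * (u s - u2 s)))"
    if u: "\<And>x. (u has_vector_derivative u1 x) (at x)" and u1: "\<And>x. (u1 has_vector_derivative u2 x) (at x)"
      and c: "continuous_on UNIV u2" and b: "\<And>x. norm (u x) \<le> B" "\<And>x. norm (u1 x) \<le> B"
      and int: "integrable lborel (\<lambda>x. u x - u2 x)" for u u1 u2 :: "real \<Rightarrow> complex" and k
  proof -
    let ?F = "\<lambda>s. - (of_real (exp (k - s)) * (u s + u1 s))"
    have cu: "continuous_on UNIV u"
      by (intro continuous_at_imp_continuous_on ballI has_vector_derivative_continuous[OF u])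
    have I: "integrable lborel (\<lambda>s. indicator {k..} s *\<^sub>R (of_real (exp (k - s)) * (u s - u2 s)))"
      by (rule Bochner_Integration.integrable_bound[OF int])
         (use int in \<open>auto simp: norm_mult mult_left_le_one_le split: split_indicator\<close>)
    have "0 - ?F k = (LINT s|lborel. indicator {k..} s *\<^sub>R (of_real (exp (k - s)) * (u s - u2 s)))"
    proof (rule ac_deriv_limit_at_top[where F="?F", OF ac_deriv_vector_derivative I])
      show "(?F has_vector_derivative of_real (exp (k - x)) * (u x - u2 x)) (at x)" for x
      proof -
        have "((\<lambda>s. complex_of_real (exp (k - s))) has_vector_derivative of_real (- exp (k - x))) (at x)"
          by (intro has_vector_derivative_of_real) (auto intro!: derivative_eq_intros)
        from has_vector_derivative_minus[OF has_vector_derivative_mult[OF this has_vector_derivative_add[OF u u1]]]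
        show ?thesis by (simp add: algebra_simps)
      qed
      show "continuous_on UNIV (\<lambda>s. of_real (exp (k - s)) * (u s - u2 s))"
        using cu c by (intro continuous_intros)
      have "((\<lambda>s. exp (k - s) * (B + B)) \<longlongrightarrow> 0) at_top" by real_asymp
      then show "(?F \<longlongrightarrow> 0) at_top"
        by (rule Lim_null_comparison[rotated])
           (auto simp: norm_mult intro!: always_eventually mult_left_mono norm_triangle_le add_mono[OF b, simplified])
    qed
    with I show ?thesis by (simp add: add.commute)
  qed
  note R = half[OF u u1 c b int]
  have d: "((\<lambda>s. f (- s)) has_vector_derivative - f' (- x)) (at x)"
    if "\<And>x. (f has_vector_derivative f' x) (at x)" for f f' :: "real \<Rightarrow> complex" and x
    using that by (rule has_vector_derivative_reflect)
  have d2: "((\<lambda>s. - u1 (- s)) has_vector_derivative u2 (- x)) (at x)" for x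
    using has_vector_derivative_minus[OF d[OF u1]] by simp
  have c': "continuous_on UNIV (\<lambda>s. u2 (- s))"
    by (rule continuous_on_compose2[OF c]) (auto intro!: continuous_intros)
  \<comment> \<open>The left half is the right half for the reflected function; reflection changes
    the sign of u' but not of u''.\<close>
  have L: "(LINT s|lborel. indicator {-k..} s *\<^sub>R (of_real (exp (-k - s)) * (u (-s) - u2 (-s)))) = u k + - u1 k
      \<and> integrable lborel (\<lambda>s. indicator {-k..} s *\<^sub>R (of_real (exp (-k - s)) * (u (-s) - u2 (-s))))"
  proof -
    have b': "norm (- u1 (- x)) \<le> B" for x using b(2) by simp
    show ?thesis
      using half[where k="- k", OF d[OF u] d2 c' b(1) b' integrable_uminus_lborel[OF int]]
      by (simp only: minus_minus)
  qed
  let ?L = "\<lambda>s. indicator {..k} s *\<^sub>R (of_real (exp (s - k)) * (u s - u2 s))"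
  let ?R = "\<lambda>s. indicator {k..} s *\<^sub>R (of_real (exp (k - s)) * (u s - u2 s))"
  have Leq: "?L (- s) = indicator {-k..} s *\<^sub>R (of_real (exp (-k - s)) * (u (-s) - u2 (-s)))" for s
  proof -
    have "indicator {..k} (- s) = (indicator {-k..} s :: real)" by (auto simp: indicator_def)
    moreover have "- s - k = - k - s" by (rule minus_diff_commute)
    ultimately show ?thesis by (simp only:)
  qed
  have iL: "integrable lborel (\<lambda>s. ?L (- s))" unfolding Leq using L by blast
  have L': "(LINT s|lborel. ?L s) = u k - u1 k" "integrable lborel ?L"
  proof -
    have "(LINT s|lborel. ?L s) = (LINT s|lborel. ?L (- s))" by (rule integral_uminus_lborel[symmetric])
    then show "(LINT s|lborel. ?L s) = u k - u1 k" unfolding Leq using L by simp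
    show "integrable lborel ?L" using integrable_uminus_lborel[OF iL] by (simp only: minus_minus)
  qed
  have [measurable]: "(\<lambda>x. u x - u2 x) \<in> borel_measurable lborel" by (rule borel_measurable_integrable[OF int])
  note iR = conjunct2[OF R]
  have "(LINT s|lborel. of_real (laplace (k - s)) * (u s - u2 s)) = (LINT s|lborel. (?L s + ?R s) / 2)"
  proof (rule integral_cong_AE)
    show "AE s in lborel. of_real (laplace (k - s)) * (u s - u2 s) = (?L s + ?R s) / 2"
    proof (rule eventually_mono[OF AE_lborel_singleton[of k]])
      fix s :: real assume "s \<noteq> k"
      then consider "s < k" | "k < s" by linarith
      then show "of_real (laplace (k - s)) * (u s - u2 s) = (?L s + ?R s) / 2"
        by cases (simp_all add: laplace_def)
    qed
    show "(\<lambda>s. of_real (laplace (k - s)) * (u s - u2 s)) \<in> borel_measurable lborel" by measurable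
    show "(\<lambda>s. (?L s + ?R s) / 2) \<in> borel_measurable lborel"
      by (intro borel_measurable_divide borel_measurable_add borel_measurable_const
        borel_measurable_integrable[OF L'(2)] borel_measurable_integrable[OF iR])
  qed
  also have "\<dots> = ((LINT s|lborel. ?L s) + (LINT s|lborel. ?R s)) / 2"
    by (simp only: integral_divide_zero Bochner_Integration.integral_add[OF L'(2) iR])
  also have "\<dots> = u k" by (simp only: L'(1) conjunct1[OF R]) simp
  finally show ?thesis .
qed

text \<open>The resolvent \<open>(1 - d\<^sup>2/dx\<^sup>2)\<^sup>-\<^sup>1\<close> is convolution with the Laplace density, whose Fourier
  representation is known explicitly; this replaces Fourier inversion.\<close>
lemma ft_of_smooth:
  fixes u :: "real \<Rightarrow> complex"
  assumes u: "\<And>x. (u has_vector_derivative u1 x) (at x)" and u1: "\<And>x. (u1 has_vector_derivative u2 x) (at x)"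
    and c: "continuous_on UNIV u2" and b: "\<And>x. norm (u x) \<le> B" "\<And>x. norm (u1 x) \<le> B"
    and int: "integrable lborel (\<lambda>x. u x - u2 x)"
  obtains h where "integrable lborel h" "\<And>k. ft h k = u k"
    "(LINT p|lborel. norm (h p)) \<le> (LINT x|lborel. norm (u x - u2 x))"
proof -
  let ?v = "\<lambda>x. u x - u2 x"
  let ?c = "\<lambda>p::real. complex_of_real (1 / (1 + p\<^sup>2))"
  have ic: "integrable lborel ?c" by (intro integrable_of_real cauchy_density_integral)
  \<comment> \<open>The inverse transform of u in disguise: u - u'' has (1 + p^2) times the
    transform of u. The Cauchy density makes \<open>h\<close> integrable although
    \<open>ft ?v\<close> is only known to be bounded; its mass pi against 1/(2 pi) leaves the factor
    1/2 below.\<close>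
  define h where "h p = of_real (1 / (2 * pi)) * (?c p * ft ?v (- p))" for p
  have cv: "continuous_on UNIV (ft ?v)" by (rule continuous_ft[OF int])
  have [measurable]: "ft ?v \<in> borel_measurable borel" by (rule borel_measurable_continuous_onI[OF cv])
  have [measurable]: "h \<in> borel_measurable borel" unfolding h_def by measurable
  have nh: "norm (h p) \<le> 1 / (2 * pi) * (LINT x|lborel. norm (?v x)) * (1 / (1 + p\<^sup>2))" for p
    using mult_left_mono[OF norm_ft_le[of ?v "- p"], of "1 / (2 * pi) * (1 / (1 + p\<^sup>2))"]
    by (simp add: h_def norm_mult norm_divide abs_of_nonneg mult_ac add_nonneg_nonneg del: of_real_add of_real_power)
  have ib: "integrable lborel (\<lambda>p. 1 / (2 * pi) * (LINT x|lborel. norm (?v x)) * (1 / (1 + p\<^sup>2)))"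
    by (intro integrable_mult_right cauchy_density_integral)
  have ih: "integrable lborel h"
    by (rule Bochner_Integration.integrable_bound[OF ib]) (auto intro!: AE_I2 order_trans[OF nh])
  show ?thesis
  proof
    show "integrable lborel h" by fact
    have "(LINT p|lborel. norm (h p)) \<le> (LINT p|lborel. 1 / (2 * pi) * (LINT x|lborel. norm (?v x)) * (1 / (1 + p\<^sup>2)))"
      by (intro integral_mono integrable_norm ih ib nh)
    also have "\<dots> = (LINT x|lborel. norm (?v x)) / 2"
      by (simp only: integral_mult_right_zero cauchy_density_integral) simp
    also have "\<dots> \<le> (LINT x|lborel. norm (?v x))" by simp
    finally show "(LINT p|lborel. norm (h p)) \<le> (LINT x|lborel. norm (?v x))" .
    fix k
    have ip: "integrable (lborel \<Otimes>\<^sub>M lborel) (\<lambda>z. ?v (fst z) * ?c (snd z))"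
      by (rule integrable_pair_mult[OF int ic])
    have ip': "integrable (lborel \<Otimes>\<^sub>M lborel) (\<lambda>(s, p). cis ((k - s) * p) * (?v s * ?c p))"
      using integrable_cis_mult[OF ip, of "\<lambda>z. (k - fst z) * snd z"] by (simp add: case_prod_beta')
    have e1: "(LINT p|lborel. cis ((k - s) * p) * (?v s * ?c p)) = of_real (2 * pi) * (of_real (laplace (k - s)) * ?v s)" for s
    proof -
      have "(LINT p|lborel. cis ((k - s) * p) * (?v s * ?c p)) = ?v s * ft ?c (k - s)"
        unfolding ft_def integral_mult_right_zero[symmetric] by (intro Bochner_Integration.integral_cong) auto
      then show ?thesis unfolding ft_cauchy_kernel by (simp add: laplace_def)
    qed
    have e2: "(LINT s|lborel. cis ((k - s) * p) * (?v s * ?c p)) = of_real (2 * pi) * (cis (k * p) * h p)" for p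
    proof -
      have c: "cis ((k - s) * p) = cis (k * p) * cis (- p * s)" for s
        by (simp add: cis_mult algebra_simps)
      have "(LINT s|lborel. cis ((k - s) * p) * (?v s * ?c p)) = (LINT s|lborel. (cis (k * p) * ?c p) * (cis (- p * s) * ?v s))"
        unfolding c by (intro Bochner_Integration.integral_cong) (auto simp: mult_ac)
      also have "\<dots> = cis (k * p) * ?c p * ft ?v (- p)" unfolding ft_def by (rule integral_mult_right_zero)
      finally show ?thesis by (simp add: h_def)
    qed
    \<comment> \<open>One double integral in two orders. Integrating over s first gives
      \<open>h\<close>; integrating over p first gives the transform of the Cauchy density at k - s,
      which is 2 pi times the Laplace density.\<close>
    have "of_real (2 * pi) * ft h k = (LINT p|lborel. LINT s|lborel. cis ((k - s) * p) * (?v s * ?c p))"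
      unfolding e2 ft_def by (rule integral_mult_right_zero[symmetric])
    also have "\<dots> = (LINT s|lborel. LINT p|lborel. cis ((k - s) * p) * (?v s * ?c p))"
      by (rule lborel_pair.Fubini_integral[OF ip'])
    also have "\<dots> = of_real (2 * pi) * u k"
      by (simp only: e1 integral_mult_right_zero laplace_convolution[OF u u1 c b int])
    finally show "ft h k = u k" by simp
  qed
qed

section \<open>Wiener's lemma\<close>

lemma integral_shift_lborel:
  fixes f :: "real \<Rightarrow> 'a::{banach, second_countable_topology}"
  shows "(LINT x|lborel. f (x - t)) = (LINT x|lborel. f x)"
  using lborel_integral_real_affine[of 1 f "- t"] by simp

lemma integrable_shift_lborel:
  fixes f :: "real \<Rightarrow> 'a::{banach, second_countable_topology}"
  shows "integrable lborel f \<Longrightarrow> integrable lborel (\<lambda>x. f (x - t))"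
  using lborel_integrable_real_affine[of f 1 "- t"] by simp

text \<open>The property \<open>P\<close> is stable under L^1 approximation (\<open>approx\<close>)
  and sums, so integrable functions reduce to indicators of measurable sets, and outer regularity
  reduces these to open sets of finite measure.\<close>

lemma L1_translation_continuous:
  fixes g :: "real \<Rightarrow> complex"
  assumes "integrable lborel g"
  shows "X \<longlonglongrightarrow> 0 \<Longrightarrow> (\<lambda>n. LINT p|lborel. norm (g (p - X n) - g p)) \<longlonglongrightarrow> 0"
proof -
  define P where "P g \<longleftrightarrow> (\<forall>X. X \<longlonglongrightarrow> 0 \<longrightarrow> (\<lambda>n. LINT p|lborel. norm (g (p - X n) - g p)) \<longlonglongrightarrow> 0)"
    for g :: "real \<Rightarrow> complex"
  have approx: "P g" if ig: "integrable lborel g"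
    and ex: "\<And>e. e > 0 \<Longrightarrow> \<exists>g'. integrable lborel g' \<and> P g' \<and> (LINT p|lborel. norm (g p - g' p)) < e" for g
    unfolding P_def
  proof (intro allI impI LIMSEQ_I)
    fix X :: "nat \<Rightarrow> real" and e :: real assume X: "X \<longlonglongrightarrow> 0" and e: "e > 0"
    obtain g' where ig': "integrable lborel g'" and Pg: "P g'" and close: "(LINT p|lborel. norm (g p - g' p)) < e / 4"
      using ex[of "e / 4"] e by auto
    have "(\<lambda>n. LINT p|lborel. norm (g' (p - X n) - g' p)) \<longlonglongrightarrow> 0" using Pg X by (auto simp: P_def)
    from LIMSEQ_D[OF this, of "e / 2"] e obtain N
      where N: "\<And>n. n \<ge> N \<Longrightarrow> norm ((LINT p|lborel. norm (g' (p - X n) - g' p)) - 0) < e / 2" by auto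
    have "norm ((LINT p|lborel. norm (g (p - X n) - g p)) - 0) < e" if "n \<ge> N" for n
    proof -
      let ?a = "\<lambda>p. norm (g (p - X n) - g' (p - X n))" and ?b = "\<lambda>p. norm (g' (p - X n) - g' p)"
        and ?c = "\<lambda>p. norm (g p - g' p)"
      have ic: "integrable lborel ?c" using ig ig' by auto
      have ia: "integrable lborel ?a" using integrable_shift_lborel[OF ic] .
      have ib: "integrable lborel ?b" using ig' integrable_shift_lborel[OF ig'] by auto
      have "(LINT p|lborel. norm (g (p - X n) - g p)) \<le> (LINT p|lborel. ?a p + ?b p + ?c p)"
      proof (rule integral_mono)
        show "integrable lborel (\<lambda>p. norm (g (p - X n) - g p))"
          using ig integrable_shift_lborel[OF ig] by auto
        show "norm (g (p - X n) - g p) \<le> ?a p + ?b p + ?c p" for p by norm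
      qed (use ia ib ic in auto)
      also have "\<dots> = (LINT p|lborel. ?a p) + (LINT p|lborel. ?b p) + (LINT p|lborel. ?c p)"
        using ia ib ic by simp
      also have "(LINT p|lborel. ?a p) = (LINT p|lborel. ?c p)" by (rule integral_shift_lborel)
      finally show ?thesis using close N[OF that] by (simp add: integral_nonneg_AE)
    qed
    then show "\<exists>no. \<forall>n\<ge>no. norm ((LINT p|lborel. norm (g (p - X n) - g p)) - 0) < e" by blast
  qed
  have open_ind: "P (\<lambda>x. indicator U x *\<^sub>R c)" if U: "open U" "emeasure lborel U < \<infinity>" for U :: "real set" and c
    unfolding P_def
  proof (intro allI impI)
    fix X :: "nat \<Rightarrow> real" assume X: "X \<longlonglongrightarrow> 0"
    have [measurable]: "U \<in> sets borel" using U by auto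
    have iU: "integrable lborel (indicator U :: real \<Rightarrow> real)"
      using U by (auto intro!: integrable_real_indicator)
    \<comment> \<open>For an open set, nearby translates of a point of \<open>U\<close> stay in
      \<open>U\<close>, which controls only this positive part pointwise. Translation invariance
      makes the signed difference integrate to 0, so the full L^1 distance is twice the integral of
      the positive part.\<close>
    let ?d = "\<lambda>n p. max 0 (indicator U p - indicator U (p - X n)) :: real"
    have id: "integrable lborel (?d n)" for n
      by (rule Bochner_Integration.integrable_bound[OF iU]) (auto split: split_indicator)
    have "(\<lambda>n. LINT p|lborel. ?d n p) \<longlonglongrightarrow> (LINT p::real|lborel. 0)"
    proof (rule integral_dominated_convergence[where w="indicator U"])
      show "AE p in lborel. (\<lambda>n. ?d n p) \<longlonglongrightarrow> 0"
      proof (rule AE_I2)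
        fix p :: real
        show "(\<lambda>n. ?d n p) \<longlonglongrightarrow> 0"
        proof (cases "p \<in> U")
          case True
          have "(\<lambda>n. p - X n) \<longlonglongrightarrow> p - 0" by (intro tendsto_intros X)
          then have "eventually (\<lambda>n. p - X n \<in> U) sequentially"
            using topological_tendstoD[of _ "p - 0", OF _ U(1)] True by simp
          then have "eventually (\<lambda>n. ?d n p = 0) sequentially"
            by eventually_elim (auto split: split_indicator)
          then show ?thesis by (rule tendsto_eventually)
        next
          case False
          then have "?d n p = 0" for n by (auto split: split_indicator)
          then show ?thesis by (simp only: tendsto_const)
        qed
      qed
      show "AE p in lborel. norm (?d n p) \<le> indicator U p" for n
        by (rule AE_I2) (auto split: split_indicator)
    qed (use iU in auto)
    then have "(\<lambda>n. 2 * norm c * (LINT p|lborel. ?d n p)) \<longlonglongrightarrow> 2 * norm c * 0"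
      by (intro tendsto_intros) simp
    moreover have "(LINT p|lborel. norm (indicator U (p - X n) *\<^sub>R c - indicator U p *\<^sub>R c)) = 2 * norm c * (LINT p|lborel. ?d n p)" for n
    proof -
      have ish: "integrable lborel (\<lambda>p. indicator U (p - X n) :: real)" by (rule integrable_shift_lborel[OF iU])
      have "(LINT p|lborel. norm (indicator U (p - X n) *\<^sub>R c - indicator U p *\<^sub>R c)) =
          (LINT p|lborel. norm c * (2 * ?d n p + (indicator U (p - X n) - indicator U p)))"
        by (intro Bochner_Integration.integral_cong) (auto split: split_indicator)
      also have "\<dots> = norm c * (2 * (LINT p|lborel. ?d n p) + ((LINT p|lborel. indicator U (p - X n)) - (LINT p|lborel. indicator U p)))"
        using id[of n] ish iU by simp
      also have "(LINT p|lborel. indicator U (p - X n)) = (LINT p|lborel. indicator U p :: real)"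
        by (rule integral_shift_lborel)
      finally show ?thesis by simp
    qed
    ultimately show "(\<lambda>n. LINT p|lborel. norm (indicator U (p - X n) *\<^sub>R c - indicator U p *\<^sub>R c)) \<longlonglongrightarrow> 0"
      by simp
  qed
  have "P g" using assms
  proof (induction rule: integrable_induct)
    case (base A c)
    then have [measurable]: "A \<in> sets borel" by simp
    have iA: "integrable lborel (\<lambda>x. indicator A x *\<^sub>R c)" using base by auto
    show ?case
    proof (rule approx[OF iA])
      fix e :: real assume e: "e > 0"
      define e' where "e' = e / (norm c + 1)"
      have e': "e' > 0" using e by (simp add: e'_def add_nonneg_pos)
      obtain U where U: "open U" "A \<subseteq> U" "emeasure lborel (U - A) < e'"
        using outer_regular_lborel[of A e'] e' by auto
      have "emeasure lborel U = emeasure lborel A + emeasure lborel (U - A)"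
        using U by (subst plus_emeasure) (auto intro!: arg_cong[where f="emeasure lborel"])
      then have fU: "emeasure lborel U < \<infinity>"
        using base U(3) by (auto simp: less_top[symmetric] top_unique ennreal_add_eq_top)
      have [measurable]: "U \<in> sets borel" using U by auto
      have iU: "integrable lborel (\<lambda>x. indicator U x *\<^sub>R c)" using fU by auto
      have "measure lborel (U - A) < e'"
        using U(3) by (metis e' emeasure_eq_ennreal_measure ennreal_less_iff less_le_not_le less_top measure_nonneg order.strict_trans ennreal_less_top)
      moreover have "(LINT p|lborel. norm (indicator A p *\<^sub>R c - indicator U p *\<^sub>R c)) = (LINT p|lborel. indicator (U - A) p * norm c)"
        using U(2) by (intro Bochner_Integration.integral_cong) (auto split: split_indicator)
      ultimately have "(LINT p|lborel. norm (indicator A p *\<^sub>R c - indicator U p *\<^sub>R c)) \<le> e' * norm c"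
        by (simp add: mult_right_mono)
      also have "\<dots> < e' * (norm c + 1)" using e' by simp
      also have "\<dots> = e" using norm_ge_zero[of c] unfolding e'_def by (simp add: add_nonneg_eq_0_iff)
      finally show "\<exists>g'. integrable lborel g' \<and> P g' \<and> (LINT p|lborel. norm (indicator A p *\<^sub>R c - g' p)) < e"
        using iU open_ind[OF U(1) fU] by blast
    qed
  next
    case (add f g)
    show ?case unfolding P_def
    proof (intro allI impI)
      fix X :: "nat \<Rightarrow> real" assume X: "X \<longlonglongrightarrow> 0"
      let ?a = "\<lambda>n p. norm (f (p - X n) - f p)" and ?b = "\<lambda>n p. norm (g (p - X n) - g p)"
      have i: "integrable lborel (?a n)" "integrable lborel (?b n)" for n
        using add.hyps integrable_shift_lborel[OF add.hyps(1)] integrable_shift_lborel[OF add.hyps(2)] by auto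
      have "(\<lambda>n. (LINT p|lborel. ?a n p) + (LINT p|lborel. ?b n p)) \<longlonglongrightarrow> 0 + 0"
        using add.IH X unfolding P_def by (intro tendsto_add) auto
      then have lim: "(\<lambda>n. (LINT p|lborel. ?a n p) + (LINT p|lborel. ?b n p)) \<longlonglongrightarrow> 0" by simp
      have le: "(LINT p|lborel. norm (f (p - X n) + g (p - X n) - (f p + g p))) \<le> (LINT p|lborel. ?a n p) + (LINT p|lborel. ?b n p)" for n
      proof -
        have "(LINT p|lborel. norm (f (p - X n) + g (p - X n) - (f p + g p))) \<le> (LINT p|lborel. ?a n p + ?b n p)"
        proof (rule integral_mono)
          show "integrable lborel (\<lambda>p. norm (f (p - X n) + g (p - X n) - (f p + g p)))"
            using add.hyps integrable_shift_lborel[OF add.hyps(1)] integrable_shift_lborel[OF add.hyps(2)] by auto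
          show "norm (f (p - X n) + g (p - X n) - (f p + g p)) \<le> ?a n p + ?b n p" for p by norm
        qed (use i in auto)
        then show ?thesis using i by simp
      qed
      show "(\<lambda>n. LINT p|lborel. norm (f (p - X n) + g (p - X n) - (f p + g p))) \<longlonglongrightarrow> 0"
        by (rule tendsto_sandwich[OF _ _ tendsto_const lim]) (auto intro!: always_eventually le integral_nonneg_AE)
    qed
  next
    case (lim f s)
    show ?case
    proof (rule approx[OF lim.hyps(4)])
      fix e :: real assume e: "e > 0"
      have [measurable]: "f \<in> borel_measurable borel" "\<And>i. s i \<in> borel_measurable borel"
        using lim.hyps(1,4) by auto
      have "(\<lambda>i. LINT p|lborel. norm (f p - s i p)) \<longlonglongrightarrow> (LINT p::real|lborel. 0)"
      proof (rule integral_dominated_convergence[where w="\<lambda>p. 3 * norm (f p)"])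
        show "AE p in lborel. (\<lambda>i. norm (f p - s i p)) \<longlonglongrightarrow> 0"
        proof (rule AE_I2)
          fix p :: real
          have "(\<lambda>i. norm (f p - s i p)) \<longlonglongrightarrow> norm (f p - f p)" using lim.hyps(2)[of p] by (intro tendsto_intros) auto
          then show "(\<lambda>i. norm (f p - s i p)) \<longlonglongrightarrow> 0" by simp
        qed
        show "AE p in lborel. norm (norm (f p - s i p)) \<le> 3 * norm (f p)" for i
        proof (rule AE_I2)
          fix p :: real
          have "norm (s i p) \<le> 2 * norm (f p)" using lim.hyps(3)[of p i] by simp
          then show "norm (norm (f p - s i p)) \<le> 3 * norm (f p)" using norm_triangle_ineq4[of "f p" "s i p"] by simp
        qed
      qed (use lim.hyps(4) in auto)
      from LIMSEQ_D[OF this e] obtain i where "norm (LINT p|lborel. norm (f p - s i p)) < e" by auto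
      then show "\<exists>g'. integrable lborel g' \<and> P g' \<and> (LINT p|lborel. norm (f p - g' p)) < e"
        using lim.hyps(1) lim.IH by (intro exI[of _ "s i"]) auto
    qed
  qed
  then show "X \<longlonglongrightarrow> 0 \<Longrightarrow> (\<lambda>n. LINT p|lborel. norm (g (p - X n) - g p)) \<longlonglongrightarrow> 0"
    by (auto simp: P_def)
qed

text \<open>The density is the average of g - g(. - \<open>\<epsilon>\<close> t) over t with the
  Laplace weight. Its L^1 norm is at most the average of the L^1 modulus of continuity
  \<open>\<omega>\<close> at \<open>\<epsilon>\<close> t, which tends to 0 by dominated convergence;
  the transform of the rescaled Laplace density produces the quotient.\<close>

lemma ft_mollify:
  assumes g: "integrable lborel g" and e: "e > 0"
  obtains \<epsilon> h where "\<epsilon> > 0" "integrable lborel h" "(LINT p|lborel. norm (h p)) < e"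
    "\<And>k. ft h k = ft g k - ft g k / (1 + of_real ((\<epsilon> * k)\<^sup>2))"
proof -
  have [measurable]: "g \<in> borel_measurable borel" using g by auto
  define \<omega> where "\<omega> t = (LINT p|lborel. norm (g (p - t) - g p))" for t
  have [measurable]: "\<omega> \<in> borel_measurable borel"
    unfolding \<omega>_def by measurable
  have ish: "integrable lborel (\<lambda>p. g (p - t) - g p)" for t
    using g integrable_shift_lborel[OF g] by auto
  have \<omega>_le: "\<omega> t \<le> 2 * (LINT p|lborel. norm (g p))" for t
  proof -
    have "\<omega> t \<le> (LINT p|lborel. norm (g (p - t)) + norm (g p))"
      unfolding \<omega>_def using g integrable_shift_lborel[OF g, of t] by (intro integral_mono) (auto intro: norm_triangle_ineq4)
    also have "\<dots> = 2 * (LINT p|lborel. norm (g p))"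
      using g integrable_shift_lborel[OF g, of t] integral_shift_lborel[of "\<lambda>p. norm (g p)" t] by simp
    finally show ?thesis .
  qed
  have \<omega>_nonneg: "\<omega> t \<ge> 0" for t unfolding \<omega>_def by (simp add: integral_nonneg_AE)
  have bound: "norm (laplace t * \<omega> s) \<le> 2 * (LINT p|lborel. norm (g p)) * laplace t" for t s
    using mult_left_mono[OF \<omega>_le[of s] less_imp_le[OF laplace_pos[of t]]] \<omega>_nonneg[of s] laplace_pos[of t]
    by (simp add: abs_mult mult_ac)
  have iw: "integrable lborel (\<lambda>t. 2 * (LINT p|lborel. norm (g p)) * laplace t)"
    by (intro integrable_mult_right integrable_laplace)
  have "(\<lambda>n. LINT t|lborel. laplace t * \<omega> (inverse (real (Suc n)) * t)) \<longlonglongrightarrow> (LINT t::real|lborel. 0)"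
  proof (rule integral_dominated_convergence[where w="\<lambda>t. 2 * (LINT p|lborel. norm (g p)) * laplace t"])
    show "AE t in lborel. (\<lambda>n. laplace t * \<omega> (inverse (real (Suc n)) * t)) \<longlonglongrightarrow> 0"
    proof (rule AE_I2)
      fix t
      have "(\<lambda>n. inverse (real (Suc n)) * t) \<longlonglongrightarrow> 0 * t"
        by (intro tendsto_intros LIMSEQ_inverse_real_of_nat)
      then have "(\<lambda>n. \<omega> (inverse (real (Suc n)) * t)) \<longlonglongrightarrow> 0"
        unfolding \<omega>_def by (intro L1_translation_continuous[OF g]) simp
      from tendsto_mult_left[OF this, of "laplace t"] show "(\<lambda>n. laplace t * \<omega> (inverse (real (Suc n)) * t)) \<longlonglongrightarrow> 0" by simp
    qed
  qed (use iw bound in auto)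
  from LIMSEQ_D[OF this e] obtain n where n: "norm ((LINT t|lborel. laplace t * \<omega> (inverse (real (Suc n)) * t)) - (LINT t::real|lborel. 0)) < e"
    by blast
  define \<epsilon> where "\<epsilon> = inverse (real (Suc n))"
  have small: "(LINT t|lborel. laplace t * \<omega> (\<epsilon> * t)) < e" using n unfolding \<epsilon>_def by simp
  define \<rho> where "\<rho> z = of_real (laplace (fst z)) * (g (snd z) - g (snd z - \<epsilon> * fst z))" for z
  have [measurable]: "\<rho> \<in> borel_measurable (lborel \<Otimes>\<^sub>M lborel)" unfolding \<rho>_def by measurable
  have n\<rho>: "(LINT p|lborel. norm (\<rho> (t, p))) = laplace t * \<omega> (\<epsilon> * t)" for t
  proof -
    have "norm (\<rho> (t, p)) = laplace t * norm (g (p - \<epsilon> * t) - g p)" for p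
      using laplace_pos[of t] by (simp add: \<rho>_def norm_mult norm_minus_commute abs_of_pos)
    then show ?thesis by (simp add: \<omega>_def)
  qed
  have i\<rho>: "integrable (lborel \<Otimes>\<^sub>M lborel) \<rho>"
  proof (rule lborel_pair.Fubini_integrable)
    show "integrable lborel (\<lambda>t. LINT p|lborel. norm (\<rho> (t, p)))"
      unfolding n\<rho> by (rule Bochner_Integration.integrable_bound[OF iw]) (use bound in \<open>auto intro!: AE_I2 intro: order_trans[OF _ abs_ge_self]\<close>)
    show "AE t in lborel. integrable lborel (\<lambda>p. \<rho> (t, p))"
      unfolding \<rho>_def using g integrable_shift_lborel[OF g] by (intro AE_I2) auto
  qed simp
  have i0: "integrable (lborel \<Otimes>\<^sub>M lborel) (\<lambda>z. (1 + \<bar>0 + 1 * snd z\<bar>) ^ 0 * norm (\<rho> z))" using i\<rho> by simp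
  obtain h where h: "h \<in> borel_measurable lborel" "integrable lborel (\<lambda>p. (1 + \<bar>p\<bar>) ^ 0 * norm (h p))"
    "\<And>k. ft h k = (\<integral>z. cis (k * (0 + 1 * snd z)) * \<rho> z \<partial>(lborel \<Otimes>\<^sub>M lborel))"
    "(LINT p|lborel. (1 + \<bar>p\<bar>) ^ 0 * norm (h p)) \<le> (\<integral>z. (1 + \<bar>0 + 1 * snd z\<bar>) ^ 0 * norm (\<rho> z) \<partial>(lborel \<Otimes>\<^sub>M lborel))"
    by (rule ft_superposition[OF lborel.sigma_finite_measure_axioms _ _ _ i0]) auto
  show ?thesis
  proof
    show "\<epsilon> > 0" by (simp add: \<epsilon>_def)
    show "integrable lborel h" using h(1,2) by (simp add: integrable_norm_iff)
    have "(LINT p|lborel. norm (h p)) \<le> (LINT t|lborel. LINT p|lborel. norm (\<rho> (t, p)))"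
      using h(4) lborel_pair.integral_fst'[OF integrable_norm[OF i\<rho>]] by simp
    then show "(LINT p|lborel. norm (h p)) < e" using small unfolding n\<rho> by simp
    fix k
    have in1: "(LINT p|lborel. cis (k * p) * \<rho> (t, p)) = of_real (laplace t) * ft g k - ft g k * (cis ((\<epsilon> * k) * t) * of_real (laplace t))" for t
    proof -
      have pt: "cis (k * p) * \<rho> (t, p) = of_real (laplace t) * (cis (k * p) * g p) -
          (cis ((\<epsilon> * k) * t) * of_real (laplace t)) * (cis (k * (p - \<epsilon> * t)) * g (p - \<epsilon> * t))" for p
      proof -
        have "cis (k * p) = cis ((\<epsilon> * k) * t) * cis (k * (p - \<epsilon> * t))" by (simp add: cis_mult algebra_simps)
        then show ?thesis by (simp add: \<rho>_def algebra_simps)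
      qed
      have sh: "(LINT p|lborel. cis (k * (p - \<epsilon> * t)) * g (p - \<epsilon> * t)) = ft g k"
        unfolding ft_def by (rule integral_shift_lborel)
      have i1: "integrable lborel (\<lambda>p. cis (k * (p - \<epsilon> * t)) * g (p - \<epsilon> * t))"
        by (intro integrable_cis_mult integrable_shift_lborel g) auto
      have i2: "integrable lborel (\<lambda>p. cis (k * p) * g p)"
        by (intro integrable_cis_mult g) auto
      have "(LINT p|lborel. cis (k * p) * \<rho> (t, p)) = of_real (laplace t) * (LINT p|lborel. cis (k * p) * g p)
          - (cis ((\<epsilon> * k) * t) * of_real (laplace t)) * (LINT p|lborel. cis (k * (p - \<epsilon> * t)) * g (p - \<epsilon> * t))"
        by (simp only: pt Bochner_Integration.integral_diff[OF integrable_mult_right[OF i2] integrable_mult_right[OF i1]]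
          integral_mult_right_zero)
      then show ?thesis unfolding sh by (simp only: ft_def[symmetric] mult.commute[of "ft g k"])
    qed
    have il: "integrable lborel (\<lambda>t. complex_of_real (laplace t))" by (intro integrable_of_real integrable_laplace)
    have "ft h k = (LINT t|lborel. LINT p|lborel. cis (k * p) * \<rho> (t, p))"
      using h(3)[of k] lborel_pair.integral_fst'[OF integrable_cis_mult[OF i\<rho>, of "\<lambda>z. k * snd z"]] by simp
    also have "\<dots> = (LINT t|lborel. of_real (laplace t) * ft g k) - (LINT t|lborel. ft g k * (cis ((\<epsilon> * k) * t) * of_real (laplace t)))"
      unfolding in1 using il by (intro Bochner_Integration.integral_diff integrable_mult_left integrable_mult_right integrable_cis_mult) auto
    also have "\<dots> = ft g k - ft g k * ft (\<lambda>t. of_real (laplace t)) (\<epsilon> * k)"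
      by (simp only: integral_mult_left_zero integral_mult_right_zero ft_def[of "\<lambda>t. of_real (laplace t)"] integral_complex_of_real laplace_integral) simp
    finally show "ft h k = ft g k - ft g k / (1 + of_real ((\<epsilon> * k)\<^sup>2))" by (simp only: ft_laplace) simp
  qed
qed

section \<open>Derivatives, series and powers of transforms\<close>

lemma has_vector_derivative_iff_quotient:
  "(f has_vector_derivative D) (at x) \<longleftrightarrow> ((\<lambda>s. (f (x + s) - f x) /\<^sub>R s) \<longlongrightarrow> D) (at 0)"
proof -
  have eq: "norm (f (x + s) - f x - s *\<^sub>R D) / norm s = norm ((f (x + s) - f x) /\<^sub>R s - D)" if "s \<noteq> 0" for s
  proof -
    have "(f (x + s) - f x) /\<^sub>R s - D = (f (x + s) - f x - s *\<^sub>R D) /\<^sub>R s"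
      using that by (simp add: scaleR_diff_right)
    then show ?thesis by (simp add: divide_inverse_commute)
  qed
  have "(f has_vector_derivative D) (at x) \<longleftrightarrow> ((\<lambda>s. norm (f (x + s) - f x - s *\<^sub>R D) / norm s) \<longlongrightarrow> 0) (at 0)"
    by (simp add: has_vector_derivative_def has_derivative_at bounded_linear_scaleR_left)
  also have "\<dots> \<longleftrightarrow> ((\<lambda>s. norm ((f (x + s) - f x) /\<^sub>R s - D)) \<longlongrightarrow> 0) (at 0)"
    by (rule filterlim_cong) (auto simp: eventually_at_filter intro!: always_eventually eq[simplified])
  also have "\<dots> \<longleftrightarrow> ((\<lambda>s. (f (x + s) - f x) /\<^sub>R s) \<longlongrightarrow> D) (at 0)"
    by (simp only: tendsto_norm_zero_iff LIM_zero_iff)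
  finally show ?thesis .
qed

lemma norm_cis_diff_le: "norm (cis a - cis b) \<le> \<bar>a - b\<bar>"
proof -
  have "norm (cis a - cis b) = norm (cis b * (exp (\<i> * of_real (a - b)) - 1))"
    unfolding cis_conv_exp[symmetric] by (simp add: right_diff_distrib cis_mult)
  also have "\<dots> = 2 * \<bar>sin ((a - b) / 2)\<bar>" by (simp only: norm_mult norm_cis dist_exp_i_1 mult_1)
  also have "\<dots> \<le> \<bar>a - b\<bar>" using abs_sin_x_le_abs_x[of "(a - b) / 2"] by simp
  finally show ?thesis .
qed

lemma ft_has_vector_derivative:
  assumes h: "integrable lborel h" and ph: "integrable lborel (\<lambda>p. of_real p * h p)"
  shows "(ft h has_vector_derivative ft (\<lambda>p. \<i> * (of_real p * h p)) k) (at k)"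
  unfolding has_vector_derivative_iff_quotient tendsto_at_iff_sequentially comp_def
proof (intro allI impI)
  have [measurable]: "h \<in> borel_measurable borel" using h by auto
  let ?q = "\<lambda>s p. ((cis ((k + s) * p) - cis (k * p)) /\<^sub>R s) * h p"
  fix X :: "nat \<Rightarrow> real" assume X0: "\<forall>i. X i \<in> UNIV - {0}" and X: "X \<longlonglongrightarrow> 0"
  have eq: "(ft h (k + s) - ft h k) /\<^sub>R s = (LINT p|lborel. ?q s p)" for s
  proof -
    have "ft h (k + s) - ft h k = (LINT p|lborel. (cis ((k + s) * p) - cis (k * p)) * h p)"
      unfolding ft_def using integrable_cis_mult[OF h, of "\<lambda>p. (k + s) * p"] integrable_cis_mult[OF h, of "\<lambda>p. k * p"]
      by (simp add: left_diff_distrib)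
    then show ?thesis by simp
  qed
  have "(\<lambda>n. LINT p|lborel. ?q (X n) p) \<longlonglongrightarrow> (LINT p|lborel. cis (k * p) * (\<i> * (of_real p * h p)))"
  proof (rule integral_dominated_convergence[where w="\<lambda>p. norm (of_real p * h p)"])
    show "AE p in lborel. (\<lambda>n. ?q (X n) p) \<longlonglongrightarrow> cis (k * p) * (\<i> * (of_real p * h p))"
    proof (rule AE_I2)
      fix p :: real
      have "((\<lambda>s. cis (s * p)) has_vector_derivative p *\<^sub>R (\<i> * cis (k * p))) (at k)"
        unfolding has_vector_derivative_def by (auto intro!: derivative_eq_intros simp: fun_eq_iff)
      then have "(\<lambda>n. (cis ((k + X n) * p) - cis (k * p)) /\<^sub>R X n) \<longlonglongrightarrow> p *\<^sub>R (\<i> * cis (k * p))"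
        unfolding has_vector_derivative_iff_quotient tendsto_at_iff_sequentially comp_def using X0 X by blast
      then have "(\<lambda>n. ?q (X n) p) \<longlonglongrightarrow> p *\<^sub>R (\<i> * cis (k * p)) * h p"
        by (rule tendsto_mult_right)
      then show "(\<lambda>n. ?q (X n) p) \<longlonglongrightarrow> cis (k * p) * (\<i> * (of_real p * h p))"
        by (simp add: scaleR_conv_of_real mult_ac)
    qed
    show "AE p in lborel. norm (?q (X n) p) \<le> norm (of_real p * h p)" for n
    proof (rule AE_I2)
      fix p :: real
      have "norm (cis ((k + X n) * p) - cis (k * p)) \<le> \<bar>X n\<bar> * \<bar>p\<bar>"
        using norm_cis_diff_le[of "(k + X n) * p" "k * p"] by (simp add: algebra_simps abs_mult)
      then have "norm ((cis ((k + X n) * p) - cis (k * p)) /\<^sub>R X n) \<le> \<bar>p\<bar>"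
        using X0[rule_format, of n] by (simp add: pos_divide_le_eq mult.commute flip: divide_inverse_commute)
      then show "norm (?q (X n) p) \<le> norm (of_real p * h p)"
        by (simp only: norm_mult norm_of_real mult_right_mono norm_ge_zero)
    qed
  qed (use ph in auto)
  then show "(\<lambda>n. (ft h (k + X n) - ft h k) /\<^sub>R X n) \<longlonglongrightarrow> ft (\<lambda>p. \<i> * (of_real p * h p)) k"
    unfolding eq by (simp only: ft_def)
qed

lemma ft_suminf:
  assumes i: "\<And>n. integrable lborel (h n)" and s: "summable (\<lambda>n. LINT p|lborel. norm (h n p))"
  obtains u where "integrable lborel u" "\<And>k. (\<lambda>n. ft (h n) k) sums ft u k"
proof -
  have [measurable]: "h n \<in> borel_measurable borel" for n using i[of n] by auto
  have "(\<integral>\<^sup>+p. (\<Sum>n. ennreal (norm (h n p))) \<partial>lborel) = (\<Sum>n. \<integral>\<^sup>+p. norm (h n p) \<partial>lborel)"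
    by (rule nn_integral_suminf) measurable
  also have "\<dots> = (\<Sum>n. ennreal (LINT p|lborel. norm (h n p)))"
    using i by (intro suminf_cong nn_integral_eq_integral) auto
  also have "\<dots> = ennreal (\<Sum>n. LINT p|lborel. norm (h n p))"
    using s by (intro suminf_ennreal2) (auto simp: integral_nonneg_AE)
  finally have fin: "(\<integral>\<^sup>+p. (\<Sum>n. ennreal (norm (h n p))) \<partial>lborel) \<noteq> \<infinity>" by simp
  have "AE p in lborel. (\<Sum>n. ennreal (norm (h n p))) \<noteq> \<infinity>"
    by (rule nn_integral_PInf_AE[OF _ fin]) measurable
  then have ae: "AE p in lborel. summable (\<lambda>n. norm (h n p))"
    by eventually_elim (rule summable_suminf_not_top, auto)
  show ?thesis
  proof
    show "integrable lborel (\<lambda>p. \<Sum>n. h n p)" by (rule integrable_suminf[OF i ae s])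
    fix k
    have ic: "integrable lborel (\<lambda>p. cis (k * p) * h n p)" for n by (intro integrable_cis_mult i) auto
    have "(\<lambda>n. LINT p|lborel. cis (k * p) * h n p) sums (LINT p|lborel. (\<Sum>n. cis (k * p) * h n p))"
      by (rule sums_integral[OF ic]) (use ae s in \<open>auto simp: norm_mult\<close>)
    also have "(LINT p|lborel. (\<Sum>n. cis (k * p) * h n p)) = (LINT p|lborel. cis (k * p) * (\<Sum>n. h n p))"
    proof (rule integral_cong_AE)
      show "AE p in lborel. (\<Sum>n. cis (k * p) * h n p) = cis (k * p) * (\<Sum>n. h n p)"
        using ae by eventually_elim (rule suminf_mult[OF summable_norm_cancel])
    qed auto
    finally show "(\<lambda>n. ft (h n) k) sums ft (\<lambda>p. \<Sum>n. h n p) k" by (simp only: ft_def)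
  qed
qed

lemma ft_power:
  assumes "integrable lborel h"
  obtains u where "integrable lborel u" "\<And>k. ft u k = ft h k ^ Suc n"
    "(LINT p|lborel. norm (u p)) \<le> (LINT p|lborel. norm (h p)) ^ Suc n"
proof -
  have "\<exists>u. integrable lborel u \<and> (\<forall>k. ft u k = ft h k ^ Suc n) \<and>
      (LINT p|lborel. norm (u p)) \<le> (LINT p|lborel. norm (h p)) ^ Suc n"
  proof (induction n)
    case 0
    show ?case using assms by (intro exI[of _ h]) auto
  next
    case (Suc n)
    then obtain u where u: "integrable lborel u" "\<And>k. ft u k = ft h k ^ Suc n"
      "(LINT p|lborel. norm (u p)) \<le> (LINT p|lborel. norm (h p)) ^ Suc n" by blast
    obtain v where v: "integrable lborel v" "\<And>k. ft v k = ft h k * ft u k"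
      "(LINT p|lborel. norm (v p)) \<le> (LINT p|lborel. norm (h p)) * (LINT p|lborel. norm (u p))"
      using ft_convolution[OF assms u(1)] by metis
    have "(LINT p|lborel. norm (v p)) \<le> (LINT p|lborel. norm (h p)) * (LINT p|lborel. norm (h p)) ^ Suc n"
      using v(3) mult_left_mono[OF u(3), of "LINT p|lborel. norm (h p)"] by (simp add: integral_nonneg_AE)
    then show ?case using v u by (intro exI[of _ v]) auto
  qed
  then show ?thesis using that by blast
qed

text \<open>By telescoping. The gain over a plain bound for \<open>v ^ n\<close> is the surviving
  factor \<open>e\<close>: with an integrable decay in the place of \<open>e\<close>, the function
  \<open>v ^ n - 1\<close> becomes integrable too.\<close>

lemma norm_power_diff_one_le:
  fixes v :: "'a::real_normed_field"
  assumes v: "norm v \<le> M" and M: "1 \<le> M" and d: "norm (v - 1) \<le> M * e"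
  shows "norm (v ^ n - 1) \<le> real n * M ^ n * e"
proof (induction n)
  case (Suc n)
  have e: "e \<ge> 0" using d M by (smt (verit) norm_ge_zero zero_le_mult_iff)
  have "v ^ Suc n - 1 = v * (v ^ n - 1) + (v - 1)" by (simp add: algebra_simps)
  then have "norm (v ^ Suc n - 1) \<le> norm v * norm (v ^ n - 1) + norm (v - 1)"
    by (metis norm_mult norm_triangle_ineq)
  also have "\<dots> \<le> M * (real n * M ^ n * e) + M * e"
    using Suc v M d by (intro add_mono mult_mono) auto
  also have "\<dots> \<le> M * (real n * M ^ n * e) + M ^ Suc n * e"
    using M e by (intro add_left_mono mult_right_mono) (auto simp: one_le_power)
  also have "\<dots> = real (Suc n) * M ^ Suc n * e" by (simp add: algebra_simps)
  finally show ?case .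
qed simp

lemma ft_truncate:
  fixes g :: "real \<Rightarrow> complex"
  assumes g: "integrable lborel g" and e: "e > 0"
  obtains N :: real where "N > 0" "(LINT p|lborel. norm (g p - indicator {- N..N} p *\<^sub>R g p)) < e"
proof -
  have [measurable]: "g \<in> borel_measurable borel" using g by auto
  have "(\<lambda>n. LINT p|lborel. norm (g p - indicator {- real (Suc n)..real (Suc n)} p *\<^sub>R g p)) \<longlonglongrightarrow> (LINT p::real|lborel. 0)"
  proof (rule integral_dominated_convergence[where w="\<lambda>p. norm (g p)"])
    show "AE p in lborel. (\<lambda>n. norm (g p - indicator {- real (Suc n)..real (Suc n)} p *\<^sub>R g p)) \<longlonglongrightarrow> 0"
    proof (rule AE_I2)
      fix p :: real
      obtain n0 :: nat where n0: "\<bar>p\<bar> \<le> real n0" using real_arch_simple by blast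
      have "eventually (\<lambda>n. norm (g p - indicator {- real (Suc n)..real (Suc n)} p *\<^sub>R g p) = 0) sequentially"
        using eventually_ge_at_top[of n0]
      proof eventually_elim
        case (elim n)
        then have "p \<in> {- real (Suc n)..real (Suc n)}" using n0 by (auto simp: abs_le_iff)
        then show ?case by simp
      qed
      then show "(\<lambda>n. norm (g p - indicator {- real (Suc n)..real (Suc n)} p *\<^sub>R g p)) \<longlonglongrightarrow> 0"
        by (rule tendsto_eventually)
    qed
    show "AE p in lborel. norm (norm (g p - indicator {- real (Suc n)..real (Suc n)} p *\<^sub>R g p)) \<le> norm (g p)" for n
      by (rule AE_I2) (auto split: split_indicator)
  qed (use g in auto)
  from LIMSEQ_D[OF this e] obtain n where "norm ((LINT p|lborel. norm (g p - indicator {- real (Suc n)..real (Suc n)} p *\<^sub>R g p)) - (LINT p::real|lborel. 0)) < e"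
    by blast
  then show ?thesis by (intro that[of "real (Suc n)"]) auto
qed

text \<open>Truncating \<open>g\<close> makes its transform smooth with bounded derivatives; the
  multiplier 1/(1 + (\<open>\<epsilon>\<close> k)^2) from \<open>ft_mollify\<close> adds quadratic
  decay. Each of the two changes costs less than e/2 in L^1.\<close>

lemma ft_smooth_approx:
  assumes g: "integrable lborel g" and e: "e > 0"
  obtains h w w1 w2 C \<epsilon> where "integrable lborel h" "(LINT p|lborel. norm (h p)) < e"
    "\<And>k. ft g k = w k + ft h k"
    "\<And>k. (w has_vector_derivative w1 k) (at k)" "\<And>k. (w1 has_vector_derivative w2 k) (at k)"
    "continuous_on UNIV w2" "C \<ge> 1" "\<epsilon> > 0"
    "\<And>k. norm (w k) \<le> C / (1 + (\<epsilon> * k)\<^sup>2)" "\<And>k. norm (w1 k) \<le> C / (1 + (\<epsilon> * k)\<^sup>2)"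
    "\<And>k. norm (w2 k) \<le> C / (1 + (\<epsilon> * k)\<^sup>2)"
proof -
  have [measurable]: "g \<in> borel_measurable borel" using g by auto
  obtain N :: real where N: "N > 0" "(LINT p|lborel. norm (g p - indicator {- N..N} p *\<^sub>R g p)) < e / 2"
    using ft_truncate[OF g, of "e / 2"] e by auto
  define f where "f p = indicator {- N..N} p *\<^sub>R g p" for p
  have [measurable]: "f \<in> borel_measurable borel" unfolding f_def by measurable
  have f: "integrable lborel f" unfolding f_def using g by (rule integrable_mult_indicator[rotated]) simp
  have pf: "integrable lborel (\<lambda>p. of_real p * u p)"
    if u: "integrable lborel u" and supp: "\<And>p. \<bar>p\<bar> > N \<Longrightarrow> u p = 0" for u :: "real \<Rightarrow> complex"
  proof (rule Bochner_Integration.integrable_bound)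
    show "integrable lborel (\<lambda>p. N * norm (u p))" using u by simp
    show "AE p in lborel. norm (of_real p * u p) \<le> norm (N * norm (u p))"
    proof (rule AE_I2)
      fix p :: real
      show "norm (of_real p * u p) \<le> norm (N * norm (u p))"
        using supp[of p] N by (cases "\<bar>p\<bar> > N") (auto simp: norm_mult intro!: mult_right_mono)
    qed
  qed (use u in auto)
  have f0: "\<bar>p\<bar> > N \<Longrightarrow> f p = 0" for p by (auto simp: f_def indicator_def)
  define f1 where "f1 p = \<i> * (of_real p * f p)" for p
  define f2 where "f2 p = \<i> * (of_real p * f1 p)" for p
  have pf0: "integrable lborel (\<lambda>p. of_real p * f p)" by (rule pf[OF f f0])
  have f1: "integrable lborel f1" unfolding f1_def by (intro integrable_mult_right pf0)
  have pf1: "integrable lborel (\<lambda>p. of_real p * f1 p)" by (rule pf[OF f1]) (simp add: f1_def f0)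
  have f2: "integrable lborel f2" unfolding f2_def by (intro integrable_mult_right pf1)
  have q0: "(ft f has_vector_derivative ft f1 k) (at k)" for k
    using ft_has_vector_derivative[OF f pf0] unfolding f1_def .
  have q1: "(ft f1 has_vector_derivative ft f2 k) (at k)" for k
    using ft_has_vector_derivative[OF f1 pf1] unfolding f2_def .
  obtain \<epsilon> h where h: "\<epsilon> > 0" "integrable lborel h" "(LINT p|lborel. norm (h p)) < e / 2"
    "\<And>k. ft h k = ft f k - ft f k / (1 + of_real ((\<epsilon> * k)\<^sup>2))"
    using ft_mollify[OF f, of "e / 2"] e by auto
  define R where "R k = 1 / (1 + (\<epsilon> * k)\<^sup>2)" for k
  have pos: "1 + (\<epsilon> * k)\<^sup>2 > 0" for k by (simp add: add_pos_nonneg)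
  have R0: "R k > 0" and R1: "R k \<le> 1" and xR: "(\<epsilon> * k)\<^sup>2 * R k \<le> 1" and xR': "2 * \<bar>\<epsilon> * k\<bar> * R k \<le> 1" for k
  proof -
    show "R k > 0" "R k \<le> 1" using pos[of k] by (auto simp: R_def)
    show "(\<epsilon> * k)\<^sup>2 * R k \<le> 1" unfolding R_def using pos[of k] by (simp add: divide_simps)
    have "0 \<le> (\<bar>\<epsilon> * k\<bar> - 1)\<^sup>2" by simp
    then have "2 * \<bar>\<epsilon> * k\<bar> \<le> 1 + (\<epsilon> * k)\<^sup>2" by (simp only: power2_diff power2_abs) simp
    then show "2 * \<bar>\<epsilon> * k\<bar> * R k \<le> 1" unfolding R_def using pos[of k] by (simp add: divide_simps)
  qed
  \<comment> \<open>First and second derivative of \<open>R\<close>. From 2|x| <= 1 + x^2 and x^2 <=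
    1 + x^2 with x = \<open>\<epsilon>\<close> k, both are bounded by constant multiples of
    \<open>R\<close> itself, so that differentiation does not lose the decay.\<close>
  define R' where "R' k = - 2 * \<epsilon>\<^sup>2 * k * (R k)\<^sup>2" for k
  define R'' where "R'' k = - 2 * \<epsilon>\<^sup>2 * (R k)\<^sup>2 + 8 * \<epsilon>\<^sup>2 * (\<epsilon> * k)\<^sup>2 * (R k) ^ 3" for k
  have dR: "(R has_real_derivative R' k) (at k)" for k
    unfolding R_def R'_def using pos[of k]
    by (auto intro!: derivative_eq_intros simp: power2_eq_square field_simps)
  have dR': "(R' has_real_derivative R'' k) (at k)" for k
  proof -
    have "(R' has_real_derivative - 2 * \<epsilon>\<^sup>2 * (R k)\<^sup>2 + - 2 * \<epsilon>\<^sup>2 * k * (2 * R k * R' k)) (at k)"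
      unfolding R'_def[abs_def] by (auto intro!: derivative_eq_intros dR[unfolded R'_def] simp: power2_eq_square)
    also have "- 2 * \<epsilon>\<^sup>2 * (R k)\<^sup>2 + - 2 * \<epsilon>\<^sup>2 * k * (2 * R k * R' k) = R'' k"
      by (simp add: R'_def R''_def power2_eq_square power3_eq_cube)
    finally show ?thesis .
  qed
  have bR': "\<bar>R' k\<bar> \<le> \<epsilon> * R k" for k
  proof -
    have "\<bar>R' k\<bar> = \<epsilon> * R k * (2 * \<bar>\<epsilon> * k\<bar> * R k)" using h(1) R0[of k] by (simp add: R'_def abs_mult power2_eq_square)
    also have "\<dots> \<le> \<epsilon> * R k * 1" using h(1) R0[of k] xR'[of k] by (intro mult_left_mono) auto
    finally show ?thesis by simp
  qed
  have bR'': "\<bar>R'' k\<bar> \<le> 10 * \<epsilon>\<^sup>2 * R k" for k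
  proof -
    have a: "(R k)\<^sup>2 \<le> R k" using R0[of k] R1[of k] by (simp add: power2_eq_square)
    have "\<bar>R'' k\<bar> \<le> \<bar>- 2 * \<epsilon>\<^sup>2 * (R k)\<^sup>2\<bar> + \<bar>8 * \<epsilon>\<^sup>2 * (\<epsilon> * k)\<^sup>2 * (R k) ^ 3\<bar>" unfolding R''_def by (rule abs_triangle_ineq)
    also have "\<dots> = 2 * \<epsilon>\<^sup>2 * (R k)\<^sup>2 + 8 * \<epsilon>\<^sup>2 * ((\<epsilon> * k)\<^sup>2 * R k) * (R k)\<^sup>2"
      using R0[of k] by (simp add: abs_of_nonneg power3_eq_cube power2_eq_square[of "R k"])
    also have "\<dots> \<le> 2 * \<epsilon>\<^sup>2 * R k + 8 * \<epsilon>\<^sup>2 * 1 * R k"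
      using a xR[of k] R0[of k] by (intro add_mono mult_mono) auto
    finally show ?thesis by (simp add: mult_ac)
  qed
  define A where "A = (LINT p|lborel. norm (f p)) + (LINT p|lborel. norm (f1 p)) + (LINT p|lborel. norm (f2 p))"
  have nn: "(LINT p|lborel. norm (u p)) \<ge> 0" for u :: "real \<Rightarrow> complex" by (simp add: integral_nonneg_AE)
  have bf: "norm (ft f k) \<le> A" "norm (ft f1 k) \<le> A" "norm (ft f2 k) \<le> A" for k
    using norm_ft_le[of f k] norm_ft_le[of f1 k] norm_ft_le[of f2 k] nn[of f] nn[of f1] nn[of f2]
    unfolding A_def by linarith+
  have A0: "A \<ge> 0" using nn[of f] nn[of f1] nn[of f2] unfolding A_def by linarith
  define w where "w k = ft f k * of_real (R k)" for k
  define w1 where "w1 k = ft f k * of_real (R' k) + ft f1 k * of_real (R k)" for k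
  define w2 where "w2 k = (ft f k * of_real (R'' k) + ft f1 k * of_real (R' k)) + (ft f1 k * of_real (R' k) + ft f2 k * of_real (R k))" for k
  note ofr = has_vector_derivative_of_real[where 'a=complex]
  have d1: "(w has_vector_derivative w1 k) (at k)" for k
    unfolding w_def[abs_def] w1_def by (rule has_vector_derivative_mult[OF q0 ofr[OF dR]])
  have d2: "(w1 has_vector_derivative w2 k) (at k)" for k
    unfolding w1_def[abs_def] w2_def
    by (intro has_vector_derivative_add has_vector_derivative_mult q0 q1 ofr dR dR')
  have cR: "continuous_on UNIV R" unfolding R_def[abs_def] by (intro continuous_intros) (metis pos less_irrefl)
  have cR1: "continuous_on UNIV R'" unfolding R'_def[abs_def] by (intro continuous_intros cR)
  have cR2: "continuous_on UNIV R''" unfolding R''_def[abs_def] by (intro continuous_intros cR)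
  have c2: "continuous_on UNIV w2"
    unfolding w2_def[abs_def] by (intro continuous_intros continuous_ft f f1 f2 cR cR1 cR2)
  \<comment> \<open>The bracket adds up the bounds for the four terms of \<open>w2\<close> and thus
    also covers \<open>w\<close> and \<open>w1\<close>; the leading 1 ensures C >= 1.\<close>
  define C where "C = 1 + A * (1 + 2 * \<epsilon> + 10 * \<epsilon>\<^sup>2)"
  have b0: "norm (ft f k * of_real (R k)) \<le> A * R k" "norm (ft f1 k * of_real (R k)) \<le> A * R k" "norm (ft f2 k * of_real (R k)) \<le> A * R k" for k
    using bf R0[of k] by (auto simp: norm_mult intro!: mult_right_mono)
  have b1: "norm (ft f k * of_real (R' k)) \<le> A * (\<epsilon> * R k)" "norm (ft f1 k * of_real (R' k)) \<le> A * (\<epsilon> * R k)" for k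
    using bf bR'[of k] R0[of k] A0 by (auto simp: norm_mult intro!: mult_mono)
  have b2: "norm (ft f k * of_real (R'' k)) \<le> A * (10 * \<epsilon>\<^sup>2 * R k)" for k
    using bf bR''[of k] R0[of k] A0 by (auto simp: norm_mult intro!: mult_mono)
  have p: "0 \<le> A * R k" "0 \<le> A * (\<epsilon> * R k)" "0 \<le> A * (10 * \<epsilon>\<^sup>2 * R k)" for k using A0 R0[of k] h(1) by auto
  have CR: "C / (1 + (\<epsilon> * k)\<^sup>2) = R k + A * R k + 2 * (A * (\<epsilon> * R k)) + A * (10 * \<epsilon>\<^sup>2 * R k)" for k
  proof -
    have "C / (1 + (\<epsilon> * k)\<^sup>2) = C * R k" by (simp add: R_def)
    then show ?thesis by (simp add: C_def algebra_simps)
  qed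
  show ?thesis
  proof
    show "integrable lborel (\<lambda>p. (g p - f p) + h p)" using g f h(2) by auto
    have "(LINT p|lborel. norm ((g p - f p) + h p)) \<le> (LINT p|lborel. norm (g p - f p) + norm (h p))"
      using g f h(2) by (intro integral_mono) (auto intro: norm_triangle_ineq)
    also have "\<dots> = (LINT p|lborel. norm (g p - f p)) + (LINT p|lborel. norm (h p))" using g f h(2) by simp
    also have "\<dots> < e" using N(2)[folded f_def] h(3) by linarith
    finally show "(LINT p|lborel. norm ((g p - f p) + h p)) < e" .
    have R_cx: "ft f k * of_real (R k) = ft f k / (1 + of_real ((\<epsilon> * k)\<^sup>2))" for k by (simp add: R_def)
    show "ft g k = w k + ft (\<lambda>p. (g p - f p) + h p) k" for k
      using g f h(2) by (simp only: ft_add ft_diff Bochner_Integration.integrable_diff h(4) w_def R_cx) simp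
    show "C \<ge> 1" unfolding C_def using A0 h(1) by (auto intro!: mult_nonneg_nonneg add_nonneg_nonneg)
    show "norm (w k) \<le> C / (1 + (\<epsilon> * k)\<^sup>2)" for k
      unfolding CR w_def using b0(1)[of k] p[of k] R0[of k] by linarith
    show "norm (w1 k) \<le> C / (1 + (\<epsilon> * k)\<^sup>2)" for k
      unfolding CR w1_def using b1(1)[of k] b0(2)[of k] p[of k] R0[of k]
        norm_triangle_ineq[of "ft f k * of_real (R' k)" "ft f1 k * of_real (R k)"] by linarith
    show "norm (w2 k) \<le> C / (1 + (\<epsilon> * k)\<^sup>2)" for k
      unfolding CR w2_def using b2[of k] b1(2)[of k] b0(3)[of k] p[of k] R0[of k]
        norm_triangle_ineq[of "ft f k * of_real (R'' k)" "ft f1 k * of_real (R' k)"]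
        norm_triangle_ineq[of "ft f1 k * of_real (R' k)" "ft f2 k * of_real (R k)"]
        norm_triangle_ineq[of "ft f k * of_real (R'' k) + ft f1 k * of_real (R' k)" "ft f1 k * of_real (R' k) + ft f2 k * of_real (R k)"] by linarith
  qed (use d1 d2 c2 h(1) in auto)
qed

text \<open>Two derivatives of the n-th power of 1/(1 + w) cost a factor quadratic in n and a fixed
  power of \<open>M\<close>, and \<open>ft_of_smooth\<close> turns this into a Wiener norm. The
  exponential rate is thus \<open>M\<close>, a bound for the supremum of 1/(1 + w).\<close>

lemma ft_inverse_power:
  assumes d1: "\<And>k. (w has_vector_derivative w1 k) (at k)" and d2: "\<And>k. (w1 has_vector_derivative w2 k) (at k)"
    and c2: "continuous_on UNIV w2" and C: "C \<ge> 1" and iR: "integrable lborel R" and R: "\<And>k. 0 \<le> R k" "\<And>k. R k \<le> 1"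
    and b: "\<And>k. norm (w k) \<le> C * R k" "\<And>k. norm (w1 k) \<le> C * R k" "\<And>k. norm (w2 k) \<le> C * R k"
    and M: "1 \<le> M" "\<And>k. 1 \<le> M * norm (1 + w k)"
  obtains h where "integrable lborel h" "\<And>k. ft h k = inverse (1 + w k) ^ n - 1"
    "(LINT p|lborel. norm (h p)) \<le> (3 * C\<^sup>2 * M\<^sup>2 * (LINT k|lborel. R k)) * (real n + 1)\<^sup>2 * M ^ n"
proof -
  define v where "v k = inverse (1 + w k)" for k
  have nz: "1 + w k \<noteq> 0" for k using M(2)[of k] by auto
  have vM: "norm (v k) \<le> M" for k
    using M(2)[of k] nz[of k] unfolding v_def norm_inverse by (simp add: field_simps)
  have dv: "(v has_vector_derivative - w1 k * (v k)\<^sup>2) (at k)" for k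
  proof -
    have "((\<lambda>k. 1 + w k) has_vector_derivative 0 + w1 k) (at k)" by (intro has_vector_derivative_add has_vector_derivative_const d1)
    from field_vector_diff_chain_at[OF this DERIV_inverse[OF nz]]
    show ?thesis by (simp add: o_def v_def[abs_def] power2_eq_square)
  qed
  have dvn: "((\<lambda>k. v k ^ n) has_vector_derivative - of_nat n * w1 k * v k ^ Suc n) (at k)" for n k
  proof -
    have "((\<lambda>z. z ^ n) has_field_derivative of_nat n * v k ^ (n - 1)) (at (v k))"
      by (auto intro!: derivative_eq_intros)
    from field_vector_diff_chain_at[OF dv this]
    have "((\<lambda>k. v k ^ n) has_vector_derivative - w1 k * (v k)\<^sup>2 * (of_nat n * v k ^ (n - 1))) (at k)"
      by (simp add: o_def)
    moreover have "- w1 k * (v k)\<^sup>2 * (of_nat n * v k ^ (n - 1)) = - of_nat n * w1 k * v k ^ Suc n"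
      by (cases n) (simp_all add: power2_eq_square algebra_simps)
    ultimately show ?thesis by (simp only:)
  qed
  define u where "u k = v k ^ n - 1" for k
  define u1 where "u1 k = - of_nat n * w1 k * v k ^ Suc n" for k
  define u2 where "u2 k = - of_nat n * w1 k * (- of_nat (Suc n) * w1 k * v k ^ Suc (Suc n)) + - of_nat n * w2 k * v k ^ Suc n" for k
  have du: "(u has_vector_derivative u1 k) (at k)" for k
    using has_vector_derivative_diff[OF dvn[of n k] has_vector_derivative_const[of 1]] by (simp add: u_def[abs_def] u1_def)
  have du1: "(u1 has_vector_derivative u2 k) (at k)" for k
    unfolding u1_def[abs_def] u2_def
    by (intro has_vector_derivative_mult[OF has_vector_derivative_mult_right[OF d2] dvn])
  have cw1: "continuous_on UNIV w1" and cv: "continuous_on UNIV v"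
    by (intro continuous_at_imp_continuous_on ballI has_vector_derivative_continuous[OF d2] has_vector_derivative_continuous[OF dv])+
  have cu2: "continuous_on UNIV u2" unfolding u2_def[abs_def] by (intro continuous_intros cw1 cv c2)
  have M0: "M \<ge> 0" using M by simp
  have vn: "norm (v k ^ m) \<le> M ^ m" for m k using vM[of k] by (simp add: norm_power power_mono)
  have CR0: "0 \<le> C * R k" for k using C R(1)[of k] by auto
  define K where "K k = (C * R k) * M ^ n" for k
  have K0: "K k \<ge> 0" for k using CR0[of k] M0 by (simp add: K_def)
  have bu: "norm (u k) \<le> real n * K k" for k
  proof -
    have "v k - 1 = - (v k * w k)" using nz[of k] by (simp add: v_def field_simps)
    then have "norm (v k - 1) = norm (v k) * norm (w k)" by (simp add: norm_mult)
    also have "\<dots> \<le> M * (C * R k)" using vM b(1) M0 by (intro mult_mono) auto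
    finally have "norm (u k) \<le> real n * M ^ n * (C * R k)" unfolding u_def by (rule norm_power_diff_one_le[OF vM M(1)])
    then show ?thesis by (simp add: K_def mult_ac)
  qed
  have bu1: "norm (u1 k) \<le> real n * M * K k" for k
  proof -
    have "norm (u1 k) = real n * norm (w1 k) * norm (v k ^ Suc n)" by (simp add: u1_def norm_mult)
    also have "\<dots> \<le> real n * (C * R k) * M ^ Suc n" using b(2)[of k] vn[of k "Suc n"] C R(1)[of k] by (intro mult_mono mult_nonneg_nonneg) auto
    finally show ?thesis by (simp add: K_def mult_ac)
  qed
  have bu2: "norm (u2 k) \<le> real n * real (Suc n) * C * M\<^sup>2 * K k + real n * M * K k" for k
  proof -
    have "norm (u2 k) \<le> real n * norm (w1 k) * (real (Suc n) * norm (w1 k) * norm (v k ^ Suc (Suc n))) + real n * norm (w2 k) * norm (v k ^ Suc n)"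
      unfolding u2_def by (rule norm_triangle_le) (simp add: norm_mult del: of_nat_Suc)
    also have "\<dots> \<le> real n * C * (real (Suc n) * (C * R k) * M ^ Suc (Suc n)) + real n * (C * R k) * M ^ Suc n"
    proof (intro add_mono mult_mono mult_nonneg_nonneg)
      have "C * R k \<le> C * 1" using R(2)[of k] C by (intro mult_left_mono) auto
      then show "norm (w1 k) \<le> C" using b(2)[of k] by linarith
    qed (use b(2,3)[of k] vn[of k "Suc n"] vn[of k "Suc (Suc n)"] R(1)[of k] C M0 in auto)
    also have "\<dots> = real n * real (Suc n) * C * M\<^sup>2 * K k + real n * M * K k" by (simp add: K_def power2_eq_square mult_ac)
    finally show ?thesis .
  qed
  have bd: "norm (u k - u2 k) \<le> (3 * C\<^sup>2 * M\<^sup>2 * (real n + 1)\<^sup>2 * M ^ n) * R k" for k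
  proof -
    have "norm (u k - u2 k) \<le> real n * K k + (real n * real (Suc n) * C * M\<^sup>2 * K k + real n * M * K k)"
      using bu[of k] bu2[of k] norm_triangle_ineq4[of "u k" "u2 k"] by linarith
    also have "\<dots> = (real n + real n * real (Suc n) * (C * M\<^sup>2) + real n * M) * K k" by (simp add: algebra_simps)
    \<comment> \<open>Each of the three summands is at most C M^2 (n + 1)^2; \<open>K\<close>
      contributes the second factor C and the power of \<open>M\<close> in the final bound.\<close>
    also have "\<dots> \<le> (3 * (C * M\<^sup>2) * (real n + 1)\<^sup>2) * K k"
    proof (rule mult_right_mono[OF _ K0])
      have m2: "M \<le> M\<^sup>2" "1 \<le> M\<^sup>2" using M(1) by (auto simp: power2_eq_square intro: mult_mono[of 1 M 1 M, simplified])
      have c1: "M\<^sup>2 \<le> C * M\<^sup>2" using C by (simp add: mult_le_cancel_right1)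
      have n2: "real n \<le> (real n + 1)\<^sup>2" "real n * real (Suc n) \<le> (real n + 1)\<^sup>2" by (simp_all add: power2_eq_square algebra_simps)
      have "real n \<le> (real n + 1)\<^sup>2 * (C * M\<^sup>2)" using mult_mono[OF n2(1), of 1 "C * M\<^sup>2"] m2 c1 by simp
      moreover have "real n * M \<le> (real n + 1)\<^sup>2 * (C * M\<^sup>2)" using m2 c1 M0 by (intro mult_mono[OF n2(1)]) auto
      moreover have "real n * real (Suc n) * (C * M\<^sup>2) \<le> (real n + 1)\<^sup>2 * (C * M\<^sup>2)" using m2 c1 by (intro mult_right_mono[OF n2(2)]) auto
      ultimately show "real n + real n * real (Suc n) * (C * M\<^sup>2) + real n * M \<le> 3 * (C * M\<^sup>2) * (real n + 1)\<^sup>2" by (simp add: mult_ac)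
    qed
    finally show ?thesis by (simp add: K_def power2_eq_square mult_ac)
  qed
  have iu: "integrable lborel (\<lambda>k. u k - u2 k)"
  proof (rule Bochner_Integration.integrable_bound)
    show "integrable lborel (\<lambda>k. (3 * C\<^sup>2 * M\<^sup>2 * (real n + 1)\<^sup>2 * M ^ n) * R k)" by (intro integrable_mult_right iR)
    have "continuous_on UNIV (\<lambda>k. u k - u2 k)" unfolding u_def[abs_def] by (intro continuous_intros cv cu2)
    then show "(\<lambda>k. u k - u2 k) \<in> borel_measurable lborel" by (simp add: borel_measurable_continuous_onI)
    show "AE k in lborel. norm (u k - u2 k) \<le> norm ((3 * C\<^sup>2 * M\<^sup>2 * (real n + 1)\<^sup>2 * M ^ n) * R k)"
      using bd by (intro AE_I2) (auto intro: order_trans[OF _ abs_ge_self])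
  qed
  define B where "B = real n * M * (C * M ^ n)"
  have KB: "K k \<le> C * M ^ n" for k using R(2)[of k] mult_left_mono[OF R(2)[of k], of C] C M0 unfolding K_def by (intro mult_right_mono) auto
  have B: "norm (u k) \<le> B" "norm (u1 k) \<le> B" for k
  proof -
    have "real n * M * K k \<le> B" unfolding B_def using KB[of k] M0 by (intro mult_left_mono) auto
    moreover have "real n * K k \<le> real n * M * K k" using K0[of k] M(1) by (simp add: mult_right_mono mult_le_cancel_left1)
    ultimately show "norm (u k) \<le> B" "norm (u1 k) \<le> B" using bu[of k] bu1[of k] by linarith+
  qed
  obtain h where h: "integrable lborel h" "\<And>k. ft h k = u k" "(LINT p|lborel. norm (h p)) \<le> (LINT x|lborel. norm (u x - u2 x))"
    using ft_of_smooth[OF du du1 cu2 B iu] by blast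
  show ?thesis
  proof
    show "integrable lborel h" by fact
    show "ft h k = inverse (1 + w k) ^ n - 1" for k using h(2) by (simp add: u_def v_def)
    have "(LINT x|lborel. norm (u x - u2 x)) \<le> (LINT k|lborel. (3 * C\<^sup>2 * M\<^sup>2 * (real n + 1)\<^sup>2 * M ^ n) * R k)"
      by (intro integral_mono integrable_norm iu integrable_mult_right iR bd)
    then show "(LINT p|lborel. norm (h p)) \<le> (3 * C\<^sup>2 * M\<^sup>2 * (LINT k|lborel. R k)) * (real n + 1)\<^sup>2 * M ^ n"
      using h(3) by (simp add: mult_ac)
  qed
qed

text \<open>The split 1 + ft g = (1 + w) + ft q is chosen so that the L^1 norm of \<open>q\<close>
  times the bound for 1/(1 + w) stays below 1/2; the geometric series then beats the polynomial
  factor from \<open>ft_inverse_power\<close>.\<close>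

theorem wiener_inverse:
  assumes g: "integrable lborel g" and nz: "\<And>k. 1 + ft g k \<noteq> 0"
  obtains h where "integrable lborel h" "\<And>k. inverse (1 + ft g k) = 1 + ft h k"
proof -
  \<comment> \<open>Pointwise nonvanishing gives a uniform lower bound: the approximation with error
    1/4 leaves the norm of \<open>ft g k\<close> at most 1/2 for large k, a form of the
    Riemann-Lebesgue lemma, and the remaining compact interval has a positive minimum.\<close>
  have "\<exists>m>0. \<forall>k. m \<le> norm (1 + ft g k)"
  proof -
    obtain h w w1 w2 C \<epsilon> where h: "integrable lborel h" "(LINT p|lborel. norm (h p)) < 1/4"
      "\<And>k. ft g k = w k + ft h k" and \<epsilon>: "\<epsilon> > 0" "C \<ge> 1" "\<And>k. norm (w k) \<le> C / (1 + (\<epsilon> * k)\<^sup>2)"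
      using ft_smooth_approx[OF g, of "1/4"] by (metis zero_less_divide_1_iff zero_less_numeral)
    define K where "K = 4 * C / \<epsilon>"
    have far: "norm (1 + ft g k) \<ge> 1/2" if "\<bar>k\<bar> \<ge> K" for k
    proof -
      have "4 * C \<le> \<bar>\<epsilon> * k\<bar>" using that \<epsilon>(1) by (simp add: K_def field_simps abs_mult)
      moreover have "\<bar>\<epsilon> * k\<bar> \<le> 1 + (\<epsilon> * k)\<^sup>2"
      proof -
        have "0 \<le> (\<bar>\<epsilon> * k\<bar> - 1)\<^sup>2" by simp
        then have "2 * \<bar>\<epsilon> * k\<bar> \<le> 1 + (\<epsilon> * k)\<^sup>2" by (simp only: power2_diff power2_abs) simp
        then show ?thesis using abs_ge_zero[of "\<epsilon> * k"] by linarith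
      qed
      ultimately have "4 * C \<le> 1 + (\<epsilon> * k)\<^sup>2" by linarith
      then have "C / (1 + (\<epsilon> * k)\<^sup>2) \<le> 1/4" using \<epsilon>(2) by (simp add: divide_simps add_pos_nonneg split: if_splits)
      then have "norm (w k) \<le> 1/4" using \<epsilon>(3)[of k] by linarith
      moreover have "norm (ft h k) \<le> 1/4" using norm_ft_le[of h k] h(2) by linarith
      ultimately have "norm (ft g k) \<le> 1/2" unfolding h(3) using norm_triangle_ineq[of "w k" "ft h k"] by linarith
      then show ?thesis using norm_triangle_ineq4[of "1 + ft g k" "ft g k"] by simp
    qed
    have c: "continuous_on {- \<bar>K\<bar>..\<bar>K\<bar>} (\<lambda>k. norm (1 + ft g k))" by (intro continuous_intros continuous_ft g)
    have "\<exists>k0\<in>{- \<bar>K\<bar>..\<bar>K\<bar>}. \<forall>k\<in>{- \<bar>K\<bar>..\<bar>K\<bar>}. norm (1 + ft g k0) \<le> norm (1 + ft g k)"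
      by (rule continuous_attains_inf[OF _ _ c]) auto
    then obtain k0 where k0: "\<And>k. k \<in> {- \<bar>K\<bar>..\<bar>K\<bar>} \<Longrightarrow> norm (1 + ft g k0) \<le> norm (1 + ft g k)"
      by blast
    have "min (1/2) (norm (1 + ft g k0)) \<le> norm (1 + ft g k)" for k
    proof (cases "\<bar>k\<bar> \<le> \<bar>K\<bar>")
      case True
      then show ?thesis using k0[of k] by (auto simp: abs_le_iff)
    next
      case False
      then have "1/2 \<le> norm (1 + ft g k)" by (intro far) linarith
      then show ?thesis by (simp add: min_le_iff_disj)
    qed
    then show ?thesis using nz[of k0] by (intro exI[of _ "min (1/2) (norm (1 + ft g k0))"]) auto
  qed
  then obtain m0 where m0: "m0 > 0" "\<And>k. m0 \<le> norm (1 + ft g k)" by blast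
  \<comment> \<open>The cap at 1 gives M >= 1 below, as \<open>ft_inverse_power\<close>
    requires.\<close>
  define m where "m = min 1 m0"
  have m: "0 < m" "m \<le> 1" "\<And>k. m \<le> norm (1 + ft g k)" using m0 by (auto simp: m_def min_le_iff_disj)
  obtain q w w1 w2 C \<epsilon> where q: "integrable lborel q" "(LINT p|lborel. norm (q p)) < m / 4"
      "\<And>k. ft g k = w k + ft q k"
    and d: "\<And>k. (w has_vector_derivative w1 k) (at k)" "\<And>k. (w1 has_vector_derivative w2 k) (at k)"
      "continuous_on UNIV w2" "C \<ge> 1" and \<epsilon>: "\<epsilon> > 0"
    and b: "\<And>k. norm (w k) \<le> C / (1 + (\<epsilon> * k)\<^sup>2)" "\<And>k. norm (w1 k) \<le> C / (1 + (\<epsilon> * k)\<^sup>2)"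
      "\<And>k. norm (w2 k) \<le> C / (1 + (\<epsilon> * k)\<^sup>2)"
    using ft_smooth_approx[OF g, of "m / 4"] m(1) by (metis zero_less_divide_iff zero_less_numeral)
  define R where "R k = 1 / (1 + (\<epsilon> * k)\<^sup>2)" for k
  have R: "0 \<le> R k" "R k \<le> 1" for k by (auto simp: R_def add_pos_nonneg)
  have iR: "integrable lborel R"
    using lborel_integrable_real_affine[OF cauchy_density_integral(1), of \<epsilon> 0] \<epsilon> by (simp add: R_def[abs_def])
  have b': "norm (w k) \<le> C * R k" "norm (w1 k) \<le> C * R k" "norm (w2 k) \<le> C * R k" for k
    using b[of k] by (simp_all add: R_def)
  \<comment> \<open>As \<open>ft q\<close> is smaller than m/4, the norm of 1 + w is at least 3m/4;
    \<open>M\<close> is the reciprocal of this. The product of \<open>Q\<close> and \<open>M\<close>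
    is then at most 1/3, and 1/2 suffices.\<close>
  define M where "M = 4 / (3 * m)"
  have M1: "1 \<le> M" using m by (simp add: M_def field_simps)
  define Q where "Q = (LINT p|lborel. norm (q p))"
  have Q0: "Q \<ge> 0" unfolding Q_def by (simp add: integral_nonneg_AE)
  have QM: "Q * M \<le> 1/2"
  proof -
    have "Q * M \<le> (m / 4) * M" using q(2) M1 by (intro mult_right_mono) (auto simp: Q_def)
    also have "\<dots> \<le> 1/2" using m(1) by (simp add: M_def)
    finally show ?thesis .
  qed
  have bq: "norm (ft q k) \<le> Q" for k using norm_ft_le by (simp add: Q_def)
  have M2: "1 \<le> M * norm (1 + w k)" for k
  proof -
    have "m \<le> norm (1 + w k) + norm (ft q k)"
      using m(3)[of k] norm_triangle_ineq[of "1 + w k" "ft q k"] by (simp add: q(3) add.assoc)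
    then have "3 * m / 4 \<le> norm (1 + w k)" using bq[of k] q(2) unfolding Q_def by linarith
    then have "M * (3 * m / 4) \<le> M * norm (1 + w k)" using M1 by (intro mult_left_mono) auto
    then show ?thesis using m(1) by (simp add: M_def)
  qed
  define D where "D = 3 * C\<^sup>2 * M\<^sup>2 * (LINT k|lborel. R k)"
  have D0: "D \<ge> 0" using R by (simp add: D_def integral_nonneg_AE)
  let ?v = "\<lambda>k. inverse (1 + w k)"
  \<comment> \<open>For n >= 1 the power of 1/(1 + w) is 1 plus a transform, and after
    multiplication by the power of \<open>ft q\<close> both parts have densities (\<open>y\<close>
    and \<open>u\<close>). For n = 0 the constant 1 has no integrable density; it is split off and
    becomes the 1 of the conclusion.\<close>
  have "\<exists>h. integrable lborel h \<and> (\<forall>k. ft h k = (- ft q k) ^ n * ?v k ^ Suc n - (if n = 0 then 1 else 0)) \<and>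
      (LINT p|lborel. norm (h p)) \<le> D * (real n + 2)\<^sup>2 * M * (1/2) ^ n + (1/2) ^ n" for n
  proof -
    obtain h where h: "integrable lborel h" "\<And>k. ft h k = ?v k ^ Suc n - 1"
      "(LINT p|lborel. norm (h p)) \<le> D * (real (Suc n) + 1)\<^sup>2 * M ^ Suc n"
      using ft_inverse_power[OF d iR R b' M1 M2, of "Suc n"] unfolding D_def by blast
    show ?thesis
    proof (cases n)
      case 0
      then show ?thesis using h by (intro exI[of _ h]) auto
    next
      case (Suc n')
      have iq: "integrable lborel (\<lambda>p. - 1 * q p)" using q(1) by simp
      obtain u where u: "integrable lborel u" "\<And>k. ft u k = (- ft q k) ^ n" "(LINT p|lborel. norm (u p)) \<le> Q ^ n"
        using ft_power[OF iq, of n'] unfolding ft_cmult Suc Q_def by auto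
      obtain y where y: "integrable lborel y" "\<And>k. ft y k = ft u k * ft h k"
        "(LINT p|lborel. norm (y p)) \<le> (LINT p|lborel. norm (u p)) * (LINT p|lborel. norm (h p))"
        using ft_convolution[OF u(1) h(1)] by blast
      have Qn: "Q ^ n * M ^ Suc n \<le> M * (1/2) ^ n"
      proof -
        have "Q ^ n * M ^ Suc n = M * (Q * M) ^ n" by (simp add: power_mult_distrib)
        also have "\<dots> \<le> M * (1/2) ^ n" using QM Q0 M1 by (intro mult_left_mono power_mono) auto
        finally show ?thesis .
      qed
      have Qn': "Q ^ n \<le> (1/2) ^ n"
      proof (rule power_mono)
        have "Q * 1 \<le> Q * M" using Q0 M1 by (intro mult_left_mono)
        then show "Q \<le> 1/2" using QM by simp
      qed (rule Q0)
      have "(LINT p|lborel. norm (y p + u p)) \<le> (LINT p|lborel. norm (y p) + norm (u p))"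
        using y u by (intro integral_mono) (auto intro: norm_triangle_ineq)
      also have "\<dots> = (LINT p|lborel. norm (y p)) + (LINT p|lborel. norm (u p))" using y u by simp
      also have "\<dots> \<le> Q ^ n * (D * (real (Suc n) + 1)\<^sup>2 * M ^ Suc n) + Q ^ n"
        using y(3) u(3) h(3) Q0 by (intro add_mono order_trans[OF y(3)] mult_mono) (auto simp: integral_nonneg_AE)
      also have "\<dots> = D * (real n + 2)\<^sup>2 * (Q ^ n * M ^ Suc n) + Q ^ n" by (simp add: mult_ac add.commute)
      also have "\<dots> \<le> D * (real n + 2)\<^sup>2 * (M * (1/2) ^ n) + (1/2) ^ n"
        using D0 Qn Qn' by (intro add_mono mult_left_mono) auto
      finally have "(LINT p|lborel. norm (y p + u p)) \<le> D * (real n + 2)\<^sup>2 * M * (1/2) ^ n + (1/2) ^ n" by (simp add: mult_ac)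
      moreover have "ft (\<lambda>p. y p + u p) k = (- ft q k) ^ n * ?v k ^ Suc n - (if n = 0 then 1 else 0)" for k
        using y(1) u(1) Suc by (simp only: ft_add y(2) h(2) u(2)) (simp add: algebra_simps)
      ultimately show ?thesis using y(1) u(1) by (intro exI[of _ "\<lambda>p. y p + u p"]) auto
    qed
  qed
  then obtain h where h: "\<And>n. integrable lborel (h n)"
    "\<And>n k. ft (h n) k = (- ft q k) ^ n * ?v k ^ Suc n - (if n = 0 then 1 else 0)"
    "\<And>n. (LINT p|lborel. norm (h n p)) \<le> D * (real n + 2)\<^sup>2 * M * (1/2) ^ n + (1/2) ^ n" by metis
  have "summable (\<lambda>n. D * (real n + 2)\<^sup>2 * M * (1/2) ^ n + (1/2) ^ n)"
  proof (rule summable_comparison_test_bigo[where g="\<lambda>n. (3/4::real) ^ n"])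
    show "(\<lambda>n. D * (real n + 2)\<^sup>2 * M * (1/2) ^ n + (1/2) ^ n) \<in> O(\<lambda>n. (3/4::real) ^ n)" by real_asymp
  qed auto
  then have sum: "summable (\<lambda>n. LINT p|lborel. norm (h n p))"
    by (rule summable_comparison_test_ev[rotated]) (use h(3) in \<open>auto simp: integral_nonneg_AE\<close>)
  obtain u where u: "integrable lborel u" "\<And>k. (\<lambda>n. ft (h n) k) sums ft u k"
    using ft_suminf[OF h(1) sum] by blast
  show ?thesis
  proof
    show "integrable lborel u" by fact
    fix k
    have nv: "norm (?v k) \<le> M"
    proof -
      have "0 < norm (1 + w k)" using M2[of k] by auto
      then show ?thesis using M2[of k] by (simp add: inverse_eq_divide norm_divide pos_divide_le_eq)
    qed
    have wz: "1 + w k \<noteq> 0" using M2[of k] by auto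
    have "norm (- ft q k * ?v k) \<le> Q * M" using bq[of k] nv Q0 by (simp add: norm_mult mult_mono del: norm_inverse)
    then have "norm (- ft q k * ?v k) < 1" using QM by simp
    moreover have "?v k * (- ft q k * ?v k) ^ n = (- ft q k) ^ n * ?v k ^ Suc n" for n
      by (simp only: power_mult_distrib power_Suc mult_ac)
    ultimately have "(\<lambda>n. (- ft q k) ^ n * ?v k ^ Suc n) sums (?v k * (1 / (1 - (- ft q k * ?v k))))"
      using sums_mult[OF geometric_sums, of "- ft q k * ?v k" "?v k"] by (simp only:)
    also have "?v k * (1 / (1 - (- ft q k * ?v k))) = inverse (1 + ft g k)"
      using wz nz[of k] unfolding q(3) by (simp add: field_simps)
    finally have "(\<lambda>n. (- ft q k) ^ n * ?v k ^ Suc n - (if n = 0 then 1 else 0)) sums (inverse (1 + ft g k) - 1)"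
      by (intro sums_diff sums_single[of 0 "\<lambda>_. 1", simplified])
    then show "inverse (1 + ft g k) = 1 + ft u k"
      using sums_unique2[OF u(2)[of k]] unfolding h(2) by (metis add.commute diff_add_cancel)
  qed
qed

section \<open>Functions with derivatives in the Wiener algebra\<close>

text \<open>\<open>wiener_smooth j c f\<close>: the function \<open>f - c\<close> and its first \<open>j\<close> derivatives lie in the Wiener algebra, so that
  \<open>c\<close> is the value of \<open>f\<close> at infinity.\<close>
fun wiener_smooth :: "nat \<Rightarrow> complex \<Rightarrow> (real \<Rightarrow> complex) \<Rightarrow> bool" where
  "wiener_smooth 0 c f \<longleftrightarrow> (\<exists>h. integrable lborel h \<and> (\<forall>k. f k = c + ft h k))"
| "wiener_smooth (Suc j) c f \<longleftrightarrow> (\<exists>h. integrable lborel h \<and> (\<forall>k. f k = c + ft h k)) \<and>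
     (\<exists>f'. (\<forall>k. (f has_vector_derivative f' k) (at k)) \<and> wiener_smooth j 0 f')"

lemma wiener_smooth_base: "wiener_smooth j c f \<Longrightarrow> wiener_smooth 0 c f"
  by (cases j) auto

lemma wiener_smooth_SucI:
  "\<lbrakk>wiener_smooth 0 c f; \<And>k. (f has_vector_derivative f' k) (at k); wiener_smooth j 0 f'\<rbrakk>
    \<Longrightarrow> wiener_smooth (Suc j) c f"
  by auto

lemma wiener_smooth_SucE:
  assumes "wiener_smooth (Suc j) c f"
  obtains f' where "\<And>k. (f has_vector_derivative f' k) (at k)" "wiener_smooth j 0 f'"
  using assms by auto

lemma wiener_smooth_Suc_imp: "wiener_smooth (Suc j) c f \<Longrightarrow> wiener_smooth j c f"
proof (induction j arbitrary: c f)
  case (Suc j)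
  obtain f' where f': "\<And>k. (f has_vector_derivative f' k) (at k)" "wiener_smooth (Suc j) 0 f'"
    using Suc.prems by (rule wiener_smooth_SucE) blast
  show ?case
    by (rule wiener_smooth_SucI[OF wiener_smooth_base[OF Suc.prems] f'(1) Suc.IH[OF f'(2)]])
qed auto

lemma wiener_smooth_ft: "integrable lborel h \<Longrightarrow> wiener_smooth 0 0 (ft h)"
  by auto

lemma wiener_smooth_add:
  "wiener_smooth j c f \<Longrightarrow> wiener_smooth j d g \<Longrightarrow> wiener_smooth j (c + d) (\<lambda>k. f k + g k)"
proof (induction j arbitrary: c d f g)
  case 0
  then obtain h1 h2 where "integrable lborel h1" "\<And>k. f k = c + ft h1 k" "integrable lborel h2" "\<And>k. g k = d + ft h2 k"
    by auto
  then show ?case by (auto intro!: exI[of _ "\<lambda>p. h1 p + h2 p"] simp: ft_add)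
next
  case (Suc j)
  obtain f' where f': "\<And>k. (f has_vector_derivative f' k) (at k)" "wiener_smooth j 0 f'"
    using Suc.prems(1) by (rule wiener_smooth_SucE) blast
  obtain g' where g': "\<And>k. (g has_vector_derivative g' k) (at k)" "wiener_smooth j 0 g'"
    using Suc.prems(2) by (rule wiener_smooth_SucE) blast
  show ?case
  proof (rule wiener_smooth_SucI)
    show "wiener_smooth 0 (c + d) (\<lambda>k. f k + g k)"
    proof -
      obtain h1 h2 where "integrable lborel h1" "\<And>k. f k = c + ft h1 k" "integrable lborel h2" "\<And>k. g k = d + ft h2 k"
        using Suc.prems by auto
      then show ?thesis by (auto intro!: exI[of _ "\<lambda>p. h1 p + h2 p"] simp: ft_add)
    qed
    show "((\<lambda>k. f k + g k) has_vector_derivative f' k + g' k) (at k)" for k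
      by (intro has_vector_derivative_add f' g')
    show "wiener_smooth j 0 (\<lambda>k. f' k + g' k)" using Suc.IH[OF f'(2) g'(2)] by simp
  qed
qed

lemma wiener_smooth_cmult: "wiener_smooth j c f \<Longrightarrow> wiener_smooth j (a * c) (\<lambda>k. a * f k)"
proof -
  have base: "wiener_smooth 0 (a * c) (\<lambda>k. a * f k)" if "wiener_smooth 0 c f" for c f
  proof -
    obtain h where "integrable lborel h" "\<And>k. f k = c + ft h k" using \<open>wiener_smooth 0 c f\<close> by auto
    then show ?thesis by (auto intro!: exI[of _ "\<lambda>p. a * h p"] simp: ft_cmult distrib_left)
  qed
  show "wiener_smooth j c f \<Longrightarrow> wiener_smooth j (a * c) (\<lambda>k. a * f k)"
  proof (induction j arbitrary: c f)
    case (Suc j)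
    obtain f' where f': "\<And>k. (f has_vector_derivative f' k) (at k)" "wiener_smooth j 0 f'"
      using Suc.prems by (rule wiener_smooth_SucE) blast
    show ?case
    proof (rule wiener_smooth_SucI[OF base[OF wiener_smooth_base[OF Suc.prems]]])
      show "((\<lambda>k. a * f k) has_vector_derivative a * f' k) (at k)" for k
        by (intro has_vector_derivative_mult_right f')
      show "wiener_smooth j 0 (\<lambda>k. a * f' k)" using Suc.IH[OF f'(2)] by simp
    qed
  qed (rule base)
qed

lemma wiener_smooth_zero: "wiener_smooth j 0 (\<lambda>k. 0)"
proof (induction j)
  case 0
  then show ?case by (auto simp: ft_def intro!: exI[of _ "\<lambda>_. 0"])
next
  case (Suc j)
  show ?case
    by (rule wiener_smooth_SucI[OF wiener_smooth_base[OF Suc] has_vector_derivative_const Suc])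
qed

lemma wiener_smooth_const: "wiener_smooth j c (\<lambda>k. c)"
proof (cases j)
  case 0
  then show ?thesis by (auto simp: ft_def intro!: exI[of _ "\<lambda>_. 0"])
next
  case (Suc j')
  have "wiener_smooth 0 c (\<lambda>k. c)" by (auto simp: ft_def intro!: exI[of _ "\<lambda>_. 0"])
  then show ?thesis unfolding Suc
    by (rule wiener_smooth_SucI[OF _ has_vector_derivative_const wiener_smooth_zero])
qed

lemma wiener_smooth_mult:
  "wiener_smooth j c f \<Longrightarrow> wiener_smooth j d g \<Longrightarrow> wiener_smooth j (c * d) (\<lambda>k. f k * g k)"
proof -
  have base: "wiener_smooth 0 (c * d) (\<lambda>k. f k * g k)" if fg: "wiener_smooth 0 c f" "wiener_smooth 0 d g" for c d f g
  proof -
    obtain h1 h2 where h: "integrable lborel h1" "\<And>k. f k = c + ft h1 k" "integrable lborel h2" "\<And>k. g k = d + ft h2 k"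
      using fg by auto
    obtain u where u: "integrable lborel u" "\<And>k. ft u k = ft h1 k * ft h2 k"
      using ft_convolution[OF h(1,3)] by blast
    have "f k * g k = c * d + ft (\<lambda>p. (c * h2 p + d * h1 p) + u p) k" for k
      using h u by (simp add: ft_add ft_cmult algebra_simps)
    then show ?thesis using h u by (auto intro!: exI[of _ "\<lambda>p. (c * h2 p + d * h1 p) + u p"])
  qed
  show "wiener_smooth j c f \<Longrightarrow> wiener_smooth j d g \<Longrightarrow> wiener_smooth j (c * d) (\<lambda>k. f k * g k)"
  proof (induction j arbitrary: c d f g)
    case (Suc j)
    obtain f' where f': "\<And>k. (f has_vector_derivative f' k) (at k)" "wiener_smooth j 0 f'"
      using Suc.prems(1) by (rule wiener_smooth_SucE) blast
    obtain g' where g': "\<And>k. (g has_vector_derivative g' k) (at k)" "wiener_smooth j 0 g'"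
      using Suc.prems(2) by (rule wiener_smooth_SucE) blast
    show ?case
    proof (rule wiener_smooth_SucI[OF base[OF Suc.prems[THEN wiener_smooth_base]]])
      show "((\<lambda>k. f k * g k) has_vector_derivative f k * g' k + f' k * g k) (at k)" for k
        by (intro has_vector_derivative_mult f' g')
      show "wiener_smooth j 0 (\<lambda>k. f k * g' k + f' k * g k)"
        using wiener_smooth_add[OF Suc.IH[OF wiener_smooth_Suc_imp[OF Suc.prems(1)] g'(2)]
            Suc.IH[OF f'(2) wiener_smooth_Suc_imp[OF Suc.prems(2)]]] by simp
    qed
  qed (rule base)
qed

lemma wiener_smooth_reflect: "wiener_smooth j c f \<Longrightarrow> wiener_smooth j c (\<lambda>k. f (- k))"
proof (induction j arbitrary: c f)
  case 0
  then obtain h where "integrable lborel h" "\<And>k. f k = c + ft h k" by auto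
  then show ?case using integrable_uminus_lborel[of h]
    by (auto simp: ft_reflect[symmetric] intro!: exI[of _ "\<lambda>p. h (- p)"])
next
  case (Suc j)
  obtain f' where f': "\<And>k. (f has_vector_derivative f' k) (at k)" "wiener_smooth j 0 f'"
    using Suc.prems by (rule wiener_smooth_SucE) blast
  obtain h where h: "integrable lborel h" "\<And>k. f k = c + ft h k" using Suc.prems by auto
  show ?case
  proof (rule wiener_smooth_SucI)
    show "wiener_smooth 0 c (\<lambda>k. f (- k))" using h integrable_uminus_lborel[of h]
      by (auto simp: ft_reflect[symmetric] intro!: exI[of _ "\<lambda>p. h (- p)"])
    show "((\<lambda>k. f (- k)) has_vector_derivative - 1 * f' (- k)) (at k)" for k
      using has_vector_derivative_reflect[OF f'(1)] by simp
    show "wiener_smooth j 0 (\<lambda>k. - 1 * f' (- k))"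
      using wiener_smooth_cmult[OF Suc.IH[OF f'(2)], of "- 1"] by simp
  qed
qed

text \<open>Dividing by the value \<open>c\<close> at infinity reduces the undifferentiated case to
  \<open>wiener_inverse\<close>. Derivatives need no new analysis: the derivative of 1/f is -f'/f^2,
  and the induction hypothesis already covers 1/f one level lower.\<close>

lemma wiener_smooth_inverse:
  assumes c: "c \<noteq> 0" and nz: "\<And>k. f k \<noteq> 0" and f: "wiener_smooth j c f"
  shows "wiener_smooth j (inverse c) (\<lambda>k. inverse (f k))"
proof -
  have base: "wiener_smooth 0 (inverse c) (\<lambda>k. inverse (f k))"
  proof -
    obtain h where h: "integrable lborel h" "\<And>k. f k = c + ft h k" using wiener_smooth_base[OF f] by auto
    have fk: "f k = c * (1 + ft (\<lambda>p. inverse c * h p) k)" for k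
      using c unfolding h(2) ft_cmult by (simp add: field_simps)
    have "integrable lborel (\<lambda>p. inverse c * h p)" using h by auto
    moreover have "1 + ft (\<lambda>p. inverse c * h p) k \<noteq> 0" for k using nz[of k] unfolding fk by auto
    ultimately obtain u where u: "integrable lborel u" "\<And>k. inverse (1 + ft (\<lambda>p. inverse c * h p) k) = 1 + ft u k"
      by (rule wiener_inverse) blast
    have "inverse (f k) = inverse c + ft (\<lambda>p. inverse c * u p) k" for k
      unfolding fk inverse_mult_distrib u(2) by (simp add: ft_cmult distrib_left)
    then show ?thesis using u by (auto intro!: exI[of _ "\<lambda>p. inverse c * u p"])
  qed
  show ?thesis using f
  proof (induction j)
    case (Suc j)
    obtain f' where f': "\<And>k. (f has_vector_derivative f' k) (at k)" "wiener_smooth j 0 f'"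
      using Suc.prems by (rule wiener_smooth_SucE) blast
    have IH: "wiener_smooth j (inverse c) (\<lambda>k. inverse (f k))"
      by (rule Suc.IH[OF wiener_smooth_Suc_imp[OF Suc.prems]])
    show ?case
    proof (rule wiener_smooth_SucI[OF base])
      show "((\<lambda>k. inverse (f k)) has_vector_derivative (- 1 * f' k) * (inverse (f k) * inverse (f k))) (at k)" for k
        using field_vector_diff_chain_at[OF f'(1)[of k] DERIV_inverse[OF nz]] by (simp add: o_def)
      show "wiener_smooth j 0 (\<lambda>k. (- 1 * f' k) * (inverse (f k) * inverse (f k)))"
        using wiener_smooth_mult[OF wiener_smooth_cmult[OF f'(2), of "- 1"] wiener_smooth_mult[OF IH IH]] by simp
    qed
  qed (rule base)
qed

text \<open>Moments of the density become derivatives of the transform: each differentiation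
  multiplies the density by ip and uses up one power of the weight.\<close>

lemma wiener_smooth_weighted_ft:
  assumes "h \<in> borel_measurable lborel" "integrable lborel (\<lambda>p. (1 + \<bar>p\<bar>) ^ j * norm (h p))"
  shows "wiener_smooth j 0 (ft h)"
  using assms
proof (induction j arbitrary: h)
  case 0
  then show ?case by (auto simp: integrable_norm_iff intro!: exI[of _ h])
next
  case (Suc j)
  have [measurable]: "h \<in> borel_measurable borel" using Suc.prems by simp
  have w: "1 \<le> (1 + \<bar>p\<bar>) ^ j" for p :: real by simp
  have le: "norm (h p) \<le> (1 + \<bar>p\<bar>) ^ Suc j * norm (h p)" for p
    using mult_right_mono[of 1 "(1 + \<bar>p\<bar>) ^ Suc j" "norm (h p)"] by (simp add: one_le_power del: power_Suc)
  have le2: "(1 + \<bar>p\<bar>) ^ j * (\<bar>p\<bar> * norm (h p)) \<le> (1 + \<bar>p\<bar>) ^ Suc j * norm (h p)" for p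
  proof -
    have "(1 + \<bar>p\<bar>) ^ j * (\<bar>p\<bar> * norm (h p)) \<le> (1 + \<bar>p\<bar>) ^ j * ((1 + \<bar>p\<bar>) * norm (h p))"
      by (intro mult_left_mono mult_right_mono) auto
    then show ?thesis by (simp add: mult_ac)
  qed
  have h: "integrable lborel h"
    by (rule Bochner_Integration.integrable_bound[OF Suc.prems(2)]) (auto intro!: AE_I2 order_trans[OF le] abs_ge_self simp del: power_Suc)
  have ph: "integrable lborel (\<lambda>p. of_real p * h p)"
  proof (rule Bochner_Integration.integrable_bound[OF Suc.prems(2)])
    show "AE p in lborel. norm (of_real p * h p) \<le> norm ((1 + \<bar>p\<bar>) ^ Suc j * norm (h p))"
    proof (rule AE_I2)
      fix p :: real
      have "1 * (\<bar>p\<bar> * norm (h p)) \<le> (1 + \<bar>p\<bar>) ^ j * (\<bar>p\<bar> * norm (h p))"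
        by (rule mult_right_mono[OF w]) simp
      then have "norm (of_real p * h p) \<le> (1 + \<bar>p\<bar>) ^ Suc j * norm (h p)"
        using le2[of p] by (simp only: norm_mult norm_of_real mult_1)
      then show "norm (of_real p * h p) \<le> norm ((1 + \<bar>p\<bar>) ^ Suc j * norm (h p))"
        by (rule order_trans) (simp only: real_norm_def abs_ge_self)
    qed
  qed auto
  show ?case
  proof (rule wiener_smooth_SucI[OF wiener_smooth_ft[OF h] ft_has_vector_derivative[OF h ph]])
    show "wiener_smooth j 0 (ft (\<lambda>p. \<i> * (of_real p * h p)))"
    proof (rule Suc.IH)
      show "integrable lborel (\<lambda>p. (1 + \<bar>p\<bar>) ^ j * norm (\<i> * (of_real p * h p)))"
        by (rule Bochner_Integration.integrable_bound[OF Suc.prems(2)])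
          (auto simp: norm_mult abs_mult power_abs simp del: power_Suc intro!: AE_I2 order_trans[OF le2])
    qed auto
  qed
qed

text \<open>The derivative is i times the square of the function, so closure under products gives
  all orders at once.\<close>

lemma wiener_smooth_resolvent: "wiener_smooth j 0 (\<lambda>k. 1 / (1 - \<i> * of_real k))"
proof (induction j)
  case 0
  then show ?case using integrable_exp_decay by (auto simp: ft_exp_decay intro!: exI[of _ exp_decay])
next
  case (Suc j)
  show ?case
  proof (rule wiener_smooth_SucI[OF wiener_smooth_base[OF Suc]])
    show "((\<lambda>k. 1 / (1 - \<i> * of_real k)) has_vector_derivative \<i> * (1 / (1 - \<i> * of_real k) * (1 / (1 - \<i> * of_real k)))) (at k)" for k
    proof (rule has_vector_derivative_real_field)
      have "1 - \<i> * of_real k \<noteq> 0" by (auto simp: complex_eq_iff)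
      then show "((\<lambda>z. 1 / (1 - \<i> * z)) has_field_derivative \<i> * (1 / (1 - \<i> * of_real k) * (1 / (1 - \<i> * of_real k)))) (at (of_real k))"
        by (auto intro!: derivative_eq_intros simp: power2_eq_square)
    qed
    show "wiener_smooth j 0 (\<lambda>k. \<i> * (1 / (1 - \<i> * of_real k) * (1 / (1 - \<i> * of_real k))))"
      using wiener_smooth_cmult[OF wiener_smooth_mult[OF Suc Suc], of \<i>] by simp
  qed
qed

lemma wiener_smooth_continuous:
  assumes "wiener_smooth j c f"
  shows "continuous_on UNIV f"
proof -
  obtain h where h: "integrable lborel h" "\<And>k. f k = c + ft h k" using wiener_smooth_base[OF assms] by auto
  then show ?thesis unfolding h(2)[abs_def] by (intro continuous_intros continuous_ft)
qed

lemma wiener_smooth_nth_deriv: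
  assumes f: "wiener_smooth j 0 f"
  shows "differentiable_upto j f" "\<And>l. l \<le> j \<Longrightarrow> nth_deriv l f \<in> wiener_algebra"
proof -
  have step: "wiener_smooth (j - l) 0 (nth_deriv l f)" if "l \<le> j" for l
    using that
  proof (induction l)
    case (Suc l)
    then have "wiener_smooth (Suc (j - Suc l)) 0 (nth_deriv l f)" by (simp add: Suc_diff_Suc)
    then obtain f' where f': "\<And>k. (nth_deriv l f has_vector_derivative f' k) (at k)" "wiener_smooth (j - Suc l) 0 f'"
      by (rule wiener_smooth_SucE) blast
    have "nth_deriv (Suc l) f = f'" using vector_derivative_at[OF f'(1)] by (simp add: fun_eq_iff)
    then show ?case using f'(2) by simp
  qed (use f in simp)
  show "nth_deriv l f \<in> wiener_algebra" if "l \<le> j" for l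
  proof -
    obtain h where "integrable lborel h" "\<And>k. nth_deriv l f k = 0 + ft h k"
      using wiener_smooth_base[OF step[OF \<open>l \<le> j\<close>]] by auto
    then show ?thesis unfolding wiener_algebra_iff by (intro exI[of _ h]) (simp add: fun_eq_iff)
  qed
  show "differentiable_upto j f"
    unfolding differentiable_upto_def
  proof (intro allI impI)
    fix m k assume "m < j"
    then have "wiener_smooth (Suc (j - Suc m)) 0 (nth_deriv m f)" using step[of m] by (simp add: Suc_diff_Suc)
    then obtain f' where "\<And>k. (nth_deriv m f has_vector_derivative f' k) (at k)"
      by (rule wiener_smooth_SucE) blast
    then show "nth_deriv m f differentiable at k" by (rule differentiableI_vector)
  qed
qed

section \<open>Volterra inequalities\<close>

lemma nn_integral_tail_measurable [measurable]:
  fixes w :: "real \<Rightarrow> ennreal"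
  assumes [measurable]: "w \<in> borel_measurable borel"
  shows "(\<lambda>x. \<integral>\<^sup>+y. indicator {x<..} y * w y \<partial>lborel) \<in> borel_measurable borel"
proof -
  have "(\<lambda>(x, y). indicator {x<..} y * w y) = (\<lambda>p. (if fst p < snd p then 1 else 0) * w (snd p))"
    by (auto simp: indicator_def)
  moreover have "(\<lambda>p. (if fst p < snd p then 1 else 0) * w (snd p)) \<in> borel_measurable (borel \<Otimes>\<^sub>M lborel)" by measurable
  ultimately show ?thesis by (intro lborel.borel_measurable_nn_integral) simp
qed

text \<open>Formally this integrates -(\<open>\<gamma>\<close>^(n+1))' = (n + 1) w
  \<open>\<gamma>\<close>^n and is the source of all factorials below. Splitting
  \<open>\<gamma> x\<close> at z and exchanging the integrals replaces differentiation, and in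
  \<open>ennreal\<close> infinite values need no separate treatment.\<close>

lemma nn_integral_volterra_power:
  fixes w :: "real \<Rightarrow> ennreal"
  assumes [measurable]: "w \<in> borel_measurable borel"
  defines "\<gamma> \<equiv> \<lambda>x. \<integral>\<^sup>+y. indicator {x<..} y * w y \<partial>lborel"
  shows "of_nat (Suc n) * (\<integral>\<^sup>+y. indicator {x<..} y * w y * \<gamma> y ^ n \<partial>lborel) = \<gamma> x ^ Suc n"
proof (induction n arbitrary: x)
  case 0
  then show ?case by (simp add: \<gamma>_def)
next
  case (Suc n)
  have [measurable]: "\<gamma> \<in> borel_measurable borel" unfolding \<gamma>_def by measurable
  let ?J = "\<integral>\<^sup>+z. indicator {x<..} z * w z * \<gamma> z ^ n \<partial>lborel"
  let ?I = "\<integral>\<^sup>+y. indicator {x<..} y * w y * \<gamma> y ^ Suc n \<partial>lborel"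
  let ?h = "\<lambda>y z. (if x < y \<and> y < z then 1 else 0) * (w y * (w z * \<gamma> z ^ n))"
  have "?I = (\<integral>\<^sup>+y. of_nat (Suc n) * (\<integral>\<^sup>+z. ?h y z \<partial>lborel) \<partial>lborel)"
  proof (rule nn_integral_cong)
    fix y
    have "indicator {x<..} y * w y * \<gamma> y ^ Suc n = of_nat (Suc n) * ((indicator {x<..} y * w y) * (\<integral>\<^sup>+z. indicator {y<..} z * w z * \<gamma> z ^ n \<partial>lborel))"
      unfolding Suc.IH[of y, symmetric] by (simp only: mult_ac)
    also have "(indicator {x<..} y * w y) * (\<integral>\<^sup>+z. indicator {y<..} z * w z * \<gamma> z ^ n \<partial>lborel) = (\<integral>\<^sup>+z. ?h y z \<partial>lborel)"
      by (subst nn_integral_cmult[symmetric]) (auto intro!: nn_integral_cong simp: indicator_def)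
    finally show "indicator {x<..} y * w y * \<gamma> y ^ Suc n = of_nat (Suc n) * (\<integral>\<^sup>+z. ?h y z \<partial>lborel)" .
  qed
  also have "\<dots> = of_nat (Suc n) * (\<integral>\<^sup>+y. (\<integral>\<^sup>+z. ?h y z \<partial>lborel) \<partial>lborel)"
    by (rule nn_integral_cmult) measurable
  also have "(\<integral>\<^sup>+y. (\<integral>\<^sup>+z. ?h y z \<partial>lborel) \<partial>lborel) = (\<integral>\<^sup>+z. (\<integral>\<^sup>+y. ?h y z \<partial>lborel) \<partial>lborel)"
    by (rule lborel_pair.Fubini') measurable
  finally have I: "?I = of_nat (Suc n) * (\<integral>\<^sup>+z. (\<integral>\<^sup>+y. ?h y z \<partial>lborel) \<partial>lborel)" .
  have inner: "(\<integral>\<^sup>+y. ?h y z \<partial>lborel) + indicator {x<..} z * w z * \<gamma> z ^ Suc n = \<gamma> x * (indicator {x<..} z * w z * \<gamma> z ^ n)" for z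
  proof (cases "x < z")
    case True
    have "\<gamma> x = (\<integral>\<^sup>+y. (if x < y \<and> y < z then 1 else 0) * w y + indicator {z<..} y * w y \<partial>lborel)"
      unfolding \<gamma>_def
      by (rule nn_integral_cong_AE, rule eventually_mono[OF AE_lborel_singleton[of z]]) (use True in \<open>auto simp: indicator_def\<close>)
    also have "\<dots> = (\<integral>\<^sup>+y. (if x < y \<and> y < z then 1 else 0) * w y \<partial>lborel) + \<gamma> z"
      unfolding \<gamma>_def by (rule nn_integral_add) measurable
    finally have \<gamma>x: "\<gamma> x = (\<integral>\<^sup>+y. (if x < y \<and> y < z then 1 else 0) * w y \<partial>lborel) + \<gamma> z" .
    have "(\<integral>\<^sup>+y. ?h y z \<partial>lborel) = (\<integral>\<^sup>+y. (if x < y \<and> y < z then 1 else 0) * w y \<partial>lborel) * (w z * \<gamma> z ^ n)"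
      by (subst nn_integral_multc[symmetric]) (auto intro!: nn_integral_cong simp: mult.assoc)
    then show ?thesis unfolding \<gamma>x using True by (simp add: distrib_left mult_ac)
  next
    case False
    then have "(\<integral>\<^sup>+y. ?h y z \<partial>lborel) = (\<integral>\<^sup>+y. 0 \<partial>(lborel :: real measure))"
      by (intro nn_integral_cong) auto
    then show ?thesis using False by simp
  qed
  have "(\<integral>\<^sup>+z. (\<integral>\<^sup>+y. ?h y z \<partial>lborel) \<partial>lborel) + ?I = (\<integral>\<^sup>+z. (\<integral>\<^sup>+y. ?h y z \<partial>lborel) + indicator {x<..} z * w z * \<gamma> z ^ Suc n \<partial>lborel)"
    by (rule nn_integral_add[symmetric]) measurable
  also have "\<dots> = \<gamma> x * ?J" unfolding inner by (rule nn_integral_cmult) measurable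
  finally have "of_nat (Suc n) * (\<integral>\<^sup>+z. (\<integral>\<^sup>+y. ?h y z \<partial>lborel) \<partial>lborel) + of_nat (Suc n) * ?I = of_nat (Suc n) * (\<gamma> x * ?J)"
    by (simp only: distrib_left[symmetric])
  then have "?I + of_nat (Suc n) * ?I = \<gamma> x * (of_nat (Suc n) * ?J)"
    unfolding I[symmetric] by (simp only: mult.left_commute)
  also have "\<dots> = \<gamma> x ^ Suc (Suc n)" unfolding Suc.IH by simp
  finally show ?case by (simp add: distrib_right)
qed

text \<open>Inserting the inequality into itself n times gives C \<open>\<gamma>\<close>^n / n!,
  with the factorial kept on the left to avoid division in \<open>ennreal\<close>.\<close>

lemma volterra_iterate_bound:
  fixes w U :: "real \<Rightarrow> ennreal"
  assumes [measurable]: "w \<in> borel_measurable borel" "U \<in> borel_measurable borel" and C: "\<And>x. a \<le> x \<Longrightarrow> U x \<le> C"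
    and U: "\<And>x. a \<le> x \<Longrightarrow> U x \<le> (\<integral>\<^sup>+y. indicator {x<..} y * w y * U y \<partial>lborel)" and x: "a \<le> x"
  shows "of_nat (fact n) * U x \<le> C * (\<integral>\<^sup>+y. indicator {x<..} y * w y \<partial>lborel) ^ n"
  using x
proof (induction n arbitrary: x)
  case 0
  then show ?case using C by simp
next
  case (Suc n)
  define \<gamma> where "\<gamma> x = (\<integral>\<^sup>+y. indicator {x<..} y * w y \<partial>lborel)" for x
  have [measurable]: "\<gamma> \<in> borel_measurable borel" unfolding \<gamma>_def[abs_def] by measurable
  have "of_nat (fact n) * U x \<le> of_nat (fact n) * (\<integral>\<^sup>+y. indicator {x<..} y * w y * U y \<partial>lborel)"
    by (intro mult_left_mono U Suc.prems) simp
  also have "\<dots> = (\<integral>\<^sup>+y. of_nat (fact n) * (indicator {x<..} y * w y * U y) \<partial>lborel)"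
    by (rule nn_integral_cmult[symmetric]) measurable
  also have "\<dots> \<le> (\<integral>\<^sup>+y. C * (indicator {x<..} y * w y * \<gamma> y ^ n) \<partial>lborel)"
  proof (rule nn_integral_mono)
    fix y
    show "of_nat (fact n) * (indicator {x<..} y * w y * U y) \<le> C * (indicator {x<..} y * w y * \<gamma> y ^ n)"
    proof (cases "x < y")
      case True
      then have "w y * (of_nat (fact n) * U y) \<le> w y * (C * \<gamma> y ^ n)"
        unfolding \<gamma>_def using Suc.prems by (intro mult_left_mono Suc.IH) auto
      then show ?thesis using True by (simp add: mult_ac)
    qed simp
  qed
  also have "\<dots> = C * (\<integral>\<^sup>+y. indicator {x<..} y * w y * \<gamma> y ^ n \<partial>lborel)" by (rule nn_integral_cmult) measurable
  finally have "of_nat (fact n) * U x \<le> C * (\<integral>\<^sup>+y. indicator {x<..} y * w y * \<gamma> y ^ n \<partial>lborel)" .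
  then have "of_nat (Suc n) * (of_nat (fact n) * U x) \<le> of_nat (Suc n) * (C * (\<integral>\<^sup>+y. indicator {x<..} y * w y * \<gamma> y ^ n \<partial>lborel))"
    by (rule mult_left_mono) simp
  also have "\<dots> = C * \<gamma> x ^ Suc n"
    using nn_integral_volterra_power[of w n x] by (simp only: \<gamma>_def[symmetric] mult.left_commute assms(1))
  finally show ?case by (simp only: \<gamma>_def fact_Suc of_nat_mult of_nat_id mult.assoc)
qed

text \<open>The iterated bounds are terms of a convergent exponential series, hence tend to 0.
  Boundedness of \<open>U\<close> is what starts the iteration.\<close>

lemma volterra_unique:
  fixes w U :: "real \<Rightarrow> ennreal"
  assumes w: "w \<in> borel_measurable borel" "U \<in> borel_measurable borel" and C: "\<And>x. a \<le> x \<Longrightarrow> U x \<le> C" "C < \<infinity>"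
    and U: "\<And>x. a \<le> x \<Longrightarrow> U x \<le> (\<integral>\<^sup>+y. indicator {x<..} y * w y * U y \<partial>lborel)" and x: "a \<le> x"
    and fin: "(\<integral>\<^sup>+y. indicator {x<..} y * w y \<partial>lborel) < \<infinity>"
  shows "U x = 0"
proof -
  obtain c where c: "C = ennreal c" "c \<ge> 0" using C(2) by (cases C) auto
  obtain g where g: "(\<integral>\<^sup>+y. indicator {x<..} y * w y \<partial>lborel) = ennreal g" "g \<ge> 0"
    using fin by (cases "\<integral>\<^sup>+y. indicator {x<..} y * w y \<partial>lborel") auto
  obtain u where u: "U x = ennreal u" "u \<ge> 0" using order.strict_trans1[OF C(1)[OF x] C(2)] by (cases "U x") auto
  have "u \<le> c * (inverse (fact n) * g ^ n)" for n
  proof -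
    have "ennreal (fact n * u) \<le> ennreal (c * g ^ n)"
      using volterra_iterate_bound[OF w C(1) U x, of n] c g u
      by (simp add: ennreal_mult ennreal_power ennreal_of_nat_eq_real_of_nat)
    then have "fact n * u \<le> c * g ^ n" using c g by (subst (asm) ennreal_le_iff) auto
    then show ?thesis by (simp add: field_simps)
  qed
  moreover have "(\<lambda>n. c * (inverse (fact n) * g ^ n)) \<longlonglongrightarrow> c * 0"
    by (intro tendsto_intros summable_LIMSEQ_zero[OF summable_exp])
  ultimately have "u \<le> c * 0" by (intro tendsto_lowerbound[OF _ _ sequentially_bot]) (auto intro: always_eventually)
  then show ?thesis using u by simp
qed

section \<open>The Jost solution\<close>

lemma ennreal_norm_integral_le:
  fixes f :: "'a \<Rightarrow> 'b::{banach, second_countable_topology}"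
  shows "ennreal (norm (integral\<^sup>L M f)) \<le> (\<integral>\<^sup>+x. ennreal (norm (f x)) \<partial>M)"
  by (cases "integrable M f") (auto simp: not_integrable_integral_eq intro: integral_norm_bound_ennreal)

text \<open>Iterates of h(x) = 1 + integral over x < z < y of e^(2ik(y-z)) V(y) h(y), read on the
  Fourier side. The pair \<open>p\<close> is (y, z); multiplication by e^(2ik(y-z)) shifts the
  variable \<open>t\<close> by y - z, and the substitution t = y - z in the first iterate gives the
  base case with its cutoff 0 < t.\<close>

fun jost_kernel_term :: "(real \<Rightarrow> real) \<Rightarrow> nat \<Rightarrow> real \<Rightarrow> real \<Rightarrow> real" where
  "jost_kernel_term V 0 x t = (LINT y|lborel. (if 0 < t \<and> x + t < y then V y else 0))"
| "jost_kernel_term V (Suc n) x t = (LINT p|(lborel \<Otimes>\<^sub>M lborel).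
     (if x < snd p \<and> snd p < fst p then V (fst p) * jost_kernel_term V n (fst p) (t - fst p + snd p) else 0))"

lemma jost_kernel_term_measurable [measurable (raw)]:
  assumes V[measurable]: "V \<in> borel_measurable borel"
    and fg: "f \<in> borel_measurable M" "g \<in> borel_measurable M"
  shows "(\<lambda>w. jost_kernel_term V n (f w) (g w)) \<in> borel_measurable M"
proof -
  have "(\<lambda>z. jost_kernel_term V n (fst z) (snd z)) \<in> borel_measurable (borel \<Otimes>\<^sub>M borel)"
  proof (induction n)
    case 0
    show ?case by simp
  next
    case (Suc n)
    have [measurable (raw)]: "(\<lambda>w. jost_kernel_term V n (f w) (g w)) \<in> borel_measurable N"
      if "f \<in> borel_measurable N" "g \<in> borel_measurable N" for f g and N :: "'c measure"
      using measurable_compose[OF measurable_Pair[OF that] Suc] by simp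
    show ?case by simp
  qed
  from measurable_compose[OF measurable_Pair[OF fg] this] show ?thesis by simp
qed

lemma jost_kernel_term_nonpos: "t \<le> 0 \<Longrightarrow> jost_kernel_term V n x t = 0"
proof (induction n arbitrary: x t)
  case (Suc n)
  have "(LINT p|(lborel \<Otimes>\<^sub>M lborel). (if x < snd p \<and> snd p < fst p then V (fst p) * jost_kernel_term V n (fst p) (t - fst p + snd p) else 0))
      = (LINT p|(lborel \<Otimes>\<^sub>M lborel :: (real \<times> real) measure). 0)"
    using Suc by (intro Bochner_Integration.integral_cong) auto
  then show ?case by simp
qed simp

text \<open>The tail in the induction hypothesis starts at y + (t - y + z) = z + t, beyond x + t, so
  it can be pulled out as the tail at x + t. The integral over z contributes the length y - x <= y -
  a, which is where the first moment of \<open>V\<close> enters, and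
  \<open>nn_integral_volterra_power\<close> supplies the factorial. The fixed left end
  \<open>a\<close> keeps the weight the same through the induction.\<close>

lemma jost_kernel_term_bound:
  fixes V :: "real \<Rightarrow> real"
  assumes V[measurable]: "V \<in> borel_measurable borel" and x: "a \<le> x"
  shows "of_nat (fact n) * ennreal \<bar>jost_kernel_term V n x t\<bar> \<le>
    (\<integral>\<^sup>+y. indicator {x + t<..} y * ennreal \<bar>V y\<bar> \<partial>lborel) * (\<integral>\<^sup>+y. indicator {x<..} y * ennreal ((y - a) * \<bar>V y\<bar>) \<partial>lborel) ^ n"
  using x
proof (induction n arbitrary: x t)
  case 0
  have "ennreal \<bar>jost_kernel_term V 0 x t\<bar> \<le> (\<integral>\<^sup>+y. ennreal (norm (if 0 < t \<and> x + t < y then V y else 0)) \<partial>lborel)"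
    using ennreal_norm_integral_le[of lborel "\<lambda>y. if 0 < t \<and> x + t < y then V y else 0"] by simp
  also have "\<dots> \<le> (\<integral>\<^sup>+y. indicator {x + t<..} y * ennreal \<bar>V y\<bar> \<partial>lborel)"
    by (intro nn_integral_mono) auto
  finally show ?case by simp
next
  case (Suc n)
  define e where "e s = (\<integral>\<^sup>+y. indicator {s<..} y * ennreal \<bar>V y\<bar> \<partial>lborel)" for s
  define w where "w y = ennreal ((y - a) * \<bar>V y\<bar>)" for y
  define \<gamma> where "\<gamma> x = (\<integral>\<^sup>+y. indicator {x<..} y * w y \<partial>lborel)" for x
  have [measurable]: "w \<in> borel_measurable borel" unfolding w_def[abs_def] by measurable
  have [measurable]: "\<gamma> \<in> borel_measurable borel" unfolding \<gamma>_def[abs_def] by measurable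
  have e_mono: "e s \<le> e r" if "r \<le> s" for r s
    unfolding e_def using that by (intro nn_integral_mono) (auto split: split_indicator)
  let ?B = "jost_kernel_term V n"
  let ?f = "\<lambda>p. if x < snd p \<and> snd p < fst p then V (fst p) * ?B (fst p) (t - fst p + snd p) else 0"
  have "of_nat (fact n) * ennreal \<bar>jost_kernel_term V (Suc n) x t\<bar> \<le> of_nat (fact n) * (\<integral>\<^sup>+p. ennreal (norm (?f p)) \<partial>(lborel \<Otimes>\<^sub>M lborel))"
    using ennreal_norm_integral_le[of "lborel \<Otimes>\<^sub>M lborel" ?f] by (intro mult_left_mono) auto
  also have "\<dots> = (\<integral>\<^sup>+p. of_nat (fact n) * ennreal (norm (?f p)) \<partial>(lborel \<Otimes>\<^sub>M lborel))"
    by (rule nn_integral_cmult[symmetric]) measurable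
  also have "\<dots> = (\<integral>\<^sup>+y. \<integral>\<^sup>+z. of_nat (fact n) * ennreal (norm (?f (y, z))) \<partial>lborel \<partial>lborel)"
    by (rule lborel.nn_integral_fst[symmetric]) measurable
  also have "\<dots> \<le> (\<integral>\<^sup>+y. \<integral>\<^sup>+z. (e (x + t) * (ennreal \<bar>V y\<bar> * \<gamma> y ^ n)) * indicator {x<..<y} z \<partial>lborel \<partial>lborel)"
  proof (intro nn_integral_mono)
    fix y z :: real
    show "of_nat (fact n) * ennreal (norm (?f (y, z))) \<le> (e (x + t) * (ennreal \<bar>V y\<bar> * \<gamma> y ^ n)) * indicator {x<..<y} z"
    proof (cases "x < z \<and> z < y")
      case True
      have "of_nat (fact n) * ennreal \<bar>?B y (t - y + z)\<bar> \<le> e (y + (t - y + z)) * \<gamma> y ^ n"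
        unfolding e_def \<gamma>_def w_def using True Suc.prems by (intro Suc.IH) auto
      also have "\<dots> \<le> e (x + t) * \<gamma> y ^ n"
        using True by (intro mult_right_mono e_mono) auto
      finally have "ennreal \<bar>V y\<bar> * (of_nat (fact n) * ennreal \<bar>?B y (t - y + z)\<bar>) \<le> ennreal \<bar>V y\<bar> * (e (x + t) * \<gamma> y ^ n)"
        by (rule mult_left_mono) simp
      then show ?thesis using True by (simp add: abs_mult ennreal_mult mult_ac)
    qed auto
  qed
  also have "\<dots> = (\<integral>\<^sup>+y. (e (x + t) * (ennreal \<bar>V y\<bar> * \<gamma> y ^ n)) * emeasure lborel {x<..<y} \<partial>lborel)"
    by (intro nn_integral_cong nn_integral_cmult_indicator) auto
  also have "\<dots> \<le> (\<integral>\<^sup>+y. e (x + t) * (indicator {x<..} y * w y * \<gamma> y ^ n) \<partial>lborel)"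
  proof (rule nn_integral_mono)
    fix y :: real
    show "(e (x + t) * (ennreal \<bar>V y\<bar> * \<gamma> y ^ n)) * emeasure lborel {x<..<y} \<le> e (x + t) * (indicator {x<..} y * w y * \<gamma> y ^ n)"
    proof (cases "x < y")
      case True
      have "ennreal \<bar>V y\<bar> * emeasure lborel {x<..<y} \<le> w y"
        unfolding w_def using True Suc.prems
        by (simp add: ennreal_mult[symmetric]) (simp add: mult.commute mult_left_mono)
      then have "(e (x + t) * \<gamma> y ^ n) * (ennreal \<bar>V y\<bar> * emeasure lborel {x<..<y}) \<le> (e (x + t) * \<gamma> y ^ n) * w y"
        by (rule mult_left_mono) simp
      then show ?thesis using True by (simp only: mult_ac indicator_simps greaterThan_iff mult_1_left mult_1_right)
    qed auto
  qed
  also have "\<dots> = e (x + t) * (\<integral>\<^sup>+y. indicator {x<..} y * w y * \<gamma> y ^ n \<partial>lborel)"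
    by (rule nn_integral_cmult) measurable
  finally have "of_nat (Suc n) * (of_nat (fact n) * ennreal \<bar>jost_kernel_term V (Suc n) x t\<bar>)
      \<le> of_nat (Suc n) * (e (x + t) * (\<integral>\<^sup>+y. indicator {x<..} y * w y * \<gamma> y ^ n \<partial>lborel))"
    by (rule mult_left_mono) simp
  also have "\<dots> = e (x + t) * (of_nat (Suc n) * (\<integral>\<^sup>+y. indicator {x<..} y * w y * \<gamma> y ^ n \<partial>lborel))"
    by (rule mult.left_commute)
  also have "\<dots> = e (x + t) * \<gamma> x ^ Suc n"
    using nn_integral_volterra_power[OF \<open>w \<in> borel_measurable borel\<close>, of n x]
    by (simp only: \<gamma>_def[symmetric])
  finally show ?case by (simp only: e_def \<gamma>_def w_def fact_Suc of_nat_mult of_nat_id mult.assoc)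
qed

section \<open>The transformation kernel as the sum of its iterates\<close>

locale jost =
  fixes V :: "real \<Rightarrow> real"
  assumes L1: "L1_weighted 1 V"
begin

lemma V_measurable [measurable]: "V \<in> borel_measurable borel"
  using L1 by (simp add: L1_weighted_def)

lemma V_weighted: "integrable lborel (\<lambda>y. (1 + \<bar>y\<bar>) * \<bar>V y\<bar>)"
  using L1 by (simp add: L1_weighted_def)

lemma V_integrable: "integrable lborel V"
proof (rule integrable_bounded_by[OF V_weighted])
  show "norm (V y) \<le> (1 + \<bar>y\<bar>) * \<bar>V y\<bar>" for y by (simp add: algebra_simps)
qed auto

lemma V_linear: "integrable lborel (\<lambda>y. if x < y then (y - a) * \<bar>V y\<bar> else 0)"
proof (rule integrable_bounded_by)
  show "integrable lborel (\<lambda>y. (1 + \<bar>a\<bar>) * ((1 + \<bar>y\<bar>) * \<bar>V y\<bar>))" by (intro integrable_mult_right V_weighted)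
  show "norm (if x < y then (y - a) * \<bar>V y\<bar> else 0) \<le> (1 + \<bar>a\<bar>) * ((1 + \<bar>y\<bar>) * \<bar>V y\<bar>)" for y
  proof -
    have "\<bar>y - a\<bar> \<le> \<bar>y\<bar> + \<bar>a\<bar>" by simp
    also have "\<dots> \<le> (1 + \<bar>a\<bar>) * (1 + \<bar>y\<bar>)" by (simp add: algebra_simps)
    finally have "\<bar>y - a\<bar> * \<bar>V y\<bar> \<le> (1 + \<bar>a\<bar>) * (1 + \<bar>y\<bar>) * \<bar>V y\<bar>" by (rule mult_right_mono) simp
    then show ?thesis by (auto simp: abs_mult mult.assoc)
  qed
qed auto

definition eta :: "real \<Rightarrow> real" where "eta x = (LINT y|lborel. (if x < y then \<bar>V y\<bar> else 0))"
definition gam :: "real \<Rightarrow> real" where "gam a = (LINT y|lborel. (if a < y then (y - a) * \<bar>V y\<bar> else 0))"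

lemma V_tail_integrable: "integrable lborel (\<lambda>y. if x < y then \<bar>V y\<bar> else 0)"
  by (rule integrable_bounded_by[OF integrable_norm[OF V_integrable]]) auto

lemma eta_measurable [measurable]: "eta \<in> borel_measurable borel"
  unfolding eta_def[abs_def] by measurable

lemma eta_nonneg: "eta x \<ge> 0"
  unfolding eta_def by (simp add: integral_nonneg_AE)

lemma eta_antimono: "x \<le> y \<Longrightarrow> eta y \<le> eta x"
  unfolding eta_def by (intro integral_mono V_tail_integrable) auto

lemma gam_nonneg: "gam a \<ge> 0"
  unfolding gam_def by (intro integral_nonneg_AE) auto

lemma kernel_term_le:
  assumes "a \<le> x"
  shows "\<bar>jost_kernel_term V n x t\<bar> \<le> eta (x + t) * (inverse (fact n) * gam a ^ n)"
proof -
  have e: "(\<integral>\<^sup>+y. indicator {x + t<..} y * ennreal \<bar>V y\<bar> \<partial>lborel) = ennreal (eta (x + t))"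
    unfolding eta_def
    by (subst nn_integral_eq_integral[symmetric]) (auto simp: V_tail_integrable intro!: nn_integral_cong split: split_indicator)
  have "(\<integral>\<^sup>+y. indicator {x<..} y * ennreal ((y - a) * \<bar>V y\<bar>) \<partial>lborel) \<le> (\<integral>\<^sup>+y. ennreal (if a < y then (y - a) * \<bar>V y\<bar> else 0) \<partial>lborel)"
    using assms by (intro nn_integral_mono) (auto split: split_indicator)
  also have "\<dots> = ennreal (gam a)" unfolding gam_def
    by (rule nn_integral_eq_integral[OF V_linear]) auto
  finally have "of_nat (fact n) * ennreal \<bar>jost_kernel_term V n x t\<bar> \<le> ennreal (eta (x + t)) * ennreal (gam a) ^ n"
    using jost_kernel_term_bound[OF V_measurable assms, of n t] unfolding e
    by (meson mult_left_mono order_trans power_mono zero_le)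
  then have "ennreal (fact n * \<bar>jost_kernel_term V n x t\<bar>) \<le> ennreal (eta (x + t) * gam a ^ n)"
    by (simp add: ennreal_mult ennreal_power eta_nonneg gam_nonneg ennreal_of_nat_eq_real_of_nat)
  then have "fact n * \<bar>jost_kernel_term V n x t\<bar> \<le> eta (x + t) * gam a ^ n"
    by (subst (asm) ennreal_le_iff) (auto simp: eta_nonneg gam_nonneg)
  then show ?thesis by (simp add: field_simps)
qed

definition K :: "real \<Rightarrow> real \<Rightarrow> real" where "K x t = (\<Sum>n. jost_kernel_term V n x t)"

lemma kernel_bound_summable: "summable (\<lambda>n. c * (inverse (fact n) * gam a ^ n))"
  by (intro summable_mult summable_exp)

lemma K_summable: "summable (\<lambda>n. \<bar>jost_kernel_term V n x t\<bar>)"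
  by (rule summable_comparison_test'[OF kernel_bound_summable[of "eta (x + t)" x], of 0])
    (use kernel_term_le[of x x] in auto)

lemma exp_gam: "(\<Sum>n. inverse (fact n) * gam a ^ n) = exp (gam a)"
  by (simp add: exp_def scaleR_conv_of_real divide_inverse)

lemma K_le:
  assumes "a \<le> x"
  shows "\<bar>K x t\<bar> \<le> exp (gam a) * eta (x + t)"
proof -
  have "\<bar>K x t\<bar> \<le> (\<Sum>n. \<bar>jost_kernel_term V n x t\<bar>)"
    unfolding K_def by (rule summable_rabs[OF K_summable])
  also have "\<dots> \<le> (\<Sum>n. eta (x + t) * (inverse (fact n) * gam a ^ n))"
    by (intro suminf_le kernel_term_le assms K_summable kernel_bound_summable)
  also have "\<dots> = eta (x + t) * exp (gam a)"
    unfolding exp_gam[symmetric] by (rule suminf_mult[OF summable_exp])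
  finally show ?thesis by (simp add: mult.commute)
qed

lemma K_measurable [measurable (raw)]:
  "f \<in> borel_measurable M \<Longrightarrow> g \<in> borel_measurable M \<Longrightarrow> (\<lambda>w. K (f w) (g w)) \<in> borel_measurable M"
  unfolding K_def by measurable

lemma K_nonpos: "t \<le> 0 \<Longrightarrow> K x t = 0"
  by (simp add: K_def jost_kernel_term_nonpos)

text \<open>The slice x < z < y has length y - x, so Tonelli turns integrability over the wedge into
  a first moment of \<open>q\<close>.\<close>

lemma integrable_wedge:
  assumes "integrable lborel (\<lambda>y. if x < y then (y - x) * norm (q y) else 0)" "q \<in> borel_measurable borel"
  shows "integrable (lborel \<Otimes>\<^sub>M lborel) (\<lambda>p. if x < snd p \<and> snd p < fst p then norm (q (fst p)) else 0)"
proof (rule integrableI_bounded)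
  note [measurable] = assms(2)
  show "(\<lambda>p. if x < snd p \<and> snd p < fst p then norm (q (fst p)) else 0) \<in> borel_measurable (lborel \<Otimes>\<^sub>M lborel)"
    by measurable
  have "(\<integral>\<^sup>+p. ennreal (norm (if x < snd p \<and> snd p < fst p then norm (q (fst p)) else 0)) \<partial>(lborel \<Otimes>\<^sub>M lborel))
      = (\<integral>\<^sup>+y. \<integral>\<^sup>+z. ennreal (norm (q y)) * indicator {x<..<y} z \<partial>lborel \<partial>lborel)"
    by (subst lborel.nn_integral_fst[symmetric]) (auto intro!: nn_integral_cong split: split_indicator)
  also have "\<dots> = (\<integral>\<^sup>+y. ennreal (norm (q y)) * emeasure lborel {x<..<y} \<partial>lborel)"
    by (intro nn_integral_cong nn_integral_cmult_indicator) auto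
  also have "\<dots> = (\<integral>\<^sup>+y. ennreal (norm (if x < y then (y - x) * norm (q y) else 0)) \<partial>lborel)"
    by (intro nn_integral_cong) (auto simp: ennreal_mult[symmetric] mult.commute emeasure_lborel_Ioo not_less)
  also have "\<dots> < \<infinity>" using assms(1) by (simp add: integrable_iff_bounded)
  finally show "(\<integral>\<^sup>+p. ennreal (norm (if x < snd p \<and> snd p < fst p then norm (q (fst p)) else 0)) \<partial>(lborel \<Otimes>\<^sub>M lborel)) < \<infinity>" .
qed

lemma wedge_V_integrable:
  "integrable (lborel \<Otimes>\<^sub>M lborel) (\<lambda>p. if x < snd p \<and> snd p < fst p then norm (V (fst p)) else 0)"
  using integrable_wedge[where q=V and x=x] V_linear[of x x] by (simp only: real_norm_def V_measurable)

text \<open>Summation of the recursion over all levels. On the wedge the tail bound can be taken at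
  x + t for every term, so the series is dominated by an exponential series times the integrable
  \<open>V (fst p)\<close>.\<close>

lemma K_equation:
  "K x t = (LINT y|lborel. (if 0 < t \<and> x + t < y then V y else 0)) +
    (LINT p|(lborel \<Otimes>\<^sub>M lborel). (if x < snd p \<and> snd p < fst p then V (fst p) * K (fst p) (t - fst p + snd p) else 0))"
proof -
  let ?f = "\<lambda>n p. if x < snd p \<and> snd p < fst p then V (fst p) * jost_kernel_term V n (fst p) (t - fst p + snd p) else 0"
  let ?c = "\<lambda>n. eta (x + t) * (inverse (fact n) * gam x ^ n)"
  have bd: "norm (?f n p) \<le> ?c n * (if x < snd p \<and> snd p < fst p then norm (V (fst p)) else 0)" for n p
  proof (cases "x < snd p \<and> snd p < fst p")
    case True
    have "\<bar>jost_kernel_term V n (fst p) (t - fst p + snd p)\<bar> \<le> eta (fst p + (t - fst p + snd p)) * (inverse (fact n) * gam x ^ n)"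
      using True by (intro kernel_term_le) auto
    also have "\<dots> \<le> ?c n" using True gam_nonneg by (intro mult_right_mono eta_antimono) auto
    finally have "\<bar>V (fst p)\<bar> * \<bar>jost_kernel_term V n (fst p) (t - fst p + snd p)\<bar> \<le> \<bar>V (fst p)\<bar> * ?c n"
      by (rule mult_left_mono) simp
    then show ?thesis using True by (simp add: abs_mult mult_ac)
  qed auto
  have i: "integrable (lborel \<Otimes>\<^sub>M lborel) (?f n)" for n
    by (rule integrable_bounded_by[OF integrable_mult_right[OF wedge_V_integrable] _ bd]) measurable
  have "(LINT p|(lborel \<Otimes>\<^sub>M lborel). (if x < snd p \<and> snd p < fst p then V (fst p) * K (fst p) (t - fst p + snd p) else 0))
      = (LINT p|(lborel \<Otimes>\<^sub>M lborel). (\<Sum>n. ?f n p))"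
    unfolding K_def by (intro Bochner_Integration.integral_cong) (auto simp: suminf_mult[OF summable_rabs_cancel[OF K_summable]])
  also have "\<dots> = (\<Sum>n. LINT p|(lborel \<Otimes>\<^sub>M lborel). ?f n p)"
  proof (rule integral_suminf[OF i])
    show "AE p in lborel \<Otimes>\<^sub>M lborel. summable (\<lambda>n. norm (?f n p))"
    proof (rule AE_I2)
      fix p
      show "summable (\<lambda>n. norm (?f n p))"
      proof (rule summable_comparison_test'[OF summable_mult2[OF kernel_bound_summable], of 0])
        show "norm (norm (?f n p)) \<le> ?c n * (if x < snd p \<and> snd p < fst p then norm (V (fst p)) else 0)" for n
          using bd[where n=n and p=p] by (simp only: real_norm_def abs_idempotent)
      qed
    qed
    let ?w = "LINT p|(lborel \<Otimes>\<^sub>M lborel). (if x < snd p \<and> snd p < fst p then norm (V (fst p)) else 0)"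
    have "(LINT p|(lborel \<Otimes>\<^sub>M lborel). norm (?f n p)) \<le> ?c n * ?w" for n
      unfolding integral_mult_right_zero[symmetric]
      by (intro integral_mono integrable_norm i bd integrable_mult_right wedge_V_integrable)
    then show "summable (\<lambda>n. LINT p|(lborel \<Otimes>\<^sub>M lborel). norm (?f n p))"
      by (intro summable_comparison_test'[OF summable_mult2[OF kernel_bound_summable], of 0])
        (auto simp: integral_nonneg_AE)
  qed
  also have "\<dots> = (\<Sum>n. jost_kernel_term V (Suc n) x t)" by simp
  finally show ?thesis
    unfolding K_def[of x t] using suminf_split_head[OF summable_rabs_cancel[OF K_summable[of x t]]] by simp
qed

end

section \<open>Limits and half-line estimates for absolutely continuous functions\<close>

lemma ac_deriv_has_vector_derivative:
  assumes F: "ac_deriv F u" and u: "continuous_on UNIV u"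
  shows "(F has_vector_derivative u x) (at x)"
proof -
  let ?a = "x - 1" and ?b = "x + 1"
  have c: "continuous_on {?a..?b} u" using u continuous_on_subset by blast
  have Fy: "F ?a + integral {?a..y} u = F y" if "y \<in> {?a..?b}" for y
  proof -
    have "set_integrable lborel {?a..y} u"
      using ac_derivD(1)[OF F, of ?a y] by (simp add: set_integrable_def)
    then have "F y - F ?a = integral {?a..y} u"
      using ac_derivD(2)[OF F, of ?a y] that set_borel_integral_eq_integral(2)[of "{?a..y}" u]
      unfolding set_lebesgue_integral_def by (metis atLeastAtMost_iff)
    then show ?thesis by (metis add.commute diff_add_cancel)
  qed
  have "((\<lambda>y. F ?a + integral {?a..y} u) has_vector_derivative 0 + u x) (at x within {?a..?b})"
    by (intro has_vector_derivative_add has_vector_derivative_const integral_has_vector_derivative c) auto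
  then have "(F has_vector_derivative 0 + u x) (at x within {?a..?b})"
  proof (rule has_vector_derivative_transform[rotated 2])
    show "F y = F ?a + integral {?a..y} u" if "y \<in> {?a..?b}" for y
      using Fy[OF that] by (rule sym)
  qed simp
  moreover have "at x within {?a..?b} = at x" by (rule at_within_interior) simp
  ultimately show ?thesis by simp
qed

text \<open>Integration from infinity without any prior knowledge that \<open>u\<close> is
  integrable on the half-line: in \<open>ennreal\<close> the infinite case is trivial.\<close>

lemma ac_deriv_norm_le:
  assumes F: "ac_deriv F u" and lim: "(F \<longlongrightarrow> 0) at_top"
  shows "ennreal (norm (F a)) \<le> (\<integral>\<^sup>+x. indicator {a..} x * ennreal (norm (u x)) \<partial>lborel)" (is "_ \<le> ?I")
proof (cases ?I)
  case (real r)
  have le: "norm (F b - F a) \<le> r" if "a \<le> b" for b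
  proof -
    have "ennreal (norm (F b - F a)) \<le> (\<integral>\<^sup>+x. ennreal (norm (indicator {a..b} x *\<^sub>R u x)) \<partial>lborel)"
      unfolding ac_derivD(2)[OF F that] by (rule ennreal_norm_integral_le)
    also have "\<dots> \<le> ?I" by (intro nn_integral_mono) (auto split: split_indicator)
    finally show ?thesis using real by simp
  qed
  have "((\<lambda>b. norm (F b - F a)) \<longlongrightarrow> norm (0 - F a)) at_top" by (intro tendsto_intros lim)
  then have "norm (0 - F a) \<le> r"
    by (rule tendsto_upperbound) (auto intro: eventually_mono[OF eventually_ge_at_top[of a] le])
  then show ?thesis using real by (simp add: ennreal_leI)
qed simp

lemma tail_integral_tendsto_0:
  fixes u :: "real \<Rightarrow> 'a::{banach, second_countable_topology}"
  assumes "integrable lborel u"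
  shows "((\<lambda>x. LINT y|lborel. (if x < y then u y else 0)) \<longlongrightarrow> 0) at_top"
proof -
  have [measurable]: "u \<in> borel_measurable borel" using assms by auto
  have "((\<lambda>x. LINT y|lborel. (if x < y then u y else 0)) \<longlongrightarrow> (LINT y::real|lborel. (0::'a))) at_top"
  proof (rule integral_dominated_convergence_at_top[where w="\<lambda>y. norm (u y)"])
    show "AE y in lborel. ((\<lambda>x. if x < y then u y else 0) \<longlongrightarrow> 0) at_top"
    proof (rule AE_I2, rule tendsto_eventually)
      fix y
      show "eventually (\<lambda>x. (if x < y then u y else 0) = 0) at_top"
        using eventually_ge_at_top[of y] by eventually_elim auto
    qed
  qed (use assms in auto)
  then show ?thesis by simp
qed

lemma cis_has_vector_derivative: "((\<lambda>x. cis (c * x)) has_vector_derivative \<i> * of_real c * cis (c * x)) (at x)"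
  unfolding has_vector_derivative_def
  by (auto intro!: derivative_eq_intros simp: fun_eq_iff scaleR_conv_of_real)

lemma ac_deriv_cis: "ac_deriv (\<lambda>x. cis (c * x)) (\<lambda>x. \<i> * of_real c * cis (c * x))"
  by (rule ac_deriv_vector_derivative[OF cis_has_vector_derivative]) (intro continuous_intros)

section \<open>From the kernel to the integral equation of the Jost solution\<close>

context jost
begin

lemma eta_integral:
  "integrable lborel (\<lambda>t. if 0 < t then eta (x + t) else 0)"
  "(LINT t|lborel. (if 0 < t then eta (x + t) else 0)) = gam x"
proof -
  have "(\<integral>\<^sup>+t. ennreal (if 0 < t then eta (x + t) else 0) \<partial>lborel) =
      (\<integral>\<^sup>+t. \<integral>\<^sup>+y. (if 0 < t \<and> x + t < y then ennreal \<bar>V y\<bar> else 0) \<partial>lborel \<partial>lborel)"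
  proof (rule nn_integral_cong)
    fix t
    show "ennreal (if 0 < t then eta (x + t) else 0) = (\<integral>\<^sup>+y. (if 0 < t \<and> x + t < y then ennreal \<bar>V y\<bar> else 0) \<partial>lborel)"
    proof (cases "0 < t")
      case True
      then show ?thesis unfolding eta_def
        by (auto simp: nn_integral_eq_integral[OF V_tail_integrable, symmetric] intro!: nn_integral_cong)
    qed auto
  qed
  also have "\<dots> = (\<integral>\<^sup>+y. \<integral>\<^sup>+t. (if 0 < t \<and> x + t < y then ennreal \<bar>V y\<bar> else 0) \<partial>lborel \<partial>lborel)"
    by (rule lborel_pair.Fubini') measurable
  also have "\<dots> = (\<integral>\<^sup>+y. ennreal \<bar>V y\<bar> * emeasure lborel {0<..<y - x} \<partial>lborel)"
    by (subst nn_integral_cmult_indicator[symmetric]) (auto intro!: nn_integral_cong split: split_indicator)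
  also have "\<dots> = (\<integral>\<^sup>+y. ennreal (if x < y then (y - x) * \<bar>V y\<bar> else 0) \<partial>lborel)"
    by (intro nn_integral_cong) (auto simp: ennreal_mult[symmetric] mult.commute not_less)
  also have "\<dots> = ennreal (gam x)"
    unfolding gam_def by (rule nn_integral_eq_integral[OF V_linear]) auto
  finally have *: "(\<integral>\<^sup>+t. ennreal (if 0 < t then eta (x + t) else 0) \<partial>lborel) = ennreal (gam x)" .
  show "integrable lborel (\<lambda>t. if 0 < t then eta (x + t) else 0)"
    by (rule integrableI_nonneg) (use * in \<open>auto simp: eta_nonneg\<close>)
  show "(LINT t|lborel. (if 0 < t then eta (x + t) else 0)) = gam x"
    by (subst integral_eq_nn_integral) (use * in \<open>auto simp: eta_nonneg gam_nonneg\<close>)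
qed

lemma gam_antimono: "x \<le> y \<Longrightarrow> gam y \<le> gam x"
  unfolding gam_def by (intro integral_mono V_linear) (auto intro: mult_right_mono)

lemma K_le': "a \<le> x \<Longrightarrow> \<bar>K x t\<bar> \<le> exp (gam a) * (if 0 < t then eta (x + t) else 0)"
  using K_le[of a x t] by (auto simp: K_nonpos)

lemma K_integrable: "integrable lborel (K x)"
proof (rule integrable_bounded_by[OF integrable_mult_right[OF eta_integral(1)[of x], of "exp (gam x)"]])
  show "norm (K x t) \<le> exp (gam x) * (if 0 < t then eta (x + t) else 0)" for t
    unfolding real_norm_def by (rule K_le') simp
  show "K x \<in> borel_measurable lborel" using K_measurable[of "\<lambda>_. x" lborel "\<lambda>t. t"] by simp
qed

lemma K_norm_integral: "a \<le> x \<Longrightarrow> (LINT t|lborel. \<bar>K x t\<bar>) \<le> exp (gam a) * gam x"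
proof -
  assume "a \<le> x"
  then have "(LINT t|lborel. \<bar>K x t\<bar>) \<le> (LINT t|lborel. exp (gam a) * (if 0 < t then eta (x + t) else 0))"
    by (intro integral_mono integrable_abs K_integrable integrable_mult_right eta_integral(1) K_le')
  then show ?thesis by (simp only: integral_mult_right_zero eta_integral(2))
qed

definition h :: "real \<Rightarrow> real \<Rightarrow> complex" where
  "h k x = 1 + (LINT t|lborel. cis (2 * k * t) * of_real (K x t))"

lemma h_measurable [measurable]: "h k \<in> borel_measurable borel"
  unfolding h_def[abs_def] by measurable

lemma h_sub_one_le:
  assumes "a \<le> x"
  shows "norm (h k x - 1) \<le> exp (gam a) * gam x"
proof -
  have "norm (h k x - 1) \<le> (LINT t|lborel. norm (cis (2 * k * t) * complex_of_real (K x t)))"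
    unfolding h_def add_diff_cancel_left' by (rule integral_norm_bound)
  also have "\<dots> \<le> exp (gam a) * gam x" using K_norm_integral[OF assms] by (simp add: norm_mult)
  finally show ?thesis .
qed

definition hbound :: "real \<Rightarrow> real" where "hbound a = 1 + exp (gam a) * gam a"

lemma h_le:
  assumes "a \<le> x"
  shows "norm (h k x) \<le> hbound a"
proof -
  have "exp (gam a) * gam x \<le> exp (gam a) * gam a"
    by (intro mult_left_mono gam_antimono assms) simp
  moreover have "norm (h k x) \<le> norm (h k x - 1) + 1"
    using norm_triangle_ineq[of "h k x - 1" 1] by simp
  ultimately show ?thesis using h_sub_one_le[OF assms, of k] unfolding hbound_def by linarith
qed

definition q :: "real \<Rightarrow> real \<Rightarrow> complex" where "q k y = of_real (V y) * h k y"

lemma q_measurable [measurable]: "q k \<in> borel_measurable borel"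
  unfolding q_def[abs_def] by measurable

lemma q_le: "a \<le> y \<Longrightarrow> norm (q k y) \<le> hbound a * \<bar>V y\<bar>"
  unfolding q_def norm_mult norm_of_real mult.commute[of "\<bar>V y\<bar>"] by (intro mult_right_mono h_le) auto

lemma wedge_q_integrable:
  "integrable (lborel \<Otimes>\<^sub>M lborel) (\<lambda>p. if x < snd p \<and> snd p < fst p then cis (s p) * q k (fst p) else 0)"
  if [measurable]: "s \<in> borel_measurable (lborel \<Otimes>\<^sub>M lborel)"
proof (rule integrable_bounded_by[OF integrable_mult_right[OF wedge_V_integrable[of x], of "hbound x"]])
  fix p :: "real \<times> real"
  show "norm (if x < snd p \<and> snd p < fst p then cis (s p) * q k (fst p) else 0)
      \<le> hbound x * (if x < snd p \<and> snd p < fst p then norm (V (fst p)) else 0)"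
    using q_le[of x "fst p" k] by (auto simp: norm_mult)
qed measurable

text \<open>Transform of \<open>K_equation\<close> in t. Its inhomogeneous part turns into the wedge
  integral of \<open>V\<close>, its integral part into that of V (h - 1), both with the phase
  e^(2ik(y-z)), and together they make V h = q. The kernel bounds justify both exchanges of
  integrals.\<close>

lemma h_equation:
  "h k x = 1 + (LINT p|(lborel \<Otimes>\<^sub>M lborel). (if x < snd p \<and> snd p < fst p then cis (2 * k * (fst p - snd p)) * q k (fst p) else 0))"
proof -
  interpret P: pair_sigma_finite "lborel \<Otimes>\<^sub>M lborel :: (real \<times> real) measure" "lborel :: real measure" ..
  let ?W = "\<lambda>p::real\<times>real. x < snd p \<and> snd p < fst p"
  let ?e = "\<lambda>p::real\<times>real. cis (2 * k * (fst p - snd p))"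
  let ?A = "\<lambda>t. LINT y|lborel. (if 0 < t \<and> x + t < y then V y else 0)"
  let ?B = "\<lambda>t. LINT p|(lborel \<Otimes>\<^sub>M lborel). (if ?W p then V (fst p) * K (fst p) (t - fst p + snd p) else 0)"
  let ?a = "\<lambda>t y. if 0 < t \<and> x + t < y then cis (2 * k * t) * complex_of_real (V y) else 0"
  let ?b = "\<lambda>p t. if ?W p then cis (2 * k * t) * complex_of_real (V (fst p) * K (fst p) (t - fst p + snd p)) else 0"
  have shiftK: "integrable lborel (\<lambda>t. K y (t - y + z))" for y z
    using integrable_shift_lborel[OF K_integrable, of y "y - z"] by (simp add: algebra_simps)
  have ia: "integrable (lborel \<Otimes>\<^sub>M lborel) (\<lambda>(t, y). ?a t y)"
  proof (rule lborel_pair.Fubini_integrable)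
    show "AE t in lborel. integrable lborel (\<lambda>y. (\<lambda>(t, y). ?a t y) (t, y))"
    proof (rule AE_I2)
      fix t :: real
      show "integrable lborel (\<lambda>y. (\<lambda>(t, y). ?a t y) (t, y))"
        by (rule integrable_bounded_by[OF integrable_norm[OF V_integrable]]) (auto simp: norm_mult)
    qed
    have "(LINT y|lborel. norm ((\<lambda>(t, y). ?a t y) (t, y))) = (if 0 < t then eta (x + t) else 0)" for t
      unfolding eta_def by (auto intro!: Bochner_Integration.integral_cong simp: norm_mult)
    then show "integrable lborel (\<lambda>t. LINT y|lborel. norm ((\<lambda>(t, y). ?a t y) (t, y)))"
      using eta_integral(1)[of x] by simp
  qed measurable
  have ib: "integrable ((lborel \<Otimes>\<^sub>M lborel) \<Otimes>\<^sub>M lborel) (\<lambda>(p, t). ?b p t)"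
  proof (rule P.Fubini_integrable)
    have ib1: "integrable lborel (\<lambda>t. ?b p t)" for p
    proof (cases "?W p")
      case True
      then show ?thesis using shiftK[of "fst p" "snd p"]
        by (auto intro!: integrable_cis_mult simp del: of_real_mult)
    qed auto
    then show "AE p in lborel \<Otimes>\<^sub>M lborel. integrable lborel (\<lambda>t. (\<lambda>(p, t). ?b p t) (p, t))" by simp
    show "integrable (lborel \<Otimes>\<^sub>M lborel) (\<lambda>p. LINT t|lborel. norm ((\<lambda>(p, t). ?b p t) (p, t)))"
    proof (rule integrable_bounded_by[OF integrable_mult_right[OF wedge_V_integrable[of x], of "exp (gam x) * gam x"]])
      fix p
      show "norm (LINT t|lborel. norm ((\<lambda>(p, t). ?b p t) (p, t))) \<le> exp (gam x) * gam x * (if ?W p then norm (V (fst p)) else 0)"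
      proof (cases "?W p")
        case True
        have "(LINT t|lborel. norm (?b p t)) = \<bar>V (fst p)\<bar> * (LINT t|lborel. \<bar>K (fst p) (t - (fst p - snd p))\<bar>)"
        proof -
          have t: "t - fst p + snd p = t - (fst p - snd p)" for t by simp
          have "(LINT t|lborel. norm (?b p t)) = (LINT t|lborel. \<bar>V (fst p)\<bar> * \<bar>K (fst p) (t - (fst p - snd p))\<bar>)"
            unfolding t using True by (intro Bochner_Integration.integral_cong) (auto simp: norm_mult)
          then show ?thesis by (simp only: integral_mult_right_zero)
        qed
        also have "(LINT t|lborel. \<bar>K (fst p) (t - (fst p - snd p))\<bar>) = (LINT t|lborel. \<bar>K (fst p) t\<bar>)"
          by (rule integral_shift_lborel)
        finally have eq: "(LINT t|lborel. norm (?b p t)) = \<bar>V (fst p)\<bar> * (LINT t|lborel. \<bar>K (fst p) t\<bar>)" .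
        have "(LINT t|lborel. \<bar>K (fst p) t\<bar>) \<le> exp (gam x) * gam x"
        proof -
          have "(LINT t|lborel. \<bar>K (fst p) t\<bar>) \<le> exp (gam x) * gam (fst p)"
            using True by (intro K_norm_integral) auto
          also have "\<dots> \<le> exp (gam x) * gam x" using True by (intro mult_left_mono gam_antimono) auto
          finally show ?thesis .
        qed
        then have "\<bar>V (fst p)\<bar> * (LINT t|lborel. \<bar>K (fst p) t\<bar>) \<le> \<bar>V (fst p)\<bar> * (exp (gam x) * gam x)"
          by (rule mult_left_mono) simp
        moreover have "0 \<le> (LINT t|lborel. norm (?b p t))" by (simp add: integral_nonneg_AE)
        ultimately show ?thesis using eq True by (simp add: mult_ac)
      qed auto
    qed measurable
  qed measurable
  have iA: "integrable lborel (\<lambda>t. LINT y|lborel. ?a t y)" using lborel_pair.integrable_fst[OF ia] .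
  have iB: "integrable lborel (\<lambda>t. LINT p|(lborel \<Otimes>\<^sub>M lborel). ?b p t)" using P.integrable_snd[OF ib] .
  have eA: "cis (2 * k * t) * of_real (?A t) = (LINT y|lborel. ?a t y)" for t
    unfolding integral_complex_of_real[symmetric] integral_mult_right_zero[symmetric]
    by (intro Bochner_Integration.integral_cong) auto
  have eB: "cis (2 * k * t) * of_real (?B t) = (LINT p|(lborel \<Otimes>\<^sub>M lborel). ?b p t)" for t
    unfolding integral_complex_of_real[symmetric] integral_mult_right_zero[symmetric]
    by (intro Bochner_Integration.integral_cong) auto
  have "(LINT t|lborel. cis (2 * k * t) * of_real (K x t)) = (LINT t|lborel. (LINT y|lborel. ?a t y) + (LINT p|(lborel \<Otimes>\<^sub>M lborel). ?b p t))"
  proof (rule Bochner_Integration.integral_cong[OF refl])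
    fix t
    have "complex_of_real (K x t) = of_real (?A t) + of_real (?B t)"
      using K_equation[of x t] by (simp only: of_real_add)
    then show "cis (2 * k * t) * of_real (K x t) = (LINT y|lborel. ?a t y) + (LINT p|(lborel \<Otimes>\<^sub>M lborel). ?b p t)"
      by (simp only: distrib_left eA eB)
  qed
  also have "\<dots> = (LINT t|lborel. LINT y|lborel. ?a t y) + (LINT t|lborel. LINT p|(lborel \<Otimes>\<^sub>M lborel). ?b p t)"
    by (rule Bochner_Integration.integral_add[OF iA iB])
  finally have split: "(LINT t|lborel. cis (2 * k * t) * of_real (K x t)) =
    (LINT t|lborel. LINT y|lborel. ?a t y) + (LINT t|lborel. LINT p|(lborel \<Otimes>\<^sub>M lborel). ?b p t)" .
  have iV: "integrable (lborel \<Otimes>\<^sub>M lborel) (\<lambda>p. if ?W p then ?e p * complex_of_real (V (fst p)) else 0)"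
    by (rule integrable_bounded_by[OF wedge_V_integrable[of x]]) (auto simp: norm_mult)
  \<comment> \<open>Substituting t = y - z maps 0 < t, x + t < y onto the wedge x < z < y.\<close>
  have "(LINT t|lborel. LINT y|lborel. ?a t y) = (LINT y|lborel. LINT t|lborel. ?a t y)"
    by (rule lborel_pair.Fubini_integral[OF ia, symmetric])
  also have "\<dots> = (LINT y|lborel. LINT z|lborel. (if ?W (y, z) then ?e (y, z) * complex_of_real (V y) else 0))"
  proof (rule Bochner_Integration.integral_cong[OF refl])
    fix y
    have "(LINT t|lborel. ?a t y) = (LINT z|lborel. ?a (y + - 1 * z) y)"
      using lborel_integral_real_affine[of "- 1" "\<lambda>t. ?a t y" y] by simp
    also have "\<dots> = (LINT z|lborel. (if ?W (y, z) then ?e (y, z) * complex_of_real (V y) else 0))"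
      by (intro Bochner_Integration.integral_cong) auto
    finally show "(LINT t|lborel. ?a t y) = (LINT z|lborel. (if ?W (y, z) then ?e (y, z) * complex_of_real (V y) else 0))" .
  qed
  also have "(LINT y|lborel. LINT z|lborel. (if ?W (y, z) then ?e (y, z) * complex_of_real (V y) else 0)) =
      (LINT p|(lborel \<Otimes>\<^sub>M lborel). (if ?W p then ?e p * complex_of_real (V (fst p)) else 0))"
    using lborel_pair.integral_fst'[OF iV] by (simp only: fst_conv snd_conv)
  finally have T0: "(LINT t|lborel. LINT y|lborel. ?a t y) =
    (LINT p|(lborel \<Otimes>\<^sub>M lborel). (if ?W p then ?e p * complex_of_real (V (fst p)) else 0))" .
  \<comment> \<open>Translating t by y - z produces the phase e^(2ik(y-z)) and leaves the full
    transform of K(y, .), which is h(k, y) - 1.\<close>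
  have "(LINT t|lborel. LINT p|(lborel \<Otimes>\<^sub>M lborel). ?b p t) = (LINT p|(lborel \<Otimes>\<^sub>M lborel). LINT t|lborel. ?b p t)"
    by (rule P.Fubini_integral[OF ib])
  also have "\<dots> = (LINT p|(lborel \<Otimes>\<^sub>M lborel). (if ?W p then ?e p * (of_real (V (fst p)) * (h k (fst p) - 1)) else 0))"
  proof (rule Bochner_Integration.integral_cong[OF refl])
    fix p
    show "(LINT t|lborel. ?b p t) = (if ?W p then ?e p * (of_real (V (fst p)) * (h k (fst p) - 1)) else 0)"
    proof (cases "?W p")
      case True
      have "(LINT t|lborel. ?b p t) = (LINT t|lborel. (?e p * of_real (V (fst p))) * (cis (2 * k * (t - (fst p - snd p))) * of_real (K (fst p) (t - (fst p - snd p)))))"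
      proof (rule Bochner_Integration.integral_cong[OF refl])
        fix t
        have c: "cis (2 * k * t) = ?e p * cis (2 * k * (t - (fst p - snd p)))" by (simp add: cis_mult algebra_simps)
        have t: "t - fst p + snd p = t - (fst p - snd p)" by simp
        have "?b p t = cis (2 * k * t) * (of_real (V (fst p)) * of_real (K (fst p) (t - (fst p - snd p))))"
          using True unfolding t of_real_mult by (rule if_P)
        also have "\<dots> = (?e p * of_real (V (fst p))) * (cis (2 * k * (t - (fst p - snd p))) * of_real (K (fst p) (t - (fst p - snd p))))"
          unfolding c by (simp only: mult_ac)
        finally show "?b p t = (?e p * of_real (V (fst p))) * (cis (2 * k * (t - (fst p - snd p))) * of_real (K (fst p) (t - (fst p - snd p))))" .
      qed
      also have "\<dots> = (?e p * of_real (V (fst p))) * (LINT t|lborel. cis (2 * k * t) * of_real (K (fst p) t))"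
        unfolding integral_mult_right_zero
        by (simp only: integral_shift_lborel[of "\<lambda>t. cis (2 * k * t) * of_real (K (fst p) t)" "fst p - snd p"])
      finally show ?thesis using True by (simp add: h_def mult.assoc)
    qed auto
  qed
  finally have T1: "(LINT t|lborel. LINT p|(lborel \<Otimes>\<^sub>M lborel). ?b p t) =
    (LINT p|(lborel \<Otimes>\<^sub>M lborel). (if ?W p then ?e p * (of_real (V (fst p)) * (h k (fst p) - 1)) else 0))" .
  have "(LINT t|lborel. cis (2 * k * t) * of_real (K x t)) =
     (LINT p|(lborel \<Otimes>\<^sub>M lborel). (if ?W p then ?e p * complex_of_real (V (fst p)) else 0)) +
     (LINT p|(lborel \<Otimes>\<^sub>M lborel). (if ?W p then ?e p * (of_real (V (fst p)) * (h k (fst p) - 1)) else 0))"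
    by (simp only: split T0 T1)
  also have "\<dots> = (LINT p|(lborel \<Otimes>\<^sub>M lborel). (if ?W p then ?e p * complex_of_real (V (fst p)) else 0) +
      (if ?W p then ?e p * (of_real (V (fst p)) * (h k (fst p) - 1)) else 0))"
  proof (rule Bochner_Integration.integral_add[symmetric, OF iV])
    have "integrable (lborel \<Otimes>\<^sub>M lborel) (\<lambda>p. (if ?W p then ?e p * q k (fst p) else 0) - (if ?W p then ?e p * complex_of_real (V (fst p)) else 0))"
      by (intro Bochner_Integration.integrable_diff iV wedge_q_integrable) measurable
    then show "integrable (lborel \<Otimes>\<^sub>M lborel) (\<lambda>p. if ?W p then ?e p * (of_real (V (fst p)) * (h k (fst p) - 1)) else 0)"
      by (rule Bochner_Integration.integrable_cong[THEN iffD1, rotated 2]) (auto simp: q_def algebra_simps)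
  qed
  also have "\<dots> = (LINT p|(lborel \<Otimes>\<^sub>M lborel). (if ?W p then ?e p * q k (fst p) else 0))"
    by (intro Bochner_Integration.integral_cong) (auto simp: q_def algebra_simps)
  finally show ?thesis by (simp only: h_def[of k x])
qed

end

section \<open>From the integral equation to the differential equation, and uniqueness\<close>

context jost
begin

lemma locally_integrable_V_mult:
  fixes y :: "real \<Rightarrow> complex"
  assumes "continuous_on UNIV y"
  shows "integrable lborel (\<lambda>t. indicator {a..b} t *\<^sub>R (complex_of_real (V t - c) * y t))"
proof (rule integrable_indicator_mult_continuous[OF _ assms])
  have "integrable lborel (\<lambda>t. indicator {a..b} t *\<^sub>R complex_of_real (V t) - indicator {a..b} t *\<^sub>R complex_of_real c)"
    by (intro Bochner_Integration.integrable_diff integrable_mult_indicator integrable_of_real V_integrable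
      integrable_scaleR_left integrable_real_indicator) (auto simp: emeasure_lborel_Icc_eq)
  then show "integrable lborel (\<lambda>t. indicator {a..b} t *\<^sub>R complex_of_real (V t - c))" by (simp add: scaleR_diff_right)
qed

lemma ode_sol_iff:
  "ode_sol V k y \<longleftrightarrow> (\<exists>y'. (\<forall>x. (y has_vector_derivative y' x) (at x)) \<and>
     ac_deriv y' (\<lambda>t. complex_of_real (V t - k\<^sup>2) * y t))"
proof -
  have "(\<forall>x. y' x = y' 0 + interval_lebesgue_integral lborel (ereal 0) (ereal x) (\<lambda>t. complex_of_real (V t - k\<^sup>2) * y t))
      \<longleftrightarrow> ac_deriv y' (\<lambda>t. complex_of_real (V t - k\<^sup>2) * y t)"
    if "\<forall>x. (y has_vector_derivative y' x) (at x)" for y'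
  proof -
    have "continuous_on UNIV y"
      using that by (intro continuous_at_imp_continuous_on ballI) (auto intro: has_vector_derivative_continuous)
    from ac_deriv_interval_integral_iff[OF locally_integrable_V_mult[OF this, of _ _ "k\<^sup>2"]]
    show ?thesis by blast
  qed
  then show ?thesis unfolding ode_sol_def by blast
qed

text \<open>The integral for h' with its x-dependent phase removed: x enters only as the lower
  limit, so the derivative can be read off even though \<open>V\<close> is merely
  integrable.\<close>

definition E :: "real \<Rightarrow> real \<Rightarrow> complex" where
  "E k x = (LINT y|lborel. (if x < y then cis (2 * k * y) * q k y else 0))"

definition g :: "real \<Rightarrow> real \<Rightarrow> complex" where "g k x = - (cis (- (2 * k) * x) * E k x)"

lemma q_tail_integrable:
  assumes [measurable]: "s \<in> borel_measurable lborel"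
  shows "integrable lborel (\<lambda>y. if x < y then cis (s y) * q k y else 0)"
proof (rule integrable_bounded_by)
  show "integrable lborel (\<lambda>y. hbound x * \<bar>V y\<bar>)" by (intro integrable_mult_right integrable_abs V_integrable)
  have "0 \<le> hbound x" using norm_ge_zero[of "h 0 x"] h_le[of x x 0] by linarith
  then show "norm (if x < y then cis (s y) * q k y else 0) \<le> hbound x * \<bar>V y\<bar>" for y
    using q_le[of x y k] by (simp add: norm_mult)
qed measurable

lemma ac_deriv_E: "ac_deriv (E k) (\<lambda>y. - (cis (2 * k * y) * q k y))"
  unfolding ac_deriv_def
proof (intro conjI allI impI)
  fix a b :: real
  have eq: "AE y in lborel. indicator {a..b} y *\<^sub>R - (cis (2 * k * y) * q k y) =
      (if b < y then cis (2 * k * y) * q k y else 0) - (if a < y then cis (2 * k * y) * q k y else 0)" if "a \<le> b"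
    by (rule eventually_mono[OF AE_lborel_singleton[of a]]) (use that in auto)
  have i: "integrable lborel (\<lambda>y. if x < y then cis (2 * k * y) * q k y else 0)" for x
    by (rule q_tail_integrable) measurable
  have int: "integrable lborel (\<lambda>y. (if b < y then cis (2 * k * y) * q k y else 0) - (if a < y then cis (2 * k * y) * q k y else 0))"
    by (intro Bochner_Integration.integrable_diff i)
  show "integrable lborel (\<lambda>y. indicator {a..b} y *\<^sub>R - (cis (2 * k * y) * q k y))"
  proof (cases "a \<le> b")
    case True
    have "(\<lambda>y. indicator {a..b} y *\<^sub>R - (cis (2 * k * y) * q k y)) \<in> borel_measurable lborel" by measurable
    from integrable_cong_AE[OF this borel_measurable_integrable[OF int] eq[OF True]] int show ?thesis by blast
  qed simp
  assume ab: "a \<le> b"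
  have "(LINT y|lborel. indicator {a..b} y *\<^sub>R - (cis (2 * k * y) * q k y)) =
      (LINT y|lborel. (if b < y then cis (2 * k * y) * q k y else 0) - (if a < y then cis (2 * k * y) * q k y else 0))"
    by (rule integral_cong_AE[OF _ _ eq[OF ab]]) measurable
  also have "\<dots> = E k b - E k a" unfolding E_def by (rule Bochner_Integration.integral_diff[OF i i])
  finally show "E k b - E k a = (LINT y|lborel. indicator {a..b} y *\<^sub>R - (cis (2 * k * y) * q k y))" ..
qed

lemma g_eq: "g k x = - (LINT y|lborel. (if x < y then cis (2 * k * (y - x)) * q k y else 0))"
proof -
  have "(LINT y|lborel. (if x < y then cis (2 * k * (y - x)) * q k y else 0)) = (LINT y|lborel. cis (- (2 * k) * x) * (if x < y then cis (2 * k * y) * q k y else 0))"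
    by (intro Bochner_Integration.integral_cong) (auto simp: cis_mult right_diff_distrib simp flip: mult.assoc)
  then show ?thesis by (simp only: g_def E_def integral_mult_right_zero)
qed

lemma g_continuous: "continuous_on UNIV (g k)"
  unfolding g_def[abs_def] by (intro continuous_intros ac_deriv_continuous[OF ac_deriv_E])

lemma g_measurable [measurable]: "g k \<in> borel_measurable borel"
  by (rule borel_measurable_continuous_onI[OF g_continuous])

lemma g_le:
  assumes "a \<le> x"
  shows "norm (g k x) \<le> hbound a * eta x"
proof -
  have i: "integrable lborel (\<lambda>y. if x < y then cis (2 * k * (y - x)) * q k y else 0)"
    by (rule q_tail_integrable) measurable
  have "norm (g k x) \<le> (LINT y|lborel. norm (if x < y then cis (2 * k * (y - x)) * q k y else 0))"
    unfolding g_eq norm_minus_cancel by (rule integral_norm_bound)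
  also have "\<dots> \<le> (LINT y|lborel. hbound a * (if x < y then \<bar>V y\<bar> else 0))"
  proof (intro integral_mono integrable_norm i integrable_mult_right V_tail_integrable)
    show "norm (if x < y then cis (2 * k * (y - x)) * q k y else 0) \<le> hbound a * (if x < y then \<bar>V y\<bar> else 0)" for y
      using q_le[of a y k] assms by (auto simp: norm_mult)
  qed
  also have "\<dots> = hbound a * eta x" unfolding eta_def by (rule integral_mult_right_zero)
  finally show ?thesis .
qed

text \<open>In the wedge integral of \<open>h_equation\<close>, integrating over y first gives -g at
  z. So \<open>h\<close> is an integral of \<open>g\<close>, which is continuous; hence
  \<open>h\<close> is genuinely differentiable.\<close>

lemma g_tail: "integrable lborel (\<lambda>z. if x < z then g k z else 0)"
  "h k x = 1 - (LINT z|lborel. (if x < z then g k z else 0))"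
proof -
  let ?f = "\<lambda>y z. if x < z \<and> z < y then cis (2 * k * (y - z)) * q k y else 0"
  have i: "integrable (lborel \<Otimes>\<^sub>M lborel) (\<lambda>(y, z). ?f y z)"
    using wedge_q_integrable[of "\<lambda>p. 2 * k * (fst p - snd p)" x k] by (simp add: case_prod_beta')
  have eq: "(LINT y|lborel. ?f y z) = (if x < z then - g k z else 0)" for z
    unfolding g_eq by auto
  have "integrable lborel (\<lambda>z. - (if x < z then - g k z else 0))"
    using lborel_pair.integrable_snd[OF i] unfolding eq by (rule integrable_minus)
  then show "integrable lborel (\<lambda>z. if x < z then g k z else 0)"
    by (rule Bochner_Integration.integrable_cong[THEN iffD1, rotated 2]) auto
  have "h k x = 1 + (LINT z|lborel. LINT y|lborel. ?f y z)"
    using h_equation[of k x] lborel_pair.integral_snd[OF i] by (simp add: case_prod_beta')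
  also have "(LINT z|lborel. LINT y|lborel. ?f y z) = (LINT z|lborel. - (if x < z then g k z else 0))"
    unfolding eq by (intro Bochner_Integration.integral_cong) auto
  finally show "h k x = 1 - (LINT z|lborel. (if x < z then g k z else 0))" by simp
qed

lemma ac_deriv_h: "ac_deriv (h k) (g k)"
  unfolding ac_deriv_def
proof (intro conjI allI impI)
  fix a b :: real
  have "continuous_on {a..b} (g k)" using g_continuous continuous_on_subset by blast
  then show "integrable lborel (\<lambda>x. indicator {a..b} x *\<^sub>R g k x)"
    using borel_integrable_atLeastAtMost' by (auto simp: set_integrable_def)
  assume ab: "a \<le> b"
  have "h k b - h k a = (LINT z|lborel. (if a < z then g k z else 0)) - (LINT z|lborel. (if b < z then g k z else 0))"
    unfolding g_tail(2) by simp
  also have "\<dots> = (LINT z|lborel. (if a < z then g k z else 0) - (if b < z then g k z else 0))"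
    by (rule Bochner_Integration.integral_diff[OF g_tail(1) g_tail(1), symmetric])
  also have "\<dots> = (LINT z|lborel. indicator {a..b} z *\<^sub>R g k z)"
  proof (rule integral_cong_AE)
    show "AE z in lborel. (if a < z then g k z else 0) - (if b < z then g k z else 0) = indicator {a..b} z *\<^sub>R g k z"
      by (rule eventually_mono[OF AE_lborel_singleton[of a]]) (use ab in auto)
  qed measurable
  finally show "h k b - h k a = (LINT z|lborel. indicator {a..b} z *\<^sub>R g k z)" .
qed

lemma h_has_vector_derivative: "(h k has_vector_derivative g k x) (at x)"
  by (rule ac_deriv_has_vector_derivative[OF ac_deriv_h g_continuous])

definition f :: "real \<Rightarrow> real \<Rightarrow> complex" where "f k x = cis (k * x) * h k x"
definition f1 :: "real \<Rightarrow> real \<Rightarrow> complex" where "f1 k x = \<i> * of_real k * f k x + cis (k * x) * g k x"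

lemma f_has_vector_derivative: "(f k has_vector_derivative f1 k x) (at x)"
  using has_vector_derivative_mult[OF cis_has_vector_derivative[of k x] h_has_vector_derivative[of k x]]
  by (simp add: f_def[abs_def] f1_def algebra_simps)

lemma f_continuous: "continuous_on UNIV (f k)"
  by (intro continuous_at_imp_continuous_on ballI has_vector_derivative_continuous[OF f_has_vector_derivative])

text \<open>In this form the derivative is built from absolutely continuous functions, so the
  product rule applies once more; \<open>V\<close> appears only when \<open>E\<close> is
  differentiated.\<close>

lemma f1_eq: "f1 k x = \<i> * of_real k * f k x - cis (- k * x) * E k x"
proof -
  have "cis (k * x) * cis (- (2 * k) * x) = cis (- k * x)" by (simp add: cis_mult)
  then show ?thesis unfolding f1_def g_def by (metis diff_conv_add_uminus mult.assoc mult_minus_right)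
qed

lemma f1_continuous: "continuous_on UNIV (f1 k)"
  unfolding f1_def[abs_def] by (intro continuous_intros f_continuous g_continuous)

lemma ac_deriv_f: "ac_deriv (f k) (f1 k)"
  by (rule ac_deriv_vector_derivative[OF f_has_vector_derivative f1_continuous])

lemma ac_deriv_f1: "ac_deriv (f1 k) (\<lambda>t. complex_of_real (V t - k\<^sup>2) * f k t)"
proof -
  have "ac_deriv (\<lambda>x. \<i> * of_real k * f k x - cis (- k * x) * E k x)
     (\<lambda>x. \<i> * of_real k * f1 k x - (\<i> * of_real (- k) * cis (- k * x) * E k x + cis (- k * x) * - (cis (2 * k * x) * q k x)))"
    by (intro ac_deriv_diff ac_deriv_cmult ac_deriv_f ac_deriv_mult ac_deriv_cis ac_deriv_E)
  moreover have "(\<lambda>x. \<i> * of_real k * f k x - cis (- k * x) * E k x) = f1 k"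
    by (rule ext) (rule f1_eq[symmetric])
  ultimately have "ac_deriv (f1 k) (\<lambda>x. \<i> * of_real k * f1 k x - (\<i> * of_real (- k) * cis (- k * x) * E k x + cis (- k * x) * - (cis (2 * k * x) * q k x)))"
    by (simp only:)
  then show ?thesis
  proof (rule ac_deriv_cong)
    fix x
    have "cis (- k * x) * - (cis (2 * k * x) * q k x) = - (cis (k * x) * q k x)"
      by (simp add: cis_mult flip: mult.assoc)
    also have "cis (k * x) * q k x = of_real (V x) * f k x" by (simp add: q_def f_def)
    finally have c: "cis (- k * x) * - (cis (2 * k * x) * q k x) = - (of_real (V x) * f k x)" .
    show "\<i> * of_real k * f1 k x - (\<i> * of_real (- k) * cis (- k * x) * E k x + cis (- k * x) * - (cis (2 * k * x) * q k x))
      = complex_of_real (V x - k\<^sup>2) * f k x"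
      unfolding c f1_eq by (simp add: algebra_simps power2_eq_square)
  qed
qed

lemma eta_tendsto_0: "(eta \<longlongrightarrow> 0) at_top"
  unfolding eta_def[abs_def] by (rule tail_integral_tendsto_0[OF integrable_abs[OF V_integrable]])

lemma g_tendsto_0: "(g k \<longlongrightarrow> 0) at_top"
proof (rule Lim_null_comparison)
  show "\<forall>\<^sub>F x in at_top. norm (g k x) \<le> hbound 0 * eta x"
    using eventually_ge_at_top[of 0] by eventually_elim (rule g_le)
  show "((\<lambda>x. hbound 0 * eta x) \<longlongrightarrow> 0) at_top"
    using tendsto_mult_left[OF eta_tendsto_0, of "hbound 0"] by simp
qed

lemma h_tendsto_1: "(h k \<longlongrightarrow> 1) at_top"
proof -
  have "((\<lambda>x. 1 - (LINT z|lborel. (if x < z then (if 0 < z then g k z else 0) else 0))) \<longlongrightarrow> 1 - 0) at_top"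
    by (intro tendsto_intros tail_integral_tendsto_0 g_tail(1))
  moreover have "\<forall>\<^sub>F x in at_top. 1 - (LINT z|lborel. (if x < z then (if 0 < z then g k z else 0) else 0)) = h k x"
    using eventually_ge_at_top[of 0]
  proof eventually_elim
    case (elim x)
    have "(LINT z|lborel. (if x < z then (if 0 < z then g k z else 0) else 0)) = (LINT z|lborel. (if x < z then g k z else 0))"
      using elim by (intro Bochner_Integration.integral_cong) auto
    then show ?case by (simp only: g_tail(2))
  qed
  ultimately show ?thesis using Lim_transform_eventually by fastforce
qed

lemma f_limit: "((\<lambda>x. f k x - cis (k * x)) \<longlongrightarrow> 0) at_top"
  and f1_limit: "((\<lambda>x. f1 k x - \<i> * of_real k * cis (k * x)) \<longlongrightarrow> 0) at_top"
proof -
  have l: "((\<lambda>x. h k x - 1) \<longlongrightarrow> 1 - 1) at_top" by (intro tendsto_intros h_tendsto_1)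
  have "norm (f k x - cis (k * x)) = norm (h k x - 1)" for x
  proof -
    have "f k x - cis (k * x) = cis (k * x) * (h k x - 1)" by (simp add: f_def algebra_simps)
    then show ?thesis by (simp add: norm_mult)
  qed
  then show "((\<lambda>x. f k x - cis (k * x)) \<longlongrightarrow> 0) at_top"
    using tendsto_norm[OF l] tendsto_norm_zero_iff[of "\<lambda>x. f k x - cis (k * x)"] by simp
  have l2: "((\<lambda>x. \<i> * of_real k * (h k x - 1) + g k x) \<longlongrightarrow> \<i> * of_real k * (1 - 1) + 0) at_top"
    by (intro tendsto_intros h_tendsto_1 g_tendsto_0)
  have "norm (f1 k x - \<i> * of_real k * cis (k * x)) = norm (\<i> * of_real k * (h k x - 1) + g k x)" for x
  proof -
    have "f1 k x - \<i> * of_real k * cis (k * x) = cis (k * x) * (\<i> * of_real k * (h k x - 1) + g k x)"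
      by (simp add: f1_def f_def algebra_simps)
    then show ?thesis by (simp add: norm_mult)
  qed
  then show "((\<lambda>x. f1 k x - \<i> * of_real k * cis (k * x)) \<longlongrightarrow> 0) at_top"
    using tendsto_norm[OF l2] tendsto_norm_zero_iff[of "\<lambda>x. f1 k x - \<i> * of_real k * cis (k * x)"] by simp
qed

lemma vector_derivative_f: "vector_derivative (f k) (at x) = f1 k x"
  by (rule vector_derivative_at[OF f_has_vector_derivative])

lemma jost_plus_cond_f: "jost_plus_cond V k (f k)"
proof -
  have e: "exp (\<i> * of_real k * of_real x) = cis (k * x)" for x by (simp add: cis_conv_exp mult_ac)
  show ?thesis
    unfolding jost_plus_cond_def ode_sol_iff e vector_derivative_f
    using f_has_vector_derivative ac_deriv_f1 f_limit f1_limit by blast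
qed

text \<open>The operator D^2 + k^2 is factored into two first-order ones: \<open>v\<close> = e^(ikx)
  (y' - iky) has derivative e^(ikx) V y, and \<open>u\<close> = e^(-ikx) y has derivative e^(-2ikx)
  v. Two integrations from infinity bound the norm of y(x) by the integral of (s - x) |V(s)| |y(s)|
  over s > x, and \<open>volterra_unique\<close> applies. No division by k occurs, so k = 0 is
  included.\<close>

lemma decaying_solution_zero:
  assumes y: "\<And>x. (y has_vector_derivative y' x) (at x)"
    and ac: "ac_deriv y' (\<lambda>t. complex_of_real (V t - k\<^sup>2) * y t)"
    and ly: "(y \<longlongrightarrow> 0) at_top" and ly': "(y' \<longlongrightarrow> 0) at_top"
  shows "y a = 0"
proof -
  have cy: "continuous_on UNIV y" by (intro continuous_at_imp_continuous_on ballI has_vector_derivative_continuous[OF y])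
  have cy': "continuous_on UNIV y'" by (rule ac_deriv_continuous[OF ac])
  have [measurable]: "y \<in> borel_measurable borel" by (rule borel_measurable_continuous_onI[OF cy])
  have acy: "ac_deriv y y'" by (rule ac_deriv_vector_derivative[OF y cy'])
  define v where "v x = cis (k * x) * (y' x - \<i> * of_real k * y x)" for x
  have acv: "ac_deriv v (\<lambda>x. cis (k * x) * (of_real (V x) * y x))"
  proof -
    have "ac_deriv v (\<lambda>x. \<i> * of_real k * cis (k * x) * (y' x - \<i> * of_real k * y x) +
        cis (k * x) * (complex_of_real (V x - k\<^sup>2) * y x - \<i> * of_real k * y' x))"
      unfolding v_def[abs_def] by (intro ac_deriv_mult ac_deriv_cis ac_deriv_diff ac ac_deriv_cmult acy)
    then show ?thesis by (rule ac_deriv_cong) (simp add: algebra_simps power2_eq_square)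
  qed
  have norm_v: "norm (v x) = norm (y' x - \<i> * of_real k * y x)" for x by (simp add: v_def norm_mult)
  have "((\<lambda>x. y' x - \<i> * of_real k * y x) \<longlongrightarrow> 0 - \<i> * of_real k * 0) at_top"
    by (intro tendsto_intros ly ly')
  then have lv: "(v \<longlongrightarrow> 0) at_top"
    using tendsto_norm_zero_iff[of v] tendsto_norm_zero_iff[of "\<lambda>x. y' x - \<i> * of_real k * y x"] unfolding norm_v by simp
  define u where "u x = cis (- k * x) * y x" for x
  have acu: "ac_deriv u (\<lambda>x. cis (- (2 * k) * x) * v x)"
  proof -
    have "ac_deriv u (\<lambda>x. \<i> * of_real (- k) * cis (- k * x) * y x + cis (- k * x) * y' x)"
      unfolding u_def[abs_def] by (intro ac_deriv_mult ac_deriv_cis acy)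
    then show ?thesis
    proof (rule ac_deriv_cong)
      fix x
      have "cis (- (2 * k) * x) * cis (k * x) = cis (- k * x)" by (simp add: cis_mult)
      then show "\<i> * of_real (- k) * cis (- k * x) * y x + cis (- k * x) * y' x = cis (- (2 * k) * x) * v x"
        unfolding v_def mult.assoc[symmetric] by (simp add: algebra_simps)
    qed
  qed
  have lu: "(u \<longlongrightarrow> 0) at_top"
    using ly tendsto_norm_zero_iff[of u] tendsto_norm_zero_iff[of y] by (simp add: u_def norm_mult)
  have vle: "ennreal (norm (v x)) \<le> (\<integral>\<^sup>+s. indicator {x..} s * ennreal (\<bar>V s\<bar> * norm (y s)) \<partial>lborel)" for x
    using ac_deriv_norm_le[OF acv lv, of x] by (simp add: norm_mult)
  \<comment> \<open>\<open>volterra_unique\<close> needs a finite bound on the half-line: the limit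
    0 covers large x, and compactness covers the rest.\<close>
  have "\<exists>C. \<forall>x\<ge>a. norm (y x) \<le> C"
  proof -
    obtain b where b: "\<And>x. x \<ge> b \<Longrightarrow> norm (y x) < 1"
      using tendstoD[OF ly, of 1] by (auto simp: eventually_at_top_linorder)
    have "compact (y ` {a..b})" by (intro compact_continuous_image continuous_on_subset[OF cy]) auto
    then obtain B where B: "\<And>t. t \<in> {a..b} \<Longrightarrow> norm (y t) \<le> B"
      by (metis compact_imp_bounded bounded_iff image_eqI)
    have "norm (y x) \<le> max 1 B" if "x \<ge> a" for x
      using b[of x] B[of x] that by (cases "x \<ge> b") auto
    then show ?thesis by blast
  qed
  then obtain C where C: "\<And>x. a \<le> x \<Longrightarrow> norm (y x) \<le> C" by blast
  let ?w = "\<lambda>s. ennreal ((s - a) * \<bar>V s\<bar>)"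
  have "ennreal (norm (y a)) = 0"
  proof (rule volterra_unique[where U="\<lambda>x. ennreal (norm (y x))" and w="?w" and a=a and C="ennreal C"])
    show "a \<le> x \<Longrightarrow> ennreal (norm (y x)) \<le> ennreal C" for x using C by (intro ennreal_leI)
    have "(\<integral>\<^sup>+s. indicator {a<..} s * ?w s \<partial>lborel) = (\<integral>\<^sup>+s. ennreal (if a < s then (s - a) * \<bar>V s\<bar> else 0) \<partial>lborel)"
      by (intro nn_integral_cong) (auto split: split_indicator)
    also have "\<dots> = ennreal (gam a)" unfolding gam_def by (rule nn_integral_eq_integral[OF V_linear]) auto
    finally show "(\<integral>\<^sup>+s. indicator {a<..} s * ?w s \<partial>lborel) < \<infinity>" by simp
    fix x assume x: "a \<le> x"
    have "ennreal (norm (y x)) = ennreal (norm (u x))" by (simp add: u_def norm_mult)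
    also have "\<dots> \<le> (\<integral>\<^sup>+z. indicator {x..} z * ennreal (norm (v z)) \<partial>lborel)"
      using ac_deriv_norm_le[OF acu lu, of x] by (simp add: norm_mult)
    also have "\<dots> \<le> (\<integral>\<^sup>+z. \<integral>\<^sup>+s. (if x \<le> z \<and> z \<le> s then ennreal (\<bar>V s\<bar> * norm (y s)) else 0) \<partial>lborel \<partial>lborel)"
    proof (rule nn_integral_mono)
      fix z
      show "indicator {x..} z * ennreal (norm (v z)) \<le> (\<integral>\<^sup>+s. (if x \<le> z \<and> z \<le> s then ennreal (\<bar>V s\<bar> * norm (y s)) else 0) \<partial>lborel)"
      proof (cases "x \<le> z")
        case True
        have "(\<integral>\<^sup>+s. indicator {z..} s * ennreal (\<bar>V s\<bar> * norm (y s)) \<partial>lborel) = (\<integral>\<^sup>+s. (if x \<le> z \<and> z \<le> s then ennreal (\<bar>V s\<bar> * norm (y s)) else 0) \<partial>lborel)"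
          using True by (intro nn_integral_cong) (auto split: split_indicator)
        then show ?thesis using vle[of z] True by simp
      qed auto
    qed
    also have "\<dots> = (\<integral>\<^sup>+s. \<integral>\<^sup>+z. (if x \<le> z \<and> z \<le> s then ennreal (\<bar>V s\<bar> * norm (y s)) else 0) \<partial>lborel \<partial>lborel)"
      by (rule lborel_pair.Fubini') measurable
    also have "\<dots> = (\<integral>\<^sup>+s. ennreal (\<bar>V s\<bar> * norm (y s)) * emeasure lborel {x..s} \<partial>lborel)"
      by (subst nn_integral_cmult_indicator[symmetric]) (auto intro!: nn_integral_cong split: split_indicator)
    also have "\<dots> \<le> (\<integral>\<^sup>+s. indicator {x<..} s * ?w s * ennreal (norm (y s)) \<partial>lborel)"
    proof (rule nn_integral_mono)
      fix s
      show "ennreal (\<bar>V s\<bar> * norm (y s)) * emeasure lborel {x..s} \<le> indicator {x<..} s * ?w s * ennreal (norm (y s))"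
      proof (cases "x < s")
        case True
        have "\<bar>V s\<bar> * norm (y s) * (s - x) \<le> (s - a) * \<bar>V s\<bar> * norm (y s)"
          using x mult_left_mono[of "s - x" "s - a" "\<bar>V s\<bar> * norm (y s)"] by (simp add: mult_ac)
        then show ?thesis using True x by (simp add: ennreal_mult[symmetric])
      qed (auto simp: not_less emeasure_lborel_Icc_eq)
    qed
    finally show "ennreal (norm (y x)) \<le> (\<integral>\<^sup>+s. indicator {x<..} s * ?w s * ennreal (norm (y s)) \<partial>lborel)" .
  qed auto
  then show ?thesis by simp
qed

lemma jost_plus_cond_unique:
  assumes "jost_plus_cond V k y"
  shows "y = f k"
proof
  fix a
  have e: "exp (\<i> * of_real k * of_real x) = cis (k * x)" for x by (simp add: cis_conv_exp mult_ac)
  obtain y' where y': "\<And>x. (y has_vector_derivative y' x) (at x)" "ac_deriv y' (\<lambda>t. complex_of_real (V t - k\<^sup>2) * y t)"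
    using assms unfolding jost_plus_cond_def ode_sol_iff by blast
  have ly: "((\<lambda>x. y x - cis (k * x)) \<longlongrightarrow> 0) at_top" "((\<lambda>x. y' x - \<i> * of_real k * cis (k * x)) \<longlongrightarrow> 0) at_top"
    using assms unfolding jost_plus_cond_def e vector_derivative_at[OF y'(1)] by blast+
  have "(\<lambda>x. y x - f k x) a = 0"
  proof (rule decaying_solution_zero)
    show "((\<lambda>x. y x - f k x) has_vector_derivative y' x - f1 k x) (at x)" for x
      by (intro has_vector_derivative_diff y' f_has_vector_derivative)
    show "ac_deriv (\<lambda>x. y' x - f1 k x) (\<lambda>t. complex_of_real (V t - k\<^sup>2) * (y t - f k t))"
      using ac_deriv_diff[OF y'(2) ac_deriv_f1] by (simp only: right_diff_distrib)
    show "((\<lambda>x. y x - f k x) \<longlongrightarrow> 0) at_top"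
      using tendsto_diff[OF ly(1) f_limit[of k]] by simp
    show "((\<lambda>x. y' x - f1 k x) \<longlongrightarrow> 0) at_top"
      using tendsto_diff[OF ly(2) f1_limit[of k]] by simp
  qed
  then show "y a = f k a" by simp
qed

lemma jost_plus_eq: "jost_plus V x k = f k x"
proof -
  have "(THE y. jost_plus_cond V k y) = f k"
    using jost_plus_cond_f jost_plus_cond_unique by (intro the_equality)
  then show ?thesis by (simp add: jost_plus_def)
qed

end

section \<open>Symmetries of the Jost solution\<close>

text \<open>Gluing to zero at the origin keeps absolute continuity because F(0) = 0. It turns a
  solution with vanishing Cauchy data into one that is zero near +infinity.\<close>

lemma ac_deriv_reflect_extend_zero:
  assumes F: "ac_deriv F u" and F0: "F 0 = 0"
  shows "ac_deriv (\<lambda>x. if x \<le> 0 then F (- x) else 0) (\<lambda>x. if x \<le> 0 then - u (- x) else 0)"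
  unfolding ac_deriv_def
proof (intro conjI allI impI)
  fix a b :: real
  have eq: "indicator {a..b} x *\<^sub>R (if x \<le> 0 then - u (- x) else 0) = - (indicator {max 0 (- b)..- a} (- x) *\<^sub>R u (- x))" for x
    by (auto simp: indicator_def)
  show "integrable lborel (\<lambda>x. indicator {a..b} x *\<^sub>R (if x \<le> 0 then - u (- x) else 0))"
    unfolding eq by (intro integrable_minus integrable_uminus_lborel[where f="\<lambda>x. indicator {max 0 (- b)..- a} x *\<^sub>R u x"] ac_derivD(1)[OF F])
  assume "a \<le> b"
  have "(LINT x|lborel. indicator {a..b} x *\<^sub>R (if x \<le> 0 then - u (- x) else 0)) = - (LINT x|lborel. indicator {max 0 (- b)..- a} x *\<^sub>R u x)"
    unfolding eq using integral_uminus_lborel[of "\<lambda>x. indicator {max 0 (- b)..- a} x *\<^sub>R u x"] by simp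
  also have "\<dots> = (if b \<le> 0 then F (- b) else 0) - (if a \<le> 0 then F (- a) else 0)"
  proof (cases "a \<le> 0")
    case True
    have "(LINT x|lborel. indicator {max 0 (- b)..- a} x *\<^sub>R u x) = F (- a) - F (max 0 (- b))"
      by (rule ac_derivD(2)[OF F, symmetric]) (use True \<open>a \<le> b\<close> in auto)
    then show ?thesis using True F0 by (auto simp: max_def)
  next
    case False
    then show ?thesis using \<open>a \<le> b\<close> by (simp add: max_def)
  qed
  finally show "(if b \<le> 0 then F (- b) else 0) - (if a \<le> 0 then F (- a) else 0) =
     (LINT x|lborel. indicator {a..b} x *\<^sub>R (if x \<le> 0 then - u (- x) else 0))" ..
qed

lemma L1_weighted_reflect: "L1_weighted n V \<Longrightarrow> L1_weighted n (\<lambda>x. V (- x))"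
  unfolding L1_weighted_def using integrable_uminus_lborel[of "\<lambda>x. (1 + \<bar>x\<bar>) ^ n * \<bar>V x\<bar>"] by auto

lemma ode_sol_reflect:
  assumes V: "L1_weighted 1 V" and y: "ode_sol V k y"
  shows "ode_sol (\<lambda>x. V (- x)) k (\<lambda>x. y (- x))"
proof -
  interpret V: jost V by standard fact
  interpret R: jost "\<lambda>x. V (- x)" by standard (rule L1_weighted_reflect[OF V])
  obtain y' where y': "\<And>x. (y has_vector_derivative y' x) (at x)" "ac_deriv y' (\<lambda>t. complex_of_real (V t - k\<^sup>2) * y t)"
    using y unfolding V.ode_sol_iff by blast
  have d: "((\<lambda>x. y (- x)) has_vector_derivative - y' (- x)) (at x)" for x
    by (rule has_vector_derivative_reflect[OF y'(1)])
  have "ac_deriv (\<lambda>x. - y' (- x)) (\<lambda>t. complex_of_real (V (- t) - k\<^sup>2) * y (- t))"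
    unfolding ac_deriv_def
  proof (intro conjI allI impI)
    fix a b :: real
    let ?u = "\<lambda>t. complex_of_real (V t - k\<^sup>2) * y t"
    have eq: "indicator {a..b} x *\<^sub>R ?u (- x) = indicator {- b..- a} (- x) *\<^sub>R ?u (- x)" for x
      by (auto simp: indicator_def)
    show "integrable lborel (\<lambda>x. indicator {a..b} x *\<^sub>R ?u (- x))"
      unfolding eq by (rule integrable_uminus_lborel[where f="\<lambda>x. indicator {- b..- a} x *\<^sub>R ?u x"], rule ac_derivD(1)[OF y'(2)])
    assume "a \<le> b"
    then have "y' (- a) - y' (- b) = (LINT x|lborel. indicator {- b..- a} x *\<^sub>R ?u x)"
      by (intro ac_derivD(2)[OF y'(2)]) simp
    also have "\<dots> = (LINT x|lborel. indicator {a..b} x *\<^sub>R ?u (- x))"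
      unfolding eq using integral_uminus_lborel[of "\<lambda>x. indicator {- b..- a} x *\<^sub>R ?u x"] by simp
    finally show "- y' (- b) - - y' (- a) = (LINT x|lborel. indicator {a..b} x *\<^sub>R ?u (- x))" by simp
  qed
  then show ?thesis unfolding R.ode_sol_iff using d by (intro exI[of _ "\<lambda>x. - y' (- x)"]) simp
qed

lemma vector_derivative_reflect:
  fixes y :: "real \<Rightarrow> complex"
  assumes "\<And>x. y differentiable (at x)"
  shows "vector_derivative (\<lambda>x. y (- x)) (at x) = - vector_derivative y (at (- x))"
proof (rule vector_derivative_at)
  show "((\<lambda>x. y (- x)) has_vector_derivative - vector_derivative y (at (- x))) (at x)"
    using assms by (intro has_vector_derivative_reflect) (simp add: vector_derivative_works)
qed

lemma ode_sol_differentiable: "ode_sol V k y \<Longrightarrow> y differentiable (at x)"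
  unfolding ode_sol_def by (blast intro: differentiableI_vector)

text \<open>Reflection exchanges the two ends of the line and flips the sign of the derivative, so
  everything proved at +infinity transfers to -infinity.\<close>

lemma jost_minus_cond_iff:
  assumes V: "L1_weighted 1 V"
  shows "jost_minus_cond V k y \<longleftrightarrow> jost_plus_cond (\<lambda>x. V (- x)) k (\<lambda>x. y (- x))"
proof -
  have ode: "ode_sol V k y \<longleftrightarrow> ode_sol (\<lambda>x. V (- x)) k (\<lambda>x. y (- x))"
    using ode_sol_reflect[OF V, of k y] ode_sol_reflect[OF L1_weighted_reflect[OF V], of k "\<lambda>x. y (- x)"] by auto
  show ?thesis
  proof (cases "ode_sol V k y")
    case True
    have "vector_derivative (\<lambda>x. y (- x)) (at x) = - vector_derivative y (at (- x))" for x
      by (rule vector_derivative_reflect[OF ode_sol_differentiable[OF True]])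
    moreover have "((\<lambda>x. - vector_derivative y (at (- x)) - \<i> * of_real k * exp (\<i> * of_real k * of_real x)) \<longlongrightarrow> 0) at_top
        \<longleftrightarrow> ((\<lambda>x. vector_derivative y (at (- x)) + \<i> * of_real k * exp (\<i> * of_real k * of_real x)) \<longlongrightarrow> 0) at_top"
      using tendsto_minus_cancel_left[of "\<lambda>x. vector_derivative y (at (- x)) + \<i> * of_real k * exp (\<i> * of_real k * of_real x)" 0 at_top]
      by (simp add: algebra_simps)
    ultimately show ?thesis
      using True ode unfolding jost_minus_cond_def jost_plus_cond_def
      by (simp add: filterlim_at_bot_mirror)
  next
    case False
    then show ?thesis using ode by (simp add: jost_minus_cond_def jost_plus_cond_def)
  qed
qed

section \<open>Reflection, complex conjugation and nonvanishing initial data\<close>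

context jost
begin

text \<open>Stated for the reflected potential on purpose: in the instance of the locale at V(-x)
  the double reflection returns \<open>V\<close>, and the left Jost solution of \<open>V\<close> is
  \<open>f\<close> of that instance.\<close>

lemma jost_minus_eq: "jost_minus (\<lambda>x. V (- x)) x k = f k (- x)"
proof -
  have "jost_minus_cond (\<lambda>x. V (- x)) k y \<longleftrightarrow> y = (\<lambda>x. f k (- x))" for y
  proof -
    have "jost_minus_cond (\<lambda>x. V (- x)) k y \<longleftrightarrow> jost_plus_cond V k (\<lambda>x. y (- x))"
      using jost_minus_cond_iff[OF L1_weighted_reflect[OF L1], of k y] by simp
    also have "\<dots> \<longleftrightarrow> (\<lambda>x. y (- x)) = f k" using jost_plus_cond_f jost_plus_cond_unique by metis
    also have "\<dots> \<longleftrightarrow> y = (\<lambda>x. f k (- x))" by (auto simp: fun_eq_iff) (metis minus_minus)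
    finally show ?thesis .
  qed
  then show ?thesis by (simp add: jost_minus_def)
qed

lemma g_minus: "g (- k) x = cnj (g k x)" and h_minus: "h (- k) x = cnj (h k x)"
proof -
  have h: "h (- k) x = cnj (h k x)" for x
  proof -
    have "(LINT t|lborel. cis (2 * - k * t) * of_real (K x t)) = (LINT t|lborel. cnj (cis (2 * k * t) * of_real (K x t)))"
      by (intro Bochner_Integration.integral_cong) (auto simp: cis_cnj)
    also have "\<dots> = cnj (LINT t|lborel. cis (2 * k * t) * of_real (K x t))" by (rule Bochner_Integration.integral_cnj)
    finally show ?thesis by (simp only: h_def complex_cnj_add complex_cnj_one)
  qed
  then show "h (- k) x = cnj (h k x)" .
  have "E (- k) x = cnj (E k x)"
  proof -
    have "E (- k) x = (LINT y|lborel. cnj (if x < y then cis (2 * k * y) * q k y else 0))"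
      unfolding E_def by (intro Bochner_Integration.integral_cong) (auto simp: q_def h cis_cnj)
    then show ?thesis unfolding E_def by (simp only: Bochner_Integration.integral_cnj)
  qed
  then show "g (- k) x = cnj (g k x)" by (simp add: g_def cis_cnj)
qed

lemma f_zero: "f 0 x = h 0 x" and f1_zero: "f1 0 x = g 0 x" and f_at_0: "f k 0 = h k 0"
  and f1_at_0: "f1 k 0 = \<i> * of_real k * h k 0 + g k 0"
  by (simp_all add: f_def f1_def)

text \<open>The Wronskian of f(k) and f(-k), its complex conjugate for real k, is constant. Its
  phases cancel, so h -> 1 and g -> 0 give the value -2ik at infinity, which is compared with the
  value at 0.\<close>

lemma wronskian_conjugate:
  "h k 0 * cnj (g k 0) - g k 0 * cnj (h k 0) = 2 * \<i> * of_real k * (h k 0 * cnj (h k 0) - 1)"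
proof -
  define w where "w x = f k x * f1 (- k) x - f1 k x * f (- k) x" for x
  have "ac_deriv w (\<lambda>x. (f1 k x * f1 (- k) x + f k x * (complex_of_real (V x - (- k)\<^sup>2) * f (- k) x)) -
      (complex_of_real (V x - k\<^sup>2) * f k x * f (- k) x + f1 k x * f1 (- k) x))"
    unfolding w_def[abs_def] by (intro ac_deriv_diff ac_deriv_mult ac_deriv_f ac_deriv_f1)
  then have "ac_deriv w (\<lambda>_. 0)" by (rule ac_deriv_cong) (simp add: algebra_simps)
  then have const: "w x = w 0" for x by (rule ac_deriv_zero_imp_const)
  have w: "w x = - 2 * \<i> * of_real k * (h k x * h (- k) x) + h k x * g (- k) x - g k x * h (- k) x" for x
  proof -
    have c: "cis (k * x) * cis (- k * x) = 1" by (simp add: cis_mult)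
    have "w x = (cis (k * x) * cis (- k * x)) * (- 2 * \<i> * of_real k * (h k x * h (- k) x) + h k x * g (- k) x - g k x * h (- k) x)"
      unfolding w_def f1_def f_def by (simp add: algebra_simps)
    then show ?thesis unfolding c by simp
  qed
  have "(w \<longlongrightarrow> - 2 * \<i> * of_real k * (1 * 1) + 1 * 0 - 0 * 1) at_top"
    unfolding w[abs_def] by (intro tendsto_intros h_tendsto_1 g_tendsto_0)
  moreover have "(w \<longlongrightarrow> w 0) at_top"
    using const by (subst tendsto_cong[of _ "\<lambda>_. w 0"]) auto
  ultimately have "w 0 = - 2 * \<i> * of_real k * (1 * 1) + 1 * 0 - 0 * 1"
    by (rule tendsto_unique[OF trivial_limit_at_top_linorder, rotated])
  then show ?thesis unfolding w by (simp add: h_minus g_minus algebra_simps)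
qed

text \<open>Uniqueness of the Cauchy problem is borrowed from uniqueness at infinity: with vanishing
  data at 0 the reflected solution, continued by zero, would solve the equation for V(-x) and decay,
  hence vanish, against h -> 1.\<close>

lemma initial_data_nonzero: "h 0 0 \<noteq> 0 \<or> g 0 0 \<noteq> 0"
proof (rule ccontr)
  assume "\<not> ?thesis"
  then have 0: "f 0 0 = 0" "f1 0 0 = 0" by (simp_all add: f_zero f1_zero)
  interpret R: jost "\<lambda>x. V (- x)" by standard (rule L1_weighted_reflect[OF L1])
  let ?z = "\<lambda>x. if x \<le> 0 then f 0 (- x) else 0"
  let ?z' = "\<lambda>x. if x \<le> 0 then - f1 0 (- x) else 0"
  have z: "ac_deriv ?z ?z'" by (rule ac_deriv_reflect_extend_zero[OF ac_deriv_f 0(1)])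
  have "ac_deriv (\<lambda>x. - 1 * (if x \<le> 0 then f1 0 (- x) else 0))
     (\<lambda>x. - 1 * (if x \<le> 0 then - (complex_of_real (V (- x) - 0\<^sup>2) * f 0 (- x)) else 0))"
    by (rule ac_deriv_cmult[OF ac_deriv_reflect_extend_zero[OF ac_deriv_f1 0(2)]])
  moreover have "(\<lambda>x. - 1 * (if x \<le> 0 then f1 0 (- x) else 0)) = ?z'" by auto
  ultimately have "ac_deriv ?z' (\<lambda>x. - 1 * (if x \<le> 0 then - (complex_of_real (V (- x) - 0\<^sup>2) * f 0 (- x)) else 0))" by simp
  then have z': "ac_deriv ?z' (\<lambda>x. complex_of_real (V (- x) - 0\<^sup>2) * ?z x)"
    by (rule ac_deriv_cong) auto
  have "?z a = 0" for a
  proof (rule R.decaying_solution_zero[OF _ z'])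
    show "(?z has_vector_derivative ?z' x) (at x)" for x
      by (rule ac_deriv_has_vector_derivative[OF z ac_deriv_continuous[OF z']])
    show "(?z \<longlongrightarrow> 0) at_top" "(?z' \<longlongrightarrow> 0) at_top"
      by (rule tendsto_eventually, rule eventually_mono[OF eventually_gt_at_top[of 0]], simp)+
  qed
  then have "h 0 x = 0" if "0 \<le> x" for x using that by (metis f_zero minus_minus neg_le_0_iff_le)
  then have "(h 0 \<longlongrightarrow> 0) at_top"
    by (intro tendsto_eventually eventually_mono[OF eventually_ge_at_top[of 0]]) auto
  then show False using h_tendsto_1[of 0] tendsto_unique[OF trivial_limit_at_top_linorder] by fastforce
qed

end

section \<open>Jost data at the origin as functions of the momentum\<close>

lemma wiener_smooth_superposition:
  fixes \<rho> :: "'a \<times> real \<Rightarrow> complex" and s :: "'a \<Rightarrow> real" and c :: real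
  assumes "sigma_finite_measure M" "s \<in> borel_measurable M" "c \<noteq> 0" "\<rho> \<in> borel_measurable (M \<Otimes>\<^sub>M lborel)"
    "integrable (M \<Otimes>\<^sub>M lborel) (\<lambda>z. (1 + \<bar>s (fst z) + c * snd z\<bar>) ^ j * norm (\<rho> z))"
  shows "wiener_smooth j 0 (\<lambda>k. \<integral>z. cis (k * (s (fst z) + c * snd z)) * \<rho> z \<partial>(M \<Otimes>\<^sub>M lborel))"
proof -
  obtain u where "u \<in> borel_measurable lborel" "integrable lborel (\<lambda>p. (1 + \<bar>p\<bar>) ^ j * norm (u p))"
    and u: "\<And>k. ft u k = (\<integral>z. cis (k * (s (fst z) + c * snd z)) * \<rho> z \<partial>(M \<Otimes>\<^sub>M lborel))"
    using ft_superposition[OF assms] by blast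
  then have "wiener_smooth j 0 (ft u)" by (intro wiener_smooth_weighted_ft)
  then show ?thesis unfolding u[abs_def] .
qed

lemma wiener_smooth_scaled_ft:
  assumes c: "c \<noteq> 0" and [measurable]: "\<rho> \<in> borel_measurable borel"
    and i: "integrable lborel (\<lambda>p. (1 + \<bar>c * p\<bar>) ^ j * norm (\<rho> p))"
  shows "wiener_smooth j 0 (\<lambda>k. LINT p|lborel. cis (k * (c * p)) * \<rho> p)"
proof -
  define u where "u p = \<rho> (p / c) / of_real \<bar>c\<bar>" for p
  have [measurable]: "u \<in> borel_measurable borel" unfolding u_def[abs_def] by measurable
  have "integrable lborel (\<lambda>p. (1 + \<bar>c * (0 + 1 / c * p)\<bar>) ^ j * norm (\<rho> (0 + 1 / c * p)))"
    using lborel_integrable_real_affine[OF i, of "1 / c" 0] c by simp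
  then have "integrable lborel (\<lambda>p. (1 + \<bar>p\<bar>) ^ j * norm (\<rho> (p / c)) / \<bar>c\<bar>)"
    using c by (intro integrable_divide) simp
  then have "wiener_smooth j 0 (ft u)"
    by (intro wiener_smooth_weighted_ft) (auto simp: u_def norm_divide)
  moreover have "ft u = (\<lambda>k. LINT p|lborel. cis (k * (c * p)) * \<rho> p)"
  proof
    fix k
    have "ft u k = \<bar>c\<bar> *\<^sub>R (LINT p|lborel. cis (k * (c * p)) * u (c * p))"
      unfolding ft_def using lborel_integral_real_affine[OF c, of "\<lambda>p. cis (k * p) * u p" 0] by simp
    also have "\<dots> = (LINT p|lborel. \<bar>c\<bar> *\<^sub>R (cis (k * (c * p)) * u (c * p)))" by (simp only: integral_scaleR_right)
    also have "\<dots> = (LINT p|lborel. cis (k * (c * p)) * \<rho> p)"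
      using c by (intro Bochner_Integration.integral_cong) (auto simp: u_def scaleR_conv_of_real)
    finally show "ft u k = (LINT p|lborel. cis (k * (c * p)) * \<rho> p)" .
  qed
  ultimately show ?thesis by simp
qed

lemma weight_add_le: "(1 + \<bar>a + b\<bar>) ^ j \<le> (1 + \<bar>a\<bar>) ^ j * (1 + \<bar>b :: real\<bar>) ^ j"
proof -
  have "1 + \<bar>a + b\<bar> \<le> (1 + \<bar>a\<bar>) * (1 + \<bar>b\<bar>)"
  proof -
    have "0 \<le> \<bar>a\<bar> * \<bar>b\<bar>" by simp
    moreover have "(1 + \<bar>a\<bar>) * (1 + \<bar>b\<bar>) = 1 + \<bar>a\<bar> + \<bar>b\<bar> + \<bar>a\<bar> * \<bar>b\<bar>" by (simp add: algebra_simps)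
    ultimately show ?thesis using abs_triangle_ineq[of a b] by linarith
  qed
  then have "(1 + \<bar>a + b\<bar>) ^ j \<le> ((1 + \<bar>a\<bar>) * (1 + \<bar>b\<bar>)) ^ j" by (intro power_mono) auto
  then show ?thesis by (simp only: power_mult_distrib)
qed

lemma weight_double_le: "(1 + \<bar>2 * a\<bar>) ^ j \<le> 2 ^ j * (1 + \<bar>a :: real\<bar>) ^ j"
proof -
  have "(1 + \<bar>2 * a\<bar>) ^ j \<le> (2 * (1 + \<bar>a\<bar>)) ^ j" by (intro power_mono) auto
  then show ?thesis by (simp only: power_mult_distrib)
qed

section \<open>Moment bounds for the kernel and the data at the origin\<close>

locale jost_weighted = jost +
  fixes j :: nat
  assumes L1j: "L1_weighted (j + 1) V"
begin

lemma V_weighted_Suc: "integrable lborel (\<lambda>y. (1 + \<bar>y\<bar>) ^ Suc j * \<bar>V y\<bar>)"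
  using L1j by (simp add: L1_weighted_def)

lemma V_weighted_j: "integrable lborel (\<lambda>y. (1 + \<bar>y\<bar>) ^ j * \<bar>V y\<bar>)"
proof (rule integrable_bounded_by[OF V_weighted_Suc])
  show "norm ((1 + \<bar>y\<bar>) ^ j * \<bar>V y\<bar>) \<le> (1 + \<bar>y\<bar>) ^ Suc j * \<bar>V y\<bar>" for y
  proof -
    have "1 * ((1 + \<bar>y\<bar>) ^ j * \<bar>V y\<bar>) \<le> (1 + \<bar>y\<bar>) * ((1 + \<bar>y\<bar>) ^ j * \<bar>V y\<bar>)" by (rule mult_right_mono) auto
    then show ?thesis by (simp add: abs_mult power_abs mult_ac)
  qed
qed measurable

text \<open>The single place where a moment is spent on the kernel: by Tonelli the weight (1 + t)^j
  integrated over 0 < t < y is at most (1 + y)^j y, so j + 1 moments of \<open>V\<close> give j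
  moments of its tail.\<close>

lemma eta_weighted: "integrable lborel (\<lambda>t. if 0 < t then (1 + \<bar>t\<bar>) ^ j * eta t else 0)"
proof (rule integrableI_nonneg)
  have "(\<integral>\<^sup>+t. ennreal (if 0 < t then (1 + \<bar>t\<bar>) ^ j * eta t else 0) \<partial>lborel) =
      (\<integral>\<^sup>+t. \<integral>\<^sup>+y. (if 0 < t \<and> t < y then ennreal ((1 + \<bar>t\<bar>) ^ j * \<bar>V y\<bar>) else 0) \<partial>lborel \<partial>lborel)"
  proof (rule nn_integral_cong)
    fix t :: real
    show "ennreal (if 0 < t then (1 + \<bar>t\<bar>) ^ j * eta t else 0) =
      (\<integral>\<^sup>+y. (if 0 < t \<and> t < y then ennreal ((1 + \<bar>t\<bar>) ^ j * \<bar>V y\<bar>) else 0) \<partial>lborel)"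
    proof (cases "0 < t")
      case True
      have "ennreal ((1 + \<bar>t\<bar>) ^ j * eta t) = ennreal ((1 + \<bar>t\<bar>) ^ j) * (\<integral>\<^sup>+y. ennreal (if t < y then \<bar>V y\<bar> else 0) \<partial>lborel)"
        unfolding eta_def by (subst nn_integral_eq_integral[OF V_tail_integrable]) (auto simp: ennreal_mult integral_nonneg_AE)
      also have "\<dots> = (\<integral>\<^sup>+y. (if 0 < t \<and> t < y then ennreal ((1 + \<bar>t\<bar>) ^ j * \<bar>V y\<bar>) else 0) \<partial>lborel)"
        using True by (subst nn_integral_cmult[symmetric]) (auto intro!: nn_integral_cong simp: ennreal_mult)
      finally show ?thesis using True by simp
    qed auto
  qed
  also have "\<dots> = (\<integral>\<^sup>+y. \<integral>\<^sup>+t. (if 0 < t \<and> t < y then ennreal ((1 + \<bar>t\<bar>) ^ j * \<bar>V y\<bar>) else 0) \<partial>lborel \<partial>lborel)"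
    by (rule lborel_pair.Fubini') measurable
  also have "\<dots> \<le> (\<integral>\<^sup>+y. \<integral>\<^sup>+t. ennreal ((1 + \<bar>y\<bar>) ^ j * \<bar>V y\<bar>) * indicator {0<..<y} t \<partial>lborel \<partial>lborel)"
    by (intro nn_integral_mono) (auto split: split_indicator intro!: ennreal_leI mult_right_mono power_mono)
  also have "\<dots> = (\<integral>\<^sup>+y. ennreal ((1 + \<bar>y\<bar>) ^ j * \<bar>V y\<bar>) * emeasure lborel {0<..<y} \<partial>lborel)"
    by (intro nn_integral_cong nn_integral_cmult_indicator) auto
  also have "\<dots> \<le> (\<integral>\<^sup>+y. ennreal (norm ((1 + \<bar>y\<bar>) ^ Suc j * \<bar>V y\<bar>)) \<partial>lborel)"
  proof (rule nn_integral_mono)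
    fix y :: real
    show "ennreal ((1 + \<bar>y\<bar>) ^ j * \<bar>V y\<bar>) * emeasure lborel {0<..<y} \<le> ennreal (norm ((1 + \<bar>y\<bar>) ^ Suc j * \<bar>V y\<bar>))"
    proof (cases "0 < y")
      case True
      have "(1 + \<bar>y\<bar>) ^ j * \<bar>V y\<bar> * y \<le> (1 + \<bar>y\<bar>) ^ j * \<bar>V y\<bar> * (1 + \<bar>y\<bar>)" by (intro mult_left_mono) auto
      also have "\<dots> = norm ((1 + \<bar>y\<bar>) ^ Suc j * \<bar>V y\<bar>)" by (simp add: abs_mult power_abs mult_ac)
      finally show ?thesis using True by (simp add: ennreal_mult[symmetric] ennreal_leI)
    qed auto
  qed
  also have "\<dots> < \<infinity>" using V_weighted_Suc by (simp add: integrable_iff_bounded)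
  finally show "(\<integral>\<^sup>+t. ennreal (if 0 < t then (1 + \<bar>t\<bar>) ^ j * eta t else 0) \<partial>lborel) < \<infinity>" .
qed (auto simp: eta_nonneg)

text \<open>The weight is taken at 2t, the frequency at which \<open>K\<close> enters
  \<open>h\<close>. The bound is uniform in y >= 0, so it survives integration against a density in
  y.\<close>

lemma K_weighted_le:
  assumes "0 \<le> y"
  shows "(1 + \<bar>2 * t\<bar>) ^ j * \<bar>K y t\<bar> \<le> 2 ^ j * exp (gam 0) * (if 0 < t then (1 + \<bar>t\<bar>) ^ j * eta t else 0)"
proof (cases "0 < t")
  case True
  have "\<bar>K y t\<bar> \<le> exp (gam 0) * eta (y + t)" by (rule K_le[OF assms])
  also have "\<dots> \<le> exp (gam 0) * eta t" using assms by (intro mult_left_mono eta_antimono) auto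
  finally have "(1 + \<bar>2 * t\<bar>) ^ j * \<bar>K y t\<bar> \<le> (2 ^ j * (1 + \<bar>t\<bar>) ^ j) * (exp (gam 0) * eta t)"
    by (intro mult_mono weight_double_le) auto
  then show ?thesis using True by (simp add: mult_ac)
qed (simp add: K_nonpos)

text \<open>Inserting the transform for h - 1 gives the density \<open>\<rho> x\<close>
  K(\<open>\<sigma> x\<close>, t) at the frequency s(x) + 2t. The weight is submultiplicative and
  the kernel bound depends on t alone, so the weighted double integral is dominated by a product of
  two finite integrals. The sign condition on \<open>\<sigma>\<close> is asked only on the support
  of \<open>\<rho>\<close>, since the densities below are cut off to a half-line.\<close>

lemma wiener_smooth_h_superposition:
  fixes \<rho> :: "'a \<Rightarrow> complex" and s \<sigma> :: "'a \<Rightarrow> real"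
  assumes M: "sigma_finite_measure M" and [measurable]: "s \<in> borel_measurable M" "\<sigma> \<in> borel_measurable M" "\<rho> \<in> borel_measurable M"
    and \<sigma>: "\<And>x. \<rho> x \<noteq> 0 \<Longrightarrow> 0 \<le> \<sigma> x"
    and i: "integrable M (\<lambda>x. (1 + \<bar>s x\<bar>) ^ j * norm (\<rho> x))"
  shows "wiener_smooth j 0 (\<lambda>k. \<integral>x. cis (k * s x) * (\<rho> x * (h k (\<sigma> x) - 1)) \<partial>M)"
proof -
  interpret M: sigma_finite_measure M by fact
  interpret P: pair_sigma_finite M lborel ..
  let ?e = "\<lambda>t. 2 ^ j * exp (gam 0) * (if 0 < t then (1 + \<bar>t\<bar>) ^ j * eta t else 0)"
  let ?r = "\<lambda>z. \<rho> (fst z) * of_real (K (\<sigma> (fst z)) (snd z))"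
  have ie: "integrable lborel ?e" by (intro integrable_mult_right eta_weighted)
  have bd: "norm ((1 + \<bar>s (fst z) + 2 * snd z\<bar>) ^ j * norm (?r z)) \<le> ((1 + \<bar>s (fst z)\<bar>) ^ j * norm (\<rho> (fst z))) * ?e (snd z)" for z
  proof (cases "\<rho> (fst z) = 0")
    case False
    have "(1 + \<bar>s (fst z) + 2 * snd z\<bar>) ^ j * norm (?r z) \<le> ((1 + \<bar>s (fst z)\<bar>) ^ j * (1 + \<bar>2 * snd z\<bar>) ^ j) * norm (?r z)"
      by (intro mult_right_mono weight_add_le) auto
    also have "\<dots> = ((1 + \<bar>s (fst z)\<bar>) ^ j * norm (\<rho> (fst z))) * ((1 + \<bar>2 * snd z\<bar>) ^ j * \<bar>K (\<sigma> (fst z)) (snd z)\<bar>)"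
      by (simp add: norm_mult mult_ac)
    also have "\<dots> \<le> ((1 + \<bar>s (fst z)\<bar>) ^ j * norm (\<rho> (fst z))) * ?e (snd z)"
      using \<sigma>[OF False] by (intro mult_left_mono K_weighted_le) auto
    finally show ?thesis by (simp add: abs_mult power_abs)
  qed auto
  have iw: "integrable (M \<Otimes>\<^sub>M lborel) (\<lambda>z. (1 + \<bar>s (fst z) + 2 * snd z\<bar>) ^ j * norm (?r z))"
    by (rule integrable_bounded_by[OF P.integrable_product_mult(1)[OF i ie] _ bd]) measurable
  have w1: "1 \<le> (1 + \<bar>a\<bar>) ^ j" for a :: real by simp
  have ir: "integrable (M \<Otimes>\<^sub>M lborel) ?r"
  proof (rule integrable_bounded_by[OF iw])
    show "norm (?r z) \<le> (1 + \<bar>s (fst z) + 2 * snd z\<bar>) ^ j * norm (?r z)" for z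
      using mult_right_mono[OF w1, of "norm (?r z)"] by simp
  qed measurable
  have "wiener_smooth j 0 (\<lambda>k. \<integral>z. cis (k * (s (fst z) + 2 * snd z)) * ?r z \<partial>(M \<Otimes>\<^sub>M lborel))"
    by (rule wiener_smooth_superposition[OF M _ _ _ iw]) auto
  moreover have "(\<integral>z. cis (k * (s (fst z) + 2 * snd z)) * ?r z \<partial>(M \<Otimes>\<^sub>M lborel)) = (\<integral>x. cis (k * s x) * (\<rho> x * (h k (\<sigma> x) - 1)) \<partial>M)" for k
  proof -
    have ic: "integrable (M \<Otimes>\<^sub>M lborel) (\<lambda>z. cis (k * (s (fst z) + 2 * snd z)) * ?r z)"
      using ir by (rule integrable_cis_mult) measurable
    have "(\<integral>z. cis (k * (s (fst z) + 2 * snd z)) * ?r z \<partial>(M \<Otimes>\<^sub>M lborel)) =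
        (\<integral>x. (LINT t|lborel. cis (k * (s x + 2 * t)) * (\<rho> x * of_real (K (\<sigma> x) t))) \<partial>M)"
      using P.integral_fst'[OF ic] by simp
    also have "\<dots> = (\<integral>x. cis (k * s x) * (\<rho> x * (h k (\<sigma> x) - 1)) \<partial>M)"
    proof (rule Bochner_Integration.integral_cong[OF refl])
      fix x
      have "(LINT t|lborel. cis (k * (s x + 2 * t)) * (\<rho> x * of_real (K (\<sigma> x) t)))
          = (LINT t|lborel. (cis (k * s x) * \<rho> x) * (cis (2 * k * t) * of_real (K (\<sigma> x) t)))"
      proof (rule Bochner_Integration.integral_cong[OF refl])
        fix t
        have c: "cis (k * (s x + 2 * t)) = cis (k * s x) * cis (2 * k * t)" by (simp add: cis_mult algebra_simps)
        show "cis (k * (s x + 2 * t)) * (\<rho> x * of_real (K (\<sigma> x) t)) = (cis (k * s x) * \<rho> x) * (cis (2 * k * t) * of_real (K (\<sigma> x) t))"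
          unfolding c by (simp only: mult_ac)
      qed
      also have "\<dots> = cis (k * s x) * (\<rho> x * (h k (\<sigma> x) - 1))"
        unfolding integral_mult_right_zero by (simp add: h_def)
      finally show "(LINT t|lborel. cis (k * (s x + 2 * t)) * (\<rho> x * of_real (K (\<sigma> x) t))) = cis (k * s x) * (\<rho> x * (h k (\<sigma> x) - 1))" .
    qed
    finally show ?thesis .
  qed
  ultimately show ?thesis by simp
qed

lemma wiener_smooth_h0: "wiener_smooth j 1 (\<lambda>k. h k 0)"
proof -
  have "wiener_smooth j 0 (\<lambda>k. LINT t|lborel. cis (k * (2 * t)) * complex_of_real (K 0 t))"
  proof (rule wiener_smooth_scaled_ft)
    show "integrable lborel (\<lambda>t. (1 + \<bar>2 * t\<bar>) ^ j * norm (complex_of_real (K 0 t)))"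
    proof (rule integrable_bounded_by[OF integrable_mult_right[OF eta_weighted, of "2 ^ j * exp (gam 0)"]])
      show "norm ((1 + \<bar>2 * t\<bar>) ^ j * norm (complex_of_real (K 0 t))) \<le> 2 ^ j * exp (gam 0) * (if 0 < t then (1 + \<bar>t\<bar>) ^ j * eta t else 0)" for t
        using K_weighted_le[of 0 t] by (simp add: abs_mult power_abs)
    qed measurable
  qed auto
  from wiener_smooth_add[OF wiener_smooth_const[of j 1] this]
  show ?thesis by (simp add: h_def mult_ac)
qed

text \<open>Up to sign, g(k, 0) is the transform of V h on the positive half-line at the frequency
  2y. Writing h = 1 + (h - 1) leaves a plain transform of \<open>V\<close> and a term covered by
  \<open>wiener_smooth_h_superposition\<close>.\<close>

lemma wiener_smooth_g0: "wiener_smooth j 0 (\<lambda>k. g k 0)"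
proof -
  let ?\<rho> = "\<lambda>y. complex_of_real (if 0 < y then V y else 0)"
  have i: "integrable lborel (\<lambda>y. (1 + \<bar>2 * y\<bar>) ^ j * norm (?\<rho> y))"
  proof (rule integrable_bounded_by[OF integrable_mult_right[OF V_weighted_j, of "2 ^ j"]])
    show "norm ((1 + \<bar>2 * y\<bar>) ^ j * norm (?\<rho> y)) \<le> 2 ^ j * ((1 + \<bar>y\<bar>) ^ j * \<bar>V y\<bar>)" for y
      using mult_right_mono[OF weight_double_le[of y j], of "\<bar>V y\<bar>"] by (auto simp: abs_mult power_abs mult.assoc)
  qed measurable
  have iA: "integrable lborel (\<lambda>y. cis (k * (2 * y)) * ?\<rho> y)" for k
    by (rule integrable_bounded_by[OF integrable_abs[OF V_integrable]]) (auto simp: norm_mult)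
  have iq: "integrable lborel (\<lambda>y. cis (k * (2 * y)) * ?\<rho> y * h k y)" for k
  proof -
    have "integrable lborel (\<lambda>y. if 0 < y then cis (2 * k * y) * q k y else 0)" by (rule q_tail_integrable) measurable
    then show ?thesis by (rule Bochner_Integration.integrable_cong[THEN iffD1, rotated 2]) (auto simp: q_def mult_ac)
  qed
  have A: "wiener_smooth j 0 (\<lambda>k. LINT y|lborel. cis (k * (2 * y)) * ?\<rho> y)"
    by (rule wiener_smooth_scaled_ft[OF _ _ i]) auto
  have B: "wiener_smooth j 0 (\<lambda>k. LINT y|lborel. cis (k * (2 * y)) * (?\<rho> y * (h k y - 1)))"
    by (rule wiener_smooth_h_superposition[OF lborel.sigma_finite_measure_axioms _ _ _ _ i]) (auto split: if_splits)
  have "g k 0 = - 1 * ((LINT y|lborel. cis (k * (2 * y)) * ?\<rho> y) + (LINT y|lborel. cis (k * (2 * y)) * (?\<rho> y * (h k y - 1))))" for k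
  proof -
    have "integrable lborel (\<lambda>y. cis (k * (2 * y)) * (?\<rho> y * (h k y - 1)))"
      using Bochner_Integration.integrable_diff[OF iq[of k] iA[of k]] by (simp add: algebra_simps)
    from Bochner_Integration.integral_add[OF iA[of k] this, symmetric]
    have "(LINT y|lborel. cis (k * (2 * y)) * ?\<rho> y) + (LINT y|lborel. cis (k * (2 * y)) * (?\<rho> y * (h k y - 1))) =
       (LINT y|lborel. (if 0 < y then cis (2 * k * (y - 0)) * q k y else 0))"
      by (auto intro!: Bochner_Integration.integral_cong simp: q_def algebra_simps)
    then show ?thesis unfolding g_eq by simp
  qed
  then show ?thesis using wiener_smooth_cmult[OF wiener_smooth_add[OF A B], of "- 1"] by simp
qed

text \<open>This is the integral over y > 0 of e^(iky) times the y-derivative of h(0, y) h(k, y).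
  The two terms of the product rule are kept apart because their densities are treated
  differently.\<close>

definition Psi :: "real \<Rightarrow> complex" where
  "Psi k = (LINT y|lborel. (if 0 < y then g 0 y * (cis (k * y) * h k y) else 0)) +
     (LINT y|lborel. (if 0 < y then h 0 y * (cis (k * y) * g k y) else 0))"

lemma hbound_pos: "0 < hbound a"
  unfolding hbound_def by (intro add_pos_nonneg) (auto simp: gam_nonneg)

lemma Psi1_integrable: "integrable lborel (\<lambda>y. if 0 < y then g 0 y * (cis (k * y) * h k y) else 0)"
  and Psi2_integrable: "integrable lborel (\<lambda>y. if 0 < y then h 0 y * (cis (k * y) * g k y) else 0)"
proof -
  have *: "norm (if 0 < y then g k y * (cis (l * y) * h m y) else 0) \<le> hbound 0 * (if 0 < y then norm (g k y) else 0)" for k l m y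
  proof (cases "0 < y")
    case True
    then show ?thesis using mult_left_mono[OF h_le[of 0 y m], of "norm (g k y)"] by (simp add: norm_mult mult_ac)
  qed auto
  have i: "integrable lborel (\<lambda>y. hbound 0 * (if 0 < y then norm (g k y) else 0))" for k
  proof (rule integrable_mult_right)
    show "integrable lborel (\<lambda>y. if 0 < y then norm (g k y) else 0)"
      by (rule integrable_bounded_by[OF integrable_norm[OF g_tail(1)[of 0 k]]]) auto
  qed
  show "integrable lborel (\<lambda>y. if 0 < y then g 0 y * (cis (k * y) * h k y) else 0)"
    by (rule integrable_bounded_by[OF i _ *]) measurable
  have "integrable lborel (\<lambda>y. if 0 < y then g k y * (cis (k * y) * h 0 y) else 0)"
    by (rule integrable_bounded_by[OF i _ *]) measurable
  then show "integrable lborel (\<lambda>y. if 0 < y then h 0 y * (cis (k * y) * g k y) else 0)"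
    by (rule Bochner_Integration.integrable_cong[THEN iffD1, rotated 2]) (auto simp: mult_ac)
qed

text \<open>The density g(0, y) is bounded by a multiple of the tail \<open>eta y\<close> and
  therefore has j moments at the frequency y; h(k, y) is again split as 1 + (h - 1).\<close>

lemma wiener_smooth_Psi1:
  "wiener_smooth j 0 (\<lambda>k. LINT y|lborel. (if 0 < y then g 0 y * (cis (k * y) * h k y) else 0))"
proof -
  let ?\<rho> = "\<lambda>y. if 0 < y then g 0 y else 0"
  have i: "integrable lborel (\<lambda>y. (1 + \<bar>y\<bar>) ^ j * norm (?\<rho> y))"
  proof (rule integrable_bounded_by[OF integrable_mult_right[OF eta_weighted, of "hbound 0"]])
    show "norm ((1 + \<bar>y\<bar>) ^ j * norm (?\<rho> y)) \<le> hbound 0 * (if 0 < y then (1 + \<bar>y\<bar>) ^ j * eta y else 0)" for y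
      using mult_left_mono[OF g_le[of 0 y 0], of "(1 + \<bar>y\<bar>) ^ j"] by (auto simp: abs_mult power_abs mult_ac)
  qed measurable
  have i0: "integrable lborel ?\<rho>" by (rule g_tail(1))
  have iA: "integrable lborel (\<lambda>y. cis (k * (1 * y)) * ?\<rho> y)" for k
    by (rule integrable_cis_mult[OF i0]) measurable
  have A: "wiener_smooth j 0 (\<lambda>k. LINT y|lborel. cis (k * (1 * y)) * ?\<rho> y)"
    by (rule wiener_smooth_scaled_ft) (use i in auto)
  have B: "wiener_smooth j 0 (\<lambda>k. LINT y|lborel. cis (k * y) * (?\<rho> y * (h k y - 1)))"
    by (rule wiener_smooth_h_superposition[OF lborel.sigma_finite_measure_axioms _ _ _ _ i]) (auto split: if_splits)
  have "(LINT y|lborel. (if 0 < y then g 0 y * (cis (k * y) * h k y) else 0)) =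
      (LINT y|lborel. cis (k * (1 * y)) * ?\<rho> y) + (LINT y|lborel. cis (k * y) * (?\<rho> y * (h k y - 1)))" for k
  proof -
    have "integrable lborel (\<lambda>y. (if 0 < y then g 0 y * (cis (k * y) * h k y) else 0) - cis (k * (1 * y)) * ?\<rho> y)"
      by (rule Bochner_Integration.integrable_diff[OF Psi1_integrable iA])
    then have "integrable lborel (\<lambda>y. cis (k * y) * (?\<rho> y * (h k y - 1)))"
      by (rule Bochner_Integration.integrable_cong[THEN iffD1, rotated 2]) (auto simp: algebra_simps)
    from Bochner_Integration.integral_add[OF iA[of k] this]
    show ?thesis
      by (rule trans[rotated]) (auto intro!: Bochner_Integration.integral_cong simp: algebra_simps)
  qed
  then show ?thesis using wiener_smooth_add[OF A B] by simp
qed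

text \<open>With \<open>p\<close> = (s, y) and 0 < y < s the frequency 2s - y lies between 0 and 2s,
  so the weight is at most 2^j (1 + s)^j. The slice in y has length s, which uses the last of the j
  + 1 moments of \<open>V\<close>.\<close>

lemma wedge_weighted:
  "integrable (lborel \<Otimes>\<^sub>M lborel) (\<lambda>p. (1 + \<bar>2 * fst p - snd p\<bar>) ^ j * norm (if 0 < snd p \<and> snd p < fst p then h 0 (snd p) * of_real (V (fst p)) else 0))"
proof -
  let ?q = "\<lambda>y. hbound 0 * (2 ^ j * ((1 + \<bar>y\<bar>) ^ j * \<bar>V y\<bar>))"
  have "integrable (lborel \<Otimes>\<^sub>M lborel) (\<lambda>p. if 0 < snd p \<and> snd p < fst p then norm (?q (fst p)) else 0)"
  proof (rule integrable_wedge)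
    show "integrable lborel (\<lambda>y. if 0 < y then (y - 0) * norm (?q y) else 0)"
    proof (rule integrable_bounded_by[OF integrable_mult_right[OF V_weighted_Suc, of "hbound 0 * 2 ^ j"]])
      fix y :: real
      show "norm (if 0 < y then (y - 0) * norm (?q y) else 0) \<le> hbound 0 * 2 ^ j * ((1 + \<bar>y\<bar>) ^ Suc j * \<bar>V y\<bar>)"
      proof (cases "0 < y")
        case True
        have "y * (hbound 0 * 2 ^ j * ((1 + \<bar>y\<bar>) ^ j * \<bar>V y\<bar>)) \<le> (1 + \<bar>y\<bar>) * (hbound 0 * 2 ^ j * ((1 + \<bar>y\<bar>) ^ j * \<bar>V y\<bar>))"
          using hbound_pos[of 0] by (intro mult_right_mono) auto
        then show ?thesis using True hbound_pos[of 0] by (simp add: abs_mult power_abs mult_ac)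
      next
        case False
        then show ?thesis using hbound_pos[of 0] by simp
      qed
    qed measurable
  qed measurable
  then show ?thesis
  proof (rule integrable_bounded_by)
    fix p :: "real \<times> real"
    show "norm ((1 + \<bar>2 * fst p - snd p\<bar>) ^ j * norm (if 0 < snd p \<and> snd p < fst p then h 0 (snd p) * complex_of_real (V (fst p)) else 0))
       \<le> (if 0 < snd p \<and> snd p < fst p then norm (?q (fst p)) else 0)"
    proof (cases "0 < snd p \<and> snd p < fst p")
      case True
      have "(1 + \<bar>2 * fst p - snd p\<bar>) ^ j \<le> (1 + \<bar>2 * fst p\<bar>) ^ j" using True by (intro power_mono) auto
      also have "\<dots> \<le> 2 ^ j * (1 + \<bar>fst p\<bar>) ^ j" by (rule weight_double_le)
      finally have "(1 + \<bar>2 * fst p - snd p\<bar>) ^ j * (norm (h 0 (snd p)) * \<bar>V (fst p)\<bar>) \<le> (2 ^ j * (1 + \<bar>fst p\<bar>) ^ j) * (hbound 0 * \<bar>V (fst p)\<bar>)"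
        using True hbound_pos[of 0] by (intro mult_mono mult_right_mono h_le mult_nonneg_nonneg) auto
      then show ?thesis using True hbound_pos[of 0] by (simp add: norm_mult abs_mult power_abs mult_ac)
    qed auto
  qed measurable
qed

text \<open>The factor g(k, y) is itself an integral over s > y with phase e^(2ik(s-y)); together
  with e^(iky) this gives the frequency 2s - y on the wedge 0 < y < s. Splitting h(k, s) as 1 + (h -
  1) reduces to the two superposition lemmas, the second with the plane as outer space.\<close>

lemma wiener_smooth_Psi2:
  "wiener_smooth j 0 (\<lambda>k. LINT y|lborel. (if 0 < y then h 0 y * (cis (k * y) * g k y) else 0))"
proof -
  let ?\<rho> = "\<lambda>p. if 0 < snd p \<and> snd p < fst p then h 0 (snd p) * of_real (V (fst p)) else 0 :: complex"
  let ?L = "lborel \<Otimes>\<^sub>M lborel :: (real \<times> real) measure"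
  have i: "integrable ?L (\<lambda>p. (1 + \<bar>2 * fst p + - 1 * snd p\<bar>) ^ j * norm (?\<rho> p))" using wedge_weighted by simp
  have i': "integrable ?L ?\<rho>"
  proof (rule integrable_bounded_by[OF i])
    show "norm (?\<rho> p) \<le> (1 + \<bar>2 * fst p + - 1 * snd p\<bar>) ^ j * norm (?\<rho> p)" for p
      using mult_right_mono[of 1 "(1 + \<bar>2 * fst p + - 1 * snd p\<bar>) ^ j" "norm (?\<rho> p)"] by simp
  qed measurable
  have A: "wiener_smooth j 0 (\<lambda>k. \<integral>p. cis (k * (2 * fst p + - 1 * snd p)) * ?\<rho> p \<partial>?L)"
    by (rule wiener_smooth_superposition[where s="\<lambda>y. 2 * y", OF lborel.sigma_finite_measure_axioms _ _ _ i]) auto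
  have B: "wiener_smooth j 0 (\<lambda>k. \<integral>p. cis (k * (2 * fst p + - 1 * snd p)) * (?\<rho> p * (h k (fst p) - 1)) \<partial>?L)"
    by (rule wiener_smooth_h_superposition[OF _ _ _ _ _ i])
      (auto split: if_splits intro: lborel_pair.P.sigma_finite_measure_axioms)
  have eq: "(LINT y|lborel. (if 0 < y then h 0 y * (cis (k * y) * g k y) else 0)) =
     - 1 * ((\<integral>p. cis (k * (2 * fst p + - 1 * snd p)) * ?\<rho> p \<partial>?L) +
       (\<integral>p. cis (k * (2 * fst p + - 1 * snd p)) * (?\<rho> p * (h k (fst p) - 1)) \<partial>?L))" for k
  proof -
    let ?c = "\<lambda>p::real\<times>real. cis (k * (2 * fst p + - 1 * snd p))"
    have ih: "integrable ?L (\<lambda>p. ?\<rho> p * h k (fst p))"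
    proof (rule integrable_bounded_by[OF integrable_mult_right[OF integrable_norm[OF i'], of "hbound 0"]])
      show "norm (?\<rho> p * h k (fst p)) \<le> hbound 0 * norm (?\<rho> p)" for p
      proof (cases "0 < snd p \<and> snd p < fst p")
        case True
        then have "norm (?\<rho> p) * norm (h k (fst p)) \<le> norm (?\<rho> p) * hbound 0" by (intro mult_left_mono h_le) auto
        then show ?thesis by (simp only: norm_mult mult.commute)
      qed auto
    qed measurable
    have i1: "integrable ?L (\<lambda>p. ?c p * ?\<rho> p)" by (rule integrable_cis_mult[OF i']) measurable
    have i2: "integrable ?L (\<lambda>p. ?c p * (?\<rho> p * h k (fst p)))" by (rule integrable_cis_mult[OF ih]) measurable
    have i3: "integrable ?L (\<lambda>p. ?c p * (?\<rho> p * (h k (fst p) - 1)))"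
      using Bochner_Integration.integrable_diff[OF i2 i1] by (simp only: right_diff_distrib mult_1_right)
    have "(\<integral>p. ?c p * ?\<rho> p \<partial>?L) + (\<integral>p. ?c p * (?\<rho> p * (h k (fst p) - 1)) \<partial>?L) = (\<integral>p. ?c p * (?\<rho> p * h k (fst p)) \<partial>?L)"
      by (subst Bochner_Integration.integral_add[OF i1 i3, symmetric])
        (simp only: right_diff_distrib mult_1_right add_diff_eq add_diff_cancel_left')
    also have "\<dots> = (LINT y|lborel. LINT s|lborel. ?c (s, y) * (?\<rho> (s, y) * h k s))"
      using lborel_pair.integral_snd[of "\<lambda>s y. ?c (s, y) * (?\<rho> (s, y) * h k s)"] i2 by (simp add: case_prod_beta' cong: if_cong)
    also have "\<dots> = (LINT y|lborel. - 1 * (if 0 < y then h 0 y * (cis (k * y) * g k y) else 0))"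
    proof (rule Bochner_Integration.integral_cong[OF refl])
      fix y
      show "(LINT s|lborel. ?c (s, y) * (?\<rho> (s, y) * h k s)) = - 1 * (if 0 < y then h 0 y * (cis (k * y) * g k y) else 0)"
      proof (cases "0 < y")
        case True
        have "(LINT s|lborel. ?c (s, y) * (?\<rho> (s, y) * h k s)) =
            (LINT s|lborel. (h 0 y * cis (k * y)) * (if y < s then cis (2 * k * (s - y)) * q k s else 0))"
        proof (rule Bochner_Integration.integral_cong[OF refl])
          fix s
          have c: "?c (s, y) = cis (k * y) * cis (2 * k * (s - y))" by (simp add: cis_mult algebra_simps)
          show "?c (s, y) * (?\<rho> (s, y) * h k s) = (h 0 y * cis (k * y)) * (if y < s then cis (2 * k * (s - y)) * q k s else 0)"
            unfolding c q_def using True by simp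
        qed
        also have "\<dots> = - 1 * (h 0 y * (cis (k * y) * g k y))"
          unfolding integral_mult_right_zero g_eq by simp
        finally show ?thesis using True by simp
      qed simp
    qed
    finally show ?thesis by (simp only: integral_mult_right_zero) simp
  qed
  show ?thesis unfolding eq using wiener_smooth_cmult[OF wiener_smooth_add[OF A B], of "- 1"] by simp
qed

lemma wiener_smooth_Psi: "wiener_smooth j 0 Psi"
  using wiener_smooth_add[OF wiener_smooth_Psi1 wiener_smooth_Psi2] by (simp add: Psi_def[abs_def])

end

section \<open>Scattering coefficients\<close>

lemma wiener_smooth_divide: "wiener_smooth j c f \<Longrightarrow> wiener_smooth j (c / a) (\<lambda>k. f k / a)"
  using wiener_smooth_cmult[of j c f "1 / a"] by simp

text \<open>Here a, c and b, d are the values h, g at the origin of the two Jost solutions, and the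
  hypotheses are their conjugate Wronskians. Divided by the square of the first norm, where nonzero,
  the conclusion reads |T|^2 + |R|^2 = 1. The proof is an expansion in which the hypotheses
  eliminate \<open>s\<close> and \<open>t\<close>.\<close>

lemma transition_determinant:
  fixes a b c d :: complex and k :: real
  assumes "a * cnj c - c * cnj a = 2 * \<i> * of_real k * (a * cnj a - 1)"
    and "b * cnj d - d * cnj b = 2 * \<i> * of_real k * (b * cnj b - 1)"
  shows "(norm (2 * \<i> * of_real k * a * b + a * d + c * b))\<^sup>2 = 4 * k\<^sup>2 + (norm (a * cnj d + c * cnj b))\<^sup>2"
proof -
  let ?W = "2 * \<i> * of_real k * a * b + a * d + c * b" and ?X = "a * cnj d + c * cnj b"
  define s t A B where "s = a * cnj c - c * cnj a" and "t = b * cnj d - d * cnj b" and "A = a * cnj a" and "B = b * cnj b"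
  have "?W * cnj ?W - ?X * cnj ?X = 4 * (of_real k)\<^sup>2 * A * B + 2 * \<i> * of_real k * A * t + 2 * \<i> * of_real k * B * s - s * t"
    unfolding s_def t_def A_def B_def by (simp add: algebra_simps power2_eq_square)
  also have "\<dots> = 4 * (of_real k)\<^sup>2"
  proof -
    have s: "s = 2 * \<i> * of_real k * (A - 1)" and t: "t = 2 * \<i> * of_real k * (B - 1)"
      using assms by (simp_all only: s_def t_def A_def B_def)
    show ?thesis unfolding s t by (simp add: algebra_simps power2_eq_square)
  qed
  finally have "?W * cnj ?W = 4 * (of_real k)\<^sup>2 + ?X * cnj ?X" by (simp add: algebra_simps)
  then have "complex_of_real ((norm ?W)\<^sup>2) = of_real (4 * k\<^sup>2 + (norm ?X)\<^sup>2)"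
    unfolding of_real_add complex_norm_square by simp
  then show ?thesis by (simp only: of_real_eq_iff)
qed

text \<open>The lower bound for W gives a norm of at least 1 for \<open>Q\<close> off the origin,
  and continuity extends this to k = 0. So \<open>Q\<close> has no zero there although W does, and
  Wiener's lemma applies to \<open>Q\<close>.\<close>

lemma resonant_quotients:
  assumes Q: "wiener_smooth j 1 Q" and Y: "wiener_smooth j 0 Y"
    and W: "\<And>k. W k = 2 * \<i> * of_real k * Q k" and X: "\<And>k. X k = \<i> * of_real k * Y k"
    and lower: "\<And>k. 2 * \<bar>k\<bar> \<le> norm (W k)"
  shows "\<exists>T R. wiener_smooth j 1 T \<and> wiener_smooth j 0 R \<and>
    (\<forall>k. k \<noteq> 0 \<longrightarrow> T k = 2 * \<i> * of_real k / W k \<and> R k = X k / W k)"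
proof -
  have Q1: "1 \<le> norm (Q k)" if "k \<noteq> 0" for k
    using lower[of k] that unfolding W by (simp add: norm_mult)
  have "isCont Q 0" using wiener_smooth_continuous[OF Q] by (simp add: continuous_on_eq_continuous_at)
  then have "((\<lambda>k. norm (Q k)) \<longlongrightarrow> norm (Q 0)) (at 0)" by (intro tendsto_norm) (simp add: isCont_def)
  then have "1 \<le> norm (Q 0)"
    by (rule tendsto_lowerbound) (auto simp: eventually_at_filter Q1)
  then have nz: "Q k \<noteq> 0" for k using Q1[of k] by (cases "k = 0") auto
  have iQ: "wiener_smooth j 1 (\<lambda>k. inverse (Q k))" using wiener_smooth_inverse[OF _ nz Q] by simp
  have R: "wiener_smooth j 0 (\<lambda>k. (Y k / 2) * inverse (Q k))"
    using wiener_smooth_mult[OF wiener_smooth_divide[OF Y, of 2] iQ] by simp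
  show ?thesis
    by (intro exI[of _ "\<lambda>k. inverse (Q k)"] exI[of _ "\<lambda>k. (Y k / 2) * inverse (Q k)"] conjI iQ R allI impI)
      (auto simp: W X nz field_simps)
qed

lemma nonresonant_quotients:
  assumes F: "wiener_smooth j 1 F" and U: "wiener_smooth j 0 U" and X: "wiener_smooth j 0 X"
    and W: "\<And>k. W k = 2 * \<i> * of_real k * F k + U k" and nz: "\<And>k. W k \<noteq> 0"
  shows "\<exists>T R. wiener_smooth j 1 T \<and> wiener_smooth j 0 R \<and>
    (\<forall>k. k \<noteq> 0 \<longrightarrow> T k = 2 * \<i> * of_real k / W k \<and> R k = X k / W k)"
proof -
  define D where "D k = 1 / (1 - \<i> * complex_of_real k)" for k
  have D: "wiener_smooth j 0 D" unfolding D_def[abs_def] by (rule wiener_smooth_resolvent)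
  have z: "1 - \<i> * complex_of_real k \<noteq> 0" for k by (auto simp: complex_eq_iff)
  have Dnz: "D k \<noteq> 0" for k using z by (simp add: D_def)
  \<comment> \<open>The product of ik with the resolvent is -1 plus an element of the algebra. This
    gives W D / 2 the value -1 at infinity, so that it can be inverted.\<close>
  have kD: "\<i> * of_real k * D k = - 1 + D k" for k using z[of k] by (simp add: D_def field_simps)
  have e: "wiener_smooth j (- 1) (\<lambda>k. - 1 + D k)" using wiener_smooth_add[OF wiener_smooth_const D, of "- 1"] by simp
  define Q where "Q k = F k * (- 1 + D k) + (U k / 2) * D k" for k
  have Q: "wiener_smooth j (- 1) Q"
    unfolding Q_def[abs_def]
    using wiener_smooth_add[OF wiener_smooth_mult[OF F e] wiener_smooth_mult[OF wiener_smooth_divide[OF U, of 2] D]] by simp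
  have QW: "Q k = W k * D k / 2" for k unfolding Q_def kD[symmetric] W by (simp add: algebra_simps add_divide_distrib)
  have Qnz: "Q k \<noteq> 0" for k unfolding QW using nz Dnz by simp
  have iQ: "wiener_smooth j (- 1) (\<lambda>k. inverse (Q k))" using wiener_smooth_inverse[OF _ Qnz Q] by simp
  have T: "wiener_smooth j 1 (\<lambda>k. (- 1 + D k) * inverse (Q k))" using wiener_smooth_mult[OF e iQ] by simp
  have R: "wiener_smooth j 0 (\<lambda>k. ((X k / 2) * D k) * inverse (Q k))"
    using wiener_smooth_mult[OF wiener_smooth_mult[OF wiener_smooth_divide[OF X, of 2] D] iQ] by simp
  have "(- 1 + D k) * inverse (Q k) = 2 * \<i> * of_real k / W k" for k
    unfolding kD[symmetric] QW using nz[of k] Dnz[of k] by (simp add: field_simps)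
  moreover have "((X k / 2) * D k) * inverse (Q k) = X k / W k" for k
    unfolding QW using nz[of k] Dnz[of k] by (simp add: field_simps)
  ultimately show ?thesis using T R by blast
qed

text \<open>In the resonant case the identities for \<open>\<Psi>\<close> extract the factor \<open>k\<close> from both Wronskians.\<close>
lemma scattering_quotients:
  fixes F G \<Psi> F' G' \<Psi>' :: "real \<Rightarrow> complex"
  assumes F: "wiener_smooth j 1 F" and G: "wiener_smooth j 0 G" and \<Psi>: "wiener_smooth j 0 \<Psi>"
    and F': "wiener_smooth j 1 F'" and G': "wiener_smooth j 0 G'" and \<Psi>': "wiener_smooth j 0 \<Psi>'"
    and id: "\<And>k. G k * F 0 - F k * G 0 = \<i> * of_real k * \<Psi> k"
    and id': "\<And>k. G' k * F' 0 - F' k * G' 0 = \<i> * of_real k * \<Psi>' k"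
    and nz: "F 0 \<noteq> 0 \<or> G 0 \<noteq> 0" and nz': "F' 0 \<noteq> 0 \<or> G' 0 \<noteq> 0"
    and cnj: "\<And>k. F (- k) = cnj (F k)" "\<And>k. G (- k) = cnj (G k)"
    and wr: "\<And>k. F k * cnj (G k) - G k * cnj (F k) = 2 * \<i> * of_real k * (F k * cnj (F k) - 1)"
    and wr': "\<And>k. F' k * cnj (G' k) - G' k * cnj (F' k) = 2 * \<i> * of_real k * (F' k * cnj (F' k) - 1)"
    and W: "\<And>k. W k = 2 * \<i> * of_real k * F' k * F k + F' k * G k + G' k * F k"
    and X: "\<And>k. X k = F' k * G (- k) + G' k * F (- k)"
  shows "\<exists>T R. wiener_smooth j 1 T \<and> wiener_smooth j 0 R \<and>
    (\<forall>k. k \<noteq> 0 \<longrightarrow> T k = 2 * \<i> * of_real k / W k \<and> R k = X k / W k)"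
proof -
  have lower: "2 * \<bar>k\<bar> \<le> norm (W k)" for k
  proof -
    have "(norm (W k))\<^sup>2 = 4 * k\<^sup>2 + (norm (X k))\<^sup>2"
      unfolding W X cnj by (rule transition_determinant[OF wr' wr])
    then have "(2 * \<bar>k\<bar>)\<^sup>2 \<le> (norm (W k))\<^sup>2" by (simp add: power_mult_distrib)
    then show ?thesis by (rule power2_le_imp_le) simp
  qed
  have Fr: "wiener_smooth j 1 (\<lambda>k. F (- k))" and Gr: "wiener_smooth j 0 (\<lambda>k. G (- k))" and \<Psi>r: "wiener_smooth j 0 (\<lambda>k. \<Psi> (- k))"
    using F G \<Psi> by (auto intro: wiener_smooth_reflect)
  have FF: "wiener_smooth j 1 (\<lambda>k. F' k * F k)" using wiener_smooth_mult[OF F' F] by simp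
  have idr: "G (- k) * F 0 - F (- k) * G 0 = - (\<i> * of_real k * \<Psi> (- k))" for k using id[of "- k"] by simp
  \<comment> \<open>W(0) = 0 says F'(0) G(0) + G'(0) F(0) = 0. Which of \<open>F\<close> and
    \<open>G\<close> can be solved for depends on whether the zero-energy solution vanishes at the
    origin.\<close>
  consider (nonres) "W 0 \<noteq> 0" | (reg) "W 0 = 0" "F 0 \<noteq> 0" "F' 0 \<noteq> 0" | (sing) "W 0 = 0" "F 0 = 0 \<or> F' 0 = 0" by blast
  then show ?thesis
  proof cases
    case nonres
    have Wnz: "W k \<noteq> 0" for k using lower[of k] nonres by (cases "k = 0") auto
    have U: "wiener_smooth j 0 (\<lambda>k. F' k * G k + G' k * F k)"
      using wiener_smooth_add[OF wiener_smooth_mult[OF F' G] wiener_smooth_mult[OF G' F]] by simp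
    have "wiener_smooth j 0 (\<lambda>k. F' k * G (- k) + G' k * F (- k))"
      using wiener_smooth_add[OF wiener_smooth_mult[OF F' Gr] wiener_smooth_mult[OF G' Fr]] by simp
    then have X': "wiener_smooth j 0 X" unfolding X[abs_def] .
    show ?thesis
      by (rule nonresonant_quotients[OF FF U X' _ Wnz]) (simp add: W algebra_simps)
  next
    case reg
    have W0: "F' 0 * G 0 + G' 0 * F 0 = 0" using reg(1) unfolding W by simp
    \<comment> \<open>Both identities are solved for \<open>G\<close> and \<open>G'\<close>. The
      terms without a factor k combine to F'(k) F(k) times a multiple of F'(0) G(0) + G'(0) F(0),
      which is 0; \<open>?Q\<close> and \<open>?Y\<close> collect what is left after dividing by 2ik
      and ik.\<close>
    let ?Q = "\<lambda>k. F' k * F k + ((F' k * \<Psi> k) / (2 * F 0) + (F k * \<Psi>' k) / (2 * F' 0))"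
    let ?Y = "\<lambda>k. (F (- k) * \<Psi>' k) / F' 0 + (F' k * \<Psi> (- k)) / (- F 0)"
    have Q: "wiener_smooth j 1 ?Q"
      using wiener_smooth_add[OF FF wiener_smooth_add[OF wiener_smooth_divide[OF wiener_smooth_mult[OF F' \<Psi>], of "2 * F 0"]
        wiener_smooth_divide[OF wiener_smooth_mult[OF F \<Psi>'], of "2 * F' 0"]]] by simp
    have Y: "wiener_smooth j 0 ?Y"
      using wiener_smooth_add[OF wiener_smooth_divide[OF wiener_smooth_mult[OF Fr \<Psi>'], of "F' 0"]
        wiener_smooth_divide[OF wiener_smooth_mult[OF F' \<Psi>r], of "- F 0"]] by simp
    have g: "G k = (F k * G 0 + \<i> * of_real k * \<Psi> k) / F 0" "G' k = (F' k * G' 0 + \<i> * of_real k * \<Psi>' k) / F' 0"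
      "G (- k) = (F (- k) * G 0 - \<i> * of_real k * \<Psi> (- k)) / F 0" for k
      using id[of k] id'[of k] idr[of k] reg by (simp_all add: field_simps)
    have G0: "G' 0 = - (F' 0 * G 0 / F 0)"
      using W0 reg(2) by (simp add: field_simps eq_neg_iff_add_eq_0)
    have WQ: "W k = 2 * \<i> * of_real k * ?Q k" for k
      unfolding W g[of k] G0 using reg by (simp add: field_simps)
    have XY: "X k = \<i> * of_real k * ?Y k" for k
      unfolding X g(2,3)[of k] G0 using reg by (simp add: field_simps)
    show ?thesis by (rule resonant_quotients[OF Q Y WQ XY lower])
  next
    case sing
    have W0: "F' 0 * G 0 + G' 0 * F 0 = 0" using sing(1) unfolding W by simp
    \<comment> \<open>If one of the two values is 0, its partner among \<open>G 0\<close>,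
      \<open>G' 0\<close> is not, and W(0) = 0 forces the other value to vanish too.\<close>
    then have z: "F 0 = 0" "F' 0 = 0" using sing(2) nz nz' by auto
    then have b: "G 0 \<noteq> 0" "G' 0 \<noteq> 0" using nz nz' by auto
    \<comment> \<open>Now \<open>F\<close> and \<open>F'\<close> themselves carry the factor k and
      are substituted in the mixed terms. The product F' F already comes with 2ik in W and stays as
      it is, providing the value 1 at infinity.\<close>
    let ?Q = "\<lambda>k. F' k * F k + ((\<Psi>' k * G k) / (- 2 * G' 0) + (G' k * \<Psi> k) / (- 2 * G 0))"
    let ?Y = "\<lambda>k. (\<Psi>' k * G (- k)) / (- G' 0) + (G' k * \<Psi> (- k)) / G 0"
    have Q: "wiener_smooth j 1 ?Q"
      using wiener_smooth_add[OF FF wiener_smooth_add[OF wiener_smooth_divide[OF wiener_smooth_mult[OF \<Psi>' G], of "- 2 * G' 0"]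
        wiener_smooth_divide[OF wiener_smooth_mult[OF G' \<Psi>], of "- 2 * G 0"]]] by simp
    have Y: "wiener_smooth j 0 ?Y"
      using wiener_smooth_add[OF wiener_smooth_divide[OF wiener_smooth_mult[OF \<Psi>' Gr], of "- G' 0"]
        wiener_smooth_divide[OF wiener_smooth_mult[OF G' \<Psi>r], of "G 0"]] by simp
    have f: "F k = - (\<i> * of_real k * \<Psi> k / G 0)" "F' k = - (\<i> * of_real k * \<Psi>' k / G' 0)"
      "F (- k) = \<i> * of_real k * \<Psi> (- k) / G 0" for k
    proof -
      have "F k * G 0 = - (\<i> * of_real k * \<Psi> k)" using id[of k] unfolding z by algebra
      then show "F k = - (\<i> * of_real k * \<Psi> k / G 0)" using b by (simp add: field_simps)
      have "F' k * G' 0 = - (\<i> * of_real k * \<Psi>' k)" using id'[of k] unfolding z by algebra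
      then show "F' k = - (\<i> * of_real k * \<Psi>' k / G' 0)" using b by (simp add: field_simps)
      show "F (- k) = \<i> * of_real k * \<Psi> (- k) / G 0" using idr[of k] z b by (simp add: field_simps)
    qed
    have WQ: "W k = 2 * \<i> * of_real k * ?Q k" for k
    proof -
      have "2 * \<i> * of_real k * ?Q k = 2 * \<i> * of_real k * F' k * F k + (- (\<i> * of_real k * \<Psi>' k / G' 0)) * G k + G' k * (- (\<i> * of_real k * \<Psi> k / G 0))"
        using b by (simp add: field_simps)
      then show ?thesis unfolding W f(1,2)[of k, symmetric] by simp
    qed
    have XY: "X k = \<i> * of_real k * ?Y k" for k
      unfolding X f(2,3)[of k] using b by (simp add: field_simps)
    show ?thesis by (rule resonant_quotients[OF Q Y WQ XY lower])
  qed
qed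

context jost_weighted
begin

text \<open>The subtracted ik f(0, x) f(k, x) cancels the part of the Wronskian that does not decay,
  leaving only terms with a factor \<open>g\<close>, so \<open>\<Phi>\<close> tends to 0. In its
  derivative both \<open>V\<close> and the terms in k^2 cancel, and everything left carries the
  factor -ik.\<close>

lemma Psi_identity: "g k 0 * h 0 0 - h k 0 * g 0 0 = \<i> * of_real k * Psi k"
proof -
  define \<Phi> where "\<Phi> x = f 0 x * f1 k x - f1 0 x * f k x - \<i> * of_real k * (f 0 x * f k x)" for x
  define \<psi> where "\<psi> x = - (\<i> * of_real k) * (g 0 x * (cis (k * x) * h k x) + h 0 x * (cis (k * x) * g k x))" for x
  have "ac_deriv \<Phi> (\<lambda>x. ((f1 0 x * f1 k x + f 0 x * (complex_of_real (V x - k\<^sup>2) * f k x)) -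
      (complex_of_real (V x - 0\<^sup>2) * f 0 x * f k x + f1 0 x * f1 k x)) - \<i> * of_real k * (f1 0 x * f k x + f 0 x * f1 k x))"
    unfolding \<Phi>_def[abs_def] by (intro ac_deriv_diff ac_deriv_mult ac_deriv_cmult ac_deriv_f ac_deriv_f1)
  then have ac: "ac_deriv \<Phi> \<psi>"
  proof (rule ac_deriv_cong)
    fix x
    show "((f1 0 x * f1 k x + f 0 x * (complex_of_real (V x - k\<^sup>2) * f k x)) -
      (complex_of_real (V x - 0\<^sup>2) * f 0 x * f k x + f1 0 x * f1 k x)) - \<i> * of_real k * (f1 0 x * f k x + f 0 x * f1 k x) = \<psi> x"
      unfolding \<psi>_def f1_zero f_zero f1_def[of k] f_def[of k] by (simp add: algebra_simps power2_eq_square)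
  qed
  have \<Phi>: "\<Phi> x = h 0 x * (cis (k * x) * g k x) - g 0 x * (cis (k * x) * h k x)" for x
    unfolding \<Phi>_def f1_zero f_zero f1_def[of k] f_def[of k] by (simp add: algebra_simps)
  have lim: "(\<Phi> \<longlongrightarrow> 0) at_top"
  proof (rule Lim_null_comparison)
    show "\<forall>\<^sub>F x in at_top. norm (\<Phi> x) \<le> hbound 0 * norm (g k x) + hbound 0 * norm (g 0 x)"
      using eventually_ge_at_top[of 0]
    proof eventually_elim
      case (elim x)
      have "norm (\<Phi> x) \<le> norm (h 0 x) * norm (g k x) + norm (h k x) * norm (g 0 x)"
        unfolding \<Phi> by (rule norm_triangle_le_diff) (simp add: norm_mult mult.commute)
      also have "\<dots> \<le> hbound 0 * norm (g k x) + hbound 0 * norm (g 0 x)"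
        by (intro add_mono mult_right_mono h_le elim) auto
      finally show ?case .
    qed
    have "((\<lambda>x. hbound 0 * norm (g k x) + hbound 0 * norm (g 0 x)) \<longlongrightarrow> hbound 0 * norm (0::complex) + hbound 0 * norm (0::complex)) at_top"
      by (intro tendsto_intros g_tendsto_0)
    then show "((\<lambda>x. hbound 0 * norm (g k x) + hbound 0 * norm (g 0 x)) \<longlongrightarrow> 0) at_top" by simp
  qed
  let ?P1 = "\<lambda>y. if 0 < y then g 0 y * (cis (k * y) * h k y) else 0"
  let ?P2 = "\<lambda>y. if 0 < y then h 0 y * (cis (k * y) * g k y) else 0"
  have ae: "AE y in lborel. indicator {0..} y *\<^sub>R \<psi> y = - (\<i> * of_real k) * (?P1 y + ?P2 y)"
    by (rule eventually_mono[OF AE_lborel_singleton[of 0]]) (auto simp: \<psi>_def indicator_def)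
  have iP: "integrable lborel (\<lambda>y. - (\<i> * of_real k) * (?P1 y + ?P2 y))"
    by (intro integrable_mult_right Bochner_Integration.integrable_add Psi1_integrable Psi2_integrable)
  have m: "(\<lambda>y. indicator {0..} y *\<^sub>R \<psi> y) \<in> borel_measurable lborel"
    unfolding \<psi>_def by measurable
  have i: "integrable lborel (\<lambda>y. indicator {0..} y *\<^sub>R \<psi> y)"
    using integrable_cong_AE[OF m borel_measurable_integrable[OF iP] ae] iP by blast
  have "0 - \<Phi> 0 = (LINT y|lborel. indicator {0..} y *\<^sub>R \<psi> y)"
    by (rule ac_deriv_limit_at_top[OF ac i lim])
  also have "\<dots> = (LINT y|lborel. - (\<i> * of_real k) * (?P1 y + ?P2 y))"
    by (rule integral_cong_AE[OF m borel_measurable_integrable[OF iP] ae])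
  also have "\<dots> = - (\<i> * of_real k) * Psi k"
    unfolding Psi_def integral_mult_right_zero
    by (simp only: Bochner_Integration.integral_add[OF Psi1_integrable Psi2_integrable])
  finally have "0 - \<Phi> 0 = - (\<i> * of_real k) * Psi k" .
  moreover have "\<Phi> 0 = h 0 0 * g k 0 - g 0 0 * h k 0" by (simp add: \<Phi>)
  ultimately show ?thesis by (simp add: algebra_simps)
qed

end

section \<open>Assembly of the scattering coefficients\<close>

lemma L1_weighted_Suc_imp_1:
  assumes "L1_weighted (j + 1) V"
  shows "L1_weighted 1 V"
proof -
  have [measurable]: "V \<in> borel_measurable borel" using assms by (simp add: L1_weighted_def)
  have "integrable lborel (\<lambda>x. (1 + \<bar>x\<bar>) ^ 1 * \<bar>V x\<bar>)"
  proof (rule integrable_bounded_by)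
    show "integrable lborel (\<lambda>x. (1 + \<bar>x\<bar>) ^ (j + 1) * \<bar>V x\<bar>)" using assms by (simp add: L1_weighted_def)
    show "norm ((1 + \<bar>x\<bar>) ^ 1 * \<bar>V x\<bar>) \<le> (1 + \<bar>x\<bar>) ^ (j + 1) * \<bar>V x\<bar>" for x
    proof -
      have "(1 + \<bar>x\<bar>) ^ 1 \<le> (1 + \<bar>x\<bar>) ^ (j + 1)" by (rule power_increasing) auto
      then have "(1 + \<bar>x\<bar>) ^ 1 * \<bar>V x\<bar> \<le> (1 + \<bar>x\<bar>) ^ (j + 1) * \<bar>V x\<bar>" by (rule mult_right_mono) simp
      then show ?thesis by (simp add: abs_mult)
    qed
  qed measurable
  then show ?thesis by (simp add: L1_weighted_def)
qed

text \<open>The coefficients at k = 0 are defined by \<open>Lim\<close>; continuity of the algebra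
  element that agrees with the quotient off 0 shows that this limit exists and identifies
  it.\<close>

lemma Lim_at_0_eq:
  assumes "wiener_smooth j c T" "\<And>k. k \<noteq> 0 \<Longrightarrow> T k = w k"
  shows "Lim (at 0) w = T 0"
proof (rule tendsto_Lim)
  have "isCont T 0" using wiener_smooth_continuous[OF assms(1)] by (simp add: continuous_on_eq_continuous_at)
  then have "(T \<longlongrightarrow> T 0) (at 0)" by (simp add: isCont_def)
  then show "(w \<longlongrightarrow> T 0) (at 0)"
    by (rule Lim_transform_eventually) (auto simp: eventually_at_filter assms(2))
qed simp

theorem theorem2p2:
  fixes V :: "real \<Rightarrow> real" and j :: nat
  assumes "L1_weighted (j + 1) V"
  shows "differentiable_upto j (\<lambda>k. transmission V k - 1) \<and>
         differentiable_upto j (refl_plus V) \<and>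
         differentiable_upto j (refl_minus V) \<and>
         (\<forall>l\<le>j. nth_deriv l (\<lambda>k. transmission V k - 1) \<in> wiener_algebra \<and>
                 nth_deriv l (refl_plus V) \<in> wiener_algebra \<and>
                 nth_deriv l (refl_minus V) \<in> wiener_algebra)"
proof -
  have V1: "L1_weighted 1 V" by (rule L1_weighted_Suc_imp_1[OF assms])
  interpret P: jost_weighted V j by standard (rule V1 assms)+
  interpret M: jost_weighted "\<lambda>x. V (- x)" j
    by standard (rule L1_weighted_reflect[OF V1] L1_weighted_reflect[OF assms])+
  define F G F' G' where "F k = P.h k 0" and "G k = P.g k 0" and "F' k = M.h k 0" and "G' k = M.g k 0" for k
  define W where "W k = 2 * \<i> * of_real k * F' k * F k + F' k * G k + G' k * F k" for k
  have jp: "(\<lambda>x. jost_plus V x k) = P.f k" for k by (simp add: P.jost_plus_eq fun_eq_iff)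
  have jm: "(\<lambda>x. jost_minus V x k) = (\<lambda>x. M.f k (- x))" for k using M.jost_minus_eq[of _ k] by (simp add: fun_eq_iff)
  \<comment> \<open>The sign from reflection turns the difference in the Wronskian into the
    symmetric sums of products in \<open>W0\<close>, \<open>Wp\<close> and
    \<open>Wm\<close>.\<close>
  have dM: "vector_derivative (\<lambda>x. M.f k (- x)) (at 0) = - M.f1 k 0" for k
    using vector_derivative_reflect[of "M.f k" 0] M.f_has_vector_derivative
    by (auto simp: M.vector_derivative_f intro: differentiableI_vector)
  have W0: "W0 V k = W k" for k
    unfolding W0_def wronskian_def jp jm dM P.vector_derivative_f
    by (simp add: W_def F_def G_def F'_def G'_def P.f1_at_0 M.f1_at_0 P.f_at_0 M.f_at_0 algebra_simps)
  have Wp: "W_plus V k = F' k * G (- k) + G' k * F (- k)" for k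
    unfolding W_plus_def wronskian_def jp jm dM P.vector_derivative_f
    by (simp add: F_def G_def F'_def G'_def P.f1_at_0 M.f1_at_0 P.f_at_0 M.f_at_0 algebra_simps)
  have Wm: "W_minus V k = - (F k * G' (- k) + G k * F' (- k))" for k
    unfolding W_minus_def wronskian_def jp jm dM P.vector_derivative_f
    by (simp add: F_def G_def F'_def G'_def P.f1_at_0 M.f1_at_0 P.f_at_0 M.f_at_0 algebra_simps)
  have F: "wiener_smooth j 1 F" "wiener_smooth j 0 G" "wiener_smooth j 1 F'" "wiener_smooth j 0 G'"
    unfolding F_def G_def F'_def G'_def
    by (rule P.wiener_smooth_h0 P.wiener_smooth_g0 M.wiener_smooth_h0 M.wiener_smooth_g0)+
  note rels = P.wiener_smooth_Psi M.wiener_smooth_Psi P.Psi_identity M.Psi_identity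
    P.initial_data_nonzero M.initial_data_nonzero P.h_minus P.g_minus M.h_minus M.g_minus
    P.wronskian_conjugate M.wronskian_conjugate
  obtain T R where T: "wiener_smooth j 1 T" and R: "wiener_smooth j 0 R"
    and TR: "\<And>k. k \<noteq> 0 \<Longrightarrow> T k = 2 * \<i> * of_real k / W k" "\<And>k. k \<noteq> 0 \<Longrightarrow> R k = W_plus V k / W k"
    using scattering_quotients[OF F(1,2) P.wiener_smooth_Psi F(3,4) M.wiener_smooth_Psi, where W=W and X="W_plus V"]
      rels(3-) by (auto simp: W_def Wp F_def G_def F'_def G'_def)
  \<comment> \<open>The Wronskian \<open>W\<close> is symmetric under exchanging the two sides, so
    the same lemma with the roles of \<open>V\<close> and its reflection swapped gives the other
    reflection coefficient.\<close>
  obtain R' where R': "wiener_smooth j 0 R'" "\<And>k. k \<noteq> 0 \<Longrightarrow> R' k = - W_minus V k / W k"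
    using scattering_quotients[OF F(3,4) M.wiener_smooth_Psi F(1,2) P.wiener_smooth_Psi, where W=W and X="\<lambda>k. - W_minus V k"]
      rels(3-) by (auto simp: W_def Wm F_def G_def F'_def G'_def algebra_simps)
  have trans: "transmission V k = T k" for k
    using TR(1)[of k] Lim_at_0_eq[OF T, of "\<lambda>q. 2 * \<i> * of_real q / W0 V q"] TR(1)
    by (auto simp: transmission_def W0)
  have rp: "refl_plus V k = - 1 * R k" for k
    using TR(2)[of k] Lim_at_0_eq[OF wiener_smooth_cmult[OF R, of "- 1"], of "\<lambda>q. - W_plus V q / W0 V q"] TR(2)
    by (auto simp: refl_plus_def W0)
  have rm: "refl_minus V k = - 1 * R' k" for k
    using R'(2)[of k] Lim_at_0_eq[OF wiener_smooth_cmult[OF R'(1), of "- 1"], of "\<lambda>q. W_minus V q / W0 V q"] R'(2)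
    by (auto simp: refl_minus_def W0)
  have "wiener_smooth j 0 (\<lambda>k. transmission V k - 1)"
    using wiener_smooth_add[OF T wiener_smooth_const[of j "- 1"]] by (simp add: trans)
  moreover have "wiener_smooth j 0 (refl_plus V)"
    using wiener_smooth_cmult[OF R, of "- 1"] by (simp add: rp[abs_def])
  moreover have "wiener_smooth j 0 (refl_minus V)"
    using wiener_smooth_cmult[OF R'(1), of "- 1"] by (simp add: rm[abs_def])
  ultimately show ?thesis
    by (intro conjI allI impI wiener_smooth_nth_deriv)
qed

end
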